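(* Let $\mathcal{H}$ be a Hilbert space with norm $\mathcal{N}$, and let $C\subset\mathbb{R}^n$ be an open convex cone which is contained in or is any of the $2^n$ $n$-rants $C_v$. Let $\mathbf{f}:T^C\to\mathcal{H}$ be analytic on $T^C=\mathbb{R}^n+iC$. Assume that there are a nonnegative integer $R$ and an integer $k>1$ such that for every compact subcone $C'\subset C$ and every $r>0$ there is a constant $M(C',r)$ (depending on $C'$ and $r$, while $R$ and $k$ depend on neither) with $$\mathcal{N}(\mathbf{f}(x+iy))\le M(C',r)\,(1+|x|)^{R}\,|y|^{-k},\qquad x\in\mathbb{R}^n,\ y\in C'\setminus (C'\cap N(\overline{0},r)).$$ Assume that the boundary value of $\mathbf{f}$ in $\mathcal{S}'(\mathbb{R}^n,\mathcal{H})$ is a function $\mathbf{h}\in L^2(\mathbb{R}^n,\mathcal{H})$, i.e. $$\lim_{y\to\overline{0},\,y\in C}\mathcal{N}\Big(\int_{\mathbb{R}^n}\mathbf{f}(x+iy)\phi(x)\,dx-\int_{\mathbb{R}^n}\mathbf{h}(x)\phi(x)\,dx\Big)=0,\qquad \phi\in\mathcal{S}(\mathbb{R}^n).$$ Then $\mathbf{f}\in H^2(T^C,\mathcal{H})$ and $$\mathbf{f}(z)=\int_{\mathbb{R}^n}\mathbf{h}(t)\,Q(z;t)\,dt,\qquad z\in T^C.$$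
   Context: A set $C\subset\mathbb{R}^n$ is a cone (with vertex $\overline{0}=(0,\dots,0)$) if $y\in C$ implies $\lambda y\in C$ for all $\lambda>0$. Its projection $pr(C)$ is its intersection with the unit sphere $|y|=1$. A cone $C'\subset C$ is a compact subcone of $C$ if $pr(\overline{C'})\subset pr(C)$. The dual cone is $C^*=\{t\in\mathbb{R}^n:\langle t,y\rangle\ge 0\text{ for all }y\in C\}$. For $v=(v_1,\dots,v_n)\in\{0,1\}^n$, the $n$-rant is $C_v=\{y\in\mathbb{R}^n:(-1)^{v_j}y_j>0,\ j=1,\dots,n\}$. $N(\overline{0},r)$ is the closed ball of radius $r$ centered at $\overline{0}$. "$y\to\overline{0}$, $y\in C$" means $y\to\overline{0}$ with $y\in C'$, for every compact subcone $C'$ of $C$. $L^p(\mathbb{R}^n,\mathcal{H})$, $1\le p<\infty$, is the space of strongly measurable functions $\mathbf{f}:\mathbb{R}^n\to\mathcal{H}$ with $\int_{\mathbb{R}^n}(\mathcal{N}(\mathbf{f}(t)))^p\,dt<\infty$. $\mathcal{S}(\mathbb{R}^n)$ is the Schwartz space of scalar rapidly decreasing functions and $\mathcal{S}'(\mathbb{R}^n,\mathcal{H})$ is the space of $\mathcal{H}$-valued tempered distributions (continuous linear maps $\mathcal{S}(\mathbb{R}^n)\to\mathcal{H}$); a function $\mathbf{f}$ acts by $\langle\mathbf{f},\phi\rangle=\int\mathbf{f}(t)\phi(t)\,dt$ (Bochner integral). The Hardy space $H^p(T^C,\mathcal{H})$, $1\le p<\infty$, consists of the analytic functions $\mathbf{f}:T^C\to\mathcal{H}$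 for which there is a constant $A$ independent of $y\in C$ with $\int_{\mathbb{R}^n}(\mathcal{N}(\mathbf{f}(x+iy)))^p\,dx\le A$ for all $y\in C$. The Cauchy kernel of $T^C$ is $K(z-t)=\int_{C^*}e^{2\pi i\langle z-t,\eta\rangle}\,d\eta$, i.e. $K(z)=\int_{C^*}e^{2\pi i\langle z,\eta\rangle}\,d\eta$ for $z\in T^C$, and the Poisson kernel of $T^C$ is $Q(z;t)=\dfrac{|K(z-t)|^2}{K(2iy)}$, for $t\in\mathbb{R}^n$, $z=x+iy\in T^C$. *)

theory Defs
  imports "HOL-Analysis.Analysis"
begin

section \<open>Complex Hilbert spaces\<close>

text \<open>No separability is assumed. The inner product is linear in its first argument.\<close>

class complex_hilbert_space = banach +
  fixes scaleC :: "complex \<Rightarrow> 'a \<Rightarrow> 'a" (infixr "*\<^sub>C" 75)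
    and cinner :: "'a \<Rightarrow> 'a \<Rightarrow> complex"
  assumes scaleC_add_right: "c *\<^sub>C (x + y) = c *\<^sub>C x + c *\<^sub>C y"
    and scaleC_add_left: "(b + c) *\<^sub>C x = b *\<^sub>C x + c *\<^sub>C x"
    and scaleC_scaleC: "b *\<^sub>C c *\<^sub>C x = (b * c) *\<^sub>C x"
    and scaleC_of_real: "complex_of_real r *\<^sub>C x = r *\<^sub>R x"
    and cinner_commute: "cinner x y = cnj (cinner y x)"
    and cinner_add_left: "cinner (x + y) z = cinner x z + cinner y z"
    and cinner_scaleC_left: "cinner (c *\<^sub>C x) y = c * cinner x y"
    and cinner_self: "cinner x x = complex_of_real ((norm x)\<^sup>2)"

instantiation complex :: complex_hilbert_space
begin
definition scaleC_complex :: "complex \<Rightarrow> complex \<Rightarrow> complex"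
  where "scaleC_complex c x = c * x"
definition cinner_complex :: "complex \<Rightarrow> complex \<Rightarrow> complex"
  where "cinner_complex x y = x * cnj y"
instance
proof
  fix x :: complex
  show "cinner x x = complex_of_real ((norm x)\<^sup>2)"
    by (simp only: cinner_complex_def complex_norm_square)
qed (simp_all add: scaleC_complex_def cinner_complex_def distrib_left distrib_right
       scaleR_conv_of_real)
end

section \<open>Strong measurability and the Bochner integral\<close>

text \<open>The Bochner integral of HOL-Analysis is restricted to second-countable range spaces.
  The following is the same definition, with Borel measurability replaced by strong
  measurability, for an arbitrary normed range space. It is used with the Lebesgue measure,
  which is complete.\<close>

definition strongly_measurable :: "'a measure \<Rightarrow> ('a \<Rightarrow> 'b::real_normed_vector) \<Rightarrow> bool"
  where "strongly_measurable M f \<longleftrightarrow>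
    (\<exists>s. (\<forall>i::nat. simple_function M (s i)) \<and> (AE x in M. (\<lambda>i. s i x) \<longlonglongrightarrow> f x))"

definition has_strong_integral ::
    "'a measure \<Rightarrow> ('a \<Rightarrow> 'b::real_normed_vector) \<Rightarrow> 'b \<Rightarrow> bool"
  where "has_strong_integral M f I \<longleftrightarrow>
    strongly_measurable M f \<and>
    (\<exists>s. (\<forall>i::nat. Bochner_Integration.simple_bochner_integrable M (s i)) \<and>
         (\<lambda>i. \<integral>\<^sup>+x. ennreal (norm (f x - s i x)) \<partial>M) \<longlonglongrightarrow> 0 \<and>
         (\<lambda>i. Bochner_Integration.simple_bochner_integral M (s i)) \<longlonglongrightarrow> I)"

definition strong_integral :: "'a measure \<Rightarrow> ('a \<Rightarrow> 'b::real_normed_vector) \<Rightarrow> 'b"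
  where "strong_integral M f =
    (if \<exists>I. has_strong_integral M f I then THE I. has_strong_integral M f I else 0)"

definition Lp_space :: "real \<Rightarrow> (real^'n \<Rightarrow> 'h::real_normed_vector) set"
  where "Lp_space p = {h. strongly_measurable lebesgue h \<and>
    (\<integral>\<^sup>+t. ennreal (norm (h t) powr p) \<partial>lebesgue) < \<infinity>}"

section \<open>Cones\<close>

text \<open>The library's \<open>cone\<close> and \<open>conic\<close> also require closure under multiplication by 0,
  which an open cone not containing the origin does not satisfy.\<close>

definition vertex_cone :: "(real^'n) set \<Rightarrow> bool"
  where "vertex_cone C \<longleftrightarrow> (\<forall>y\<in>C. \<forall>c>0. c *\<^sub>R y \<in> C)"

definition cone_pr :: "(real^'n) set \<Rightarrow> (real^'n) set"
  where "cone_pr C = C \<inter> sphere 0 1"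

definition compact_subcone :: "(real^'n) set \<Rightarrow> (real^'n) set \<Rightarrow> bool"
  where "compact_subcone C' C \<longleftrightarrow>
    vertex_cone C' \<and> C' \<subseteq> C \<and> cone_pr (closure C') \<subseteq> cone_pr C"

definition dual_cone :: "(real^'n) set \<Rightarrow> (real^'n) set"
  where "dual_cone C = {t. \<forall>y\<in>C. t \<bullet> y \<ge> 0}"

definition nrant :: "nat^'n \<Rightarrow> (real^'n) set"
  where "nrant v = {y. \<forall>j. (-1) ^ (v $ j) * y $ j > 0}"

section \<open>Tubes and analytic functions\<close>

text \<open>\<open>vcomplex x y\<close> is the point \<open>x + iy\<close>.\<close>

definition vcomplex :: "real^'n \<Rightarrow> real^'n \<Rightarrow> complex^'n"
  where "vcomplex x y = (\<chi> j. Complex (x $ j) (y $ j))"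

definition tube :: "(real^'n) set \<Rightarrow> (complex^'n) set"
  where "tube C = {vcomplex x y | x y. y \<in> C}"

text \<open>As for the library's \<open>analytic_on\<close> in one variable, analyticity is complex
  differentiability near every point: on an open set, Frechet differentiability with a
  complex linear derivative.\<close>

definition vanalytic_on ::
    "(complex^'n \<Rightarrow> 'h::complex_hilbert_space) \<Rightarrow> (complex^'n) set \<Rightarrow> bool"
  where "vanalytic_on f S \<longleftrightarrow>
    (\<forall>z\<in>S. \<exists>e>0. \<forall>w\<in>ball z e. \<exists>D. (f has_derivative D) (at w) \<and>
       (\<forall>c v. D (c *s v) = c *\<^sub>C D v))"

definition hardy_space ::
    "real \<Rightarrow> (real^'n) set \<Rightarrow> (complex^'n \<Rightarrow> 'h::complex_hilbert_space) set"
  where "hardy_space p C = {f. vanalytic_on f (tube C) \<and>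
    (\<exists>A::real. \<forall>y\<in>C.
       (\<integral>\<^sup>+x. ennreal (norm (f (vcomplex x y)) powr p) \<partial>lebesgue) \<le> ennreal A)}"

section \<open>Schwartz functions\<close>

definition partial_derivative :: "'n \<Rightarrow> (real^'n \<Rightarrow> complex) \<Rightarrow> real^'n \<Rightarrow> complex"
  where "partial_derivative j \<phi> x = frechet_derivative \<phi> (at x) (axis j 1)"

text \<open>A derivative of order \<open>m\<close> is indexed by the list of its \<open>m\<close> directions rather than by a
  multi-index.\<close>

primrec iterated_partial :: "'n list \<Rightarrow> (real^'n \<Rightarrow> complex) \<Rightarrow> real^'n \<Rightarrow> complex"
  where
    "iterated_partial [] \<phi> = \<phi>"
  | "iterated_partial (j # js) \<phi> = partial_derivative j (iterated_partial js \<phi>)"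

definition schwartz_space :: "(real^'n \<Rightarrow> complex) set"
  where "schwartz_space = {\<phi>.
    (\<forall>js x. iterated_partial js \<phi> differentiable (at x)) \<and>
    (\<forall>(\<alpha>::'n \<Rightarrow> nat) js. \<exists>B. \<forall>x.
       \<bar>\<Prod>j\<in>UNIV. (x $ j) ^ \<alpha> j\<bar> * cmod (iterated_partial js \<phi> x) \<le> B)}"

section \<open>Cauchy and Poisson kernels\<close>

text \<open>The pairing of \<open>z\<close> with \<open>\<eta>\<close> is complex bilinear, without conjugation.\<close>

definition cauchy_kernel :: "(real^'n) set \<Rightarrow> complex^'n \<Rightarrow> complex"
  where "cauchy_kernel C z = (LINT \<eta>:dual_cone C|lebesgue.
    exp (2 * of_real pi * \<i> * (\<Sum>j\<in>UNIV. z $ j * of_real (\<eta> $ j))))"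

text \<open>In the denominator, \<open>K(2iy)\<close> is a positive real number, here as an element of the
  complex numbers.\<close>

definition poisson_kernel :: "(real^'n) set \<Rightarrow> complex^'n \<Rightarrow> real^'n \<Rightarrow> complex"
  where "poisson_kernel C z t =
    of_real ((cmod (cauchy_kernel C (z - vcomplex t 0)))\<^sup>2) /
    cauchy_kernel C (vcomplex 0 (2 *\<^sub>R (\<chi> j. Im (z $ j))))"

end

theory Submission
  imports Defs "HOL-Probability.Sinc_Integral" "HOL-Probability.Characteristic_Functions" "HOL-Complex_Analysis.Cauchy_Integral_Formula"
    "HOL-Real_Asymp.Real_Asymp"
begin

text \<open>Pairing with a vector of the Hilbert space reduces the theorem to scalar functions: strong
  integrability is a matter of norms, and the value of a strong integral is determined by its
  inner products. Only the rays of \<open>C\<close> are needed as compact subcones.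

  For scalar \<open>f\<close>, shifting the contour along a ray together with an entire Gaussian test function
  shows that the convolution of \<open>f(\<cdot> + iy)\<close> with a Gaussian is the convolution of \<open>h\<close> with the
  Gaussian translated by \<open>iy\<close>. Hence the mollified \<open>f\<close> grows polynomially up to the real subspace.
  Multiplied by a damping factor and by the conjugate Cauchy kernel, it satisfies Cauchy's formula:
  its Fourier transform vanishes off the dual cone (let the height tend to infinity), and Gaussian
  summability inverts the transform. Removing the damping and then the mollification gives the
  Poisson integral; the last limit uses Scheffe's lemma.

  Jensen's inequality, Tonelli's theorem and \<open>\<integral> Q(x + iy; t) dx \<le> 1\<close> then bound the Hardy norm.\<close>

section \<open>Complex Hilbert spaces and strong integrals\<close>

text \<open>The growth bound degenerates as y tends to 0 and boundary values are attained only
  against test functions, so neither a contour integral down to the real subspace nor dominated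
  convergence applies to \<open>f\<close> itself. The mollified function is therefore defined from
  \<open>h\<close> alone: it is entire in x + iy, bounded at small height by its formula in
  \<open>h\<close>, and at large height by its agreement with the mollification of \<open>f\<close>.
  The Poisson kernel arises from the choice of multiplier. For z0 = x0 + i y0 the function w
  \<mapsto> K(w - conj z0) is holomorphic on the tube, equals K(2 i y0) at w = z0, and is the
  conjugate of K(z0 - t) at real w = t. Cauchy's formula with kernel K(z0 - t) then carries the
  weight |K(z0 - t)|^2 and leaves the factor K(2 i y0). As \<open>h\<close> is merely square
  integrable, its mollifications need not converge at every point. The mollifier is moved to the
  Poisson kernel, which is continuous and bounded. Mollified and original kernel have the same mass,
  so pointwise convergence becomes convergence in mean and, by boundedness, in mean square.\<close>

lemma cinner_add_right: "cinner x (y + z) = cinner x y + cinner x z"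
  by (metis cinner_add_left cinner_commute complex_cnj_add)

lemma cinner_scaleR_left: "cinner (r *\<^sub>R x) y = of_real r * cinner x y"
  by (metis cinner_scaleC_left scaleC_of_real)

lemma cinner_scaleC_right: "cinner x (c *\<^sub>C y) = cnj c * cinner x y"
  by (metis cinner_commute cinner_scaleC_left complex_cnj_mult)

lemma cinner_zero_left [simp]: "cinner 0 y = 0"
  using cinner_scaleR_left[of 0 0 y] by simp

lemma cinner_zero_right [simp]: "cinner y 0 = 0"
  by (metis cinner_commute cinner_zero_left complex_cnj_zero)

lemma cinner_minus_left: "cinner (- x) y = - cinner x y"
  using cinner_scaleR_left[of "-1" x y] by simp

lemma cinner_diff_left: "cinner (x - y) z = cinner x z - cinner y z"
  using cinner_add_left[of x "-y" z] by (simp add: cinner_minus_left)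

text \<open>The axioms tie the norm to real scalars only; homogeneity for complex scalars follows by
  expanding the inner square.\<close>

lemma norm_scaleC: "norm (c *\<^sub>C x) = cmod c * norm x"
proof -
  have "complex_of_real ((norm (c *\<^sub>C x))\<^sup>2) = (c * cnj c) * of_real ((norm x)\<^sup>2)"
    by (metis cinner_scaleC_left cinner_scaleC_right cinner_self mult.assoc)
  also have "\<dots> = of_real ((cmod c)\<^sup>2) * of_real ((norm x)\<^sup>2)"
    by (simp only: complex_norm_square)
  also have "\<dots> = complex_of_real ((cmod c * norm x)\<^sup>2)"
    by (simp add: power_mult_distrib)
  finally have "(norm (c *\<^sub>C x))\<^sup>2 = (cmod c * norm x)\<^sup>2"
    using of_real_eq_iff by blast
  thus ?thesis by simp
qed

text \<open>Pythagoras: \<open>a *\<^sub>C y\<close> is the orthogonal projection of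
  \<open>x\<close> on the line of \<open>y\<close> and \<open>x'\<close> the remainder, so the
  projection is no longer than \<open>x\<close>.\<close>

lemma cinner_Cauchy_Schwarz: "cmod (cinner x y) \<le> norm x * norm y"
proof (cases "y = 0")
  case False
  define a where "a = cinner x y / of_real ((norm y)\<^sup>2)"
  define x' where "x' = x - a *\<^sub>C y"
  have o: "cinner x' y = 0"
    using False by (simp add: x'_def a_def cinner_diff_left cinner_scaleC_left cinner_self)
  have o': "cinner y x' = 0" by (metis cinner_commute complex_cnj_zero o)
  have "x = x' + a *\<^sub>C y" by (simp add: x'_def)
  hence "cinner x x = cinner x' x' + (a * cnj a) * cinner y y"
    by (simp add: cinner_add_left cinner_add_right cinner_scaleC_left cinner_scaleC_right o o')
  hence "complex_of_real ((norm x)\<^sup>2)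
      = of_real ((norm x')\<^sup>2) + of_real ((cmod a)\<^sup>2) * of_real ((norm y)\<^sup>2)"
    by (simp only: cinner_self complex_norm_square)
  hence "complex_of_real ((norm x)\<^sup>2) = of_real ((norm x')\<^sup>2 + (cmod a)\<^sup>2 * (norm y)\<^sup>2)"
    by simp
  hence "(norm x)\<^sup>2 = (norm x')\<^sup>2 + (cmod a)\<^sup>2 * (norm y)\<^sup>2"
    using of_real_eq_iff by blast
  hence "(cmod a * norm y)\<^sup>2 \<le> (norm x)\<^sup>2" by (simp add: power_mult_distrib)
  hence "cmod a * norm y \<le> norm x" by (rule power2_le_imp_le) simp
  moreover have "cmod (cinner x y) = cmod a * norm y * norm y"
    using False by (simp add: a_def norm_divide norm_power norm_mult power2_eq_square)
  ultimately show ?thesis by (simp add: mult_right_mono)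
qed simp

lemma bounded_linear_cinner_left: "bounded_linear (\<lambda>x. cinner x e)"
  by (rule bounded_linear_intro[where K="norm e"])
     (simp_all add: cinner_add_left cinner_scaleR_left scaleR_conv_of_real cinner_Cauchy_Schwarz)

text \<open>Carries scalar identities back to the Hilbert space: uniqueness of strong integrals and
  the final Poisson formula both rest on testing against every \<open>e\<close>.\<close>

lemma cinner_eqI:
  assumes "\<And>e. cinner x e = cinner y e"
  shows "x = y"
proof -
  have "cinner (x - y) (x - y) = 0" using assms by (simp add: cinner_diff_left)
  thus ?thesis by (simp add: cinner_self)
qed

section \<open>Strong measurability over complete measures\<close>

lemma borel_measurable_completion_AE_cong:
  fixes f g :: "'a \<Rightarrow> 'b::topological_space"
  assumes f: "f \<in> borel_measurable (completion M)" and eq: "AE x in completion M. f x = g x"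
  shows "g \<in> borel_measurable (completion M)"
proof (rule measurableI)
  fix A :: "'b set" assume "A \<in> sets borel"
  with f have "f -` A \<inter> space (completion M) \<in> sets (completion M)" by (rule measurable_sets)
  thus "g -` A \<inter> space (completion M) \<in> sets (completion M)"
    by (rule completion.in_sets_AE[rotated]) (use eq in \<open>auto elim!: eventually_mono\<close>)
qed simp

text \<open>Resetting all functions to 0 on the exceptional null set makes the convergence hold
  everywhere; the limit is then altered back on that set, which completeness permits.\<close>

lemma borel_measurable_completion_LIMSEQ_AE:
  fixes f :: "'a \<Rightarrow> 'b::{metric_space,zero}"
  assumes s: "\<And>i. s i \<in> borel_measurable (completion M)"
    and lim: "AE x in completion M. (\<lambda>i. s i x) \<longlonglongrightarrow> f x"
  shows "f \<in> borel_measurable (completion M)"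
proof -
  obtain N where "N \<in> sets (completion M)" "emeasure (completion M) N = 0"
    and N2: "{x \<in> space (completion M). \<not> (\<lambda>i. s i x) \<longlonglongrightarrow> f x} \<subseteq> N"
    using lim by (rule AE_E) (rule that)
  hence N: "N \<in> null_sets (completion M)"
      "{x \<in> space (completion M). \<not> (\<lambda>i. s i x) \<longlonglongrightarrow> f x} \<subseteq> N"
    by (auto simp: null_sets_def)
  have [measurable]: "N \<in> sets (completion M)" using N(1) by auto
  have "(\<lambda>x. if x \<in> N then 0 else f x) \<in> borel_measurable (completion M)"
  proof (rule borel_measurable_LIMSEQ_metric)
    show "(\<lambda>x. if x \<in> N then 0 else s i x) \<in> borel_measurable (completion M)" for i
      using s by measurable
    show "(\<lambda>i. if x \<in> N then 0 else s i x) \<longlonglongrightarrow> (if x \<in> N then 0 else f x)"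
      if "x \<in> space (completion M)" for x using N(2) that by auto
  qed
  moreover have "AE x in completion M. (if x \<in> N then 0 else f x) = f x"
    using AE_not_in[OF N(1)] by eventually_elim simp
  ultimately show ?thesis by (rule borel_measurable_completion_AE_cong)
qed

lemma strongly_measurableE:
  assumes "strongly_measurable M f"
  obtains s where "\<And>i::nat. simple_function M (s i)" "AE x in M. (\<lambda>i. s i x) \<longlonglongrightarrow> f x"
  using assms unfolding strongly_measurable_def by (elim exE conjE) (rule that, simp_all)

lemma strongly_measurableI:
  assumes "\<And>i::nat. simple_function M (s i)" "AE x in M. (\<lambda>i. s i x) \<longlonglongrightarrow> f x"
  shows "strongly_measurable M f"
  using assms unfolding strongly_measurable_def by (intro exI[of _ s] conjI allI)

text \<open>Norms and inner products of strongly measurable functions are Borel without any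
  separability: a continuous map sends the simple approximants to simple functions that still
  converge almost everywhere.\<close>

lemma strongly_measurable_compose_measurable:
  fixes f :: "'a \<Rightarrow> 'b::real_normed_vector" and \<phi> :: "'b \<Rightarrow> 'c::{metric_space,zero}"
  assumes "strongly_measurable (completion M) f" and \<phi>: "continuous_on UNIV \<phi>"
  shows "(\<lambda>x. \<phi> (f x)) \<in> borel_measurable (completion M)"
proof -
  from assms(1) obtain s where s: "\<And>i::nat. simple_function (completion M) (s i)"
      "AE x in completion M. (\<lambda>i. s i x) \<longlonglongrightarrow> f x"
    by (rule strongly_measurableE) (rule that)
  show ?thesis
  proof (rule borel_measurable_completion_LIMSEQ_AE)
    show "(\<lambda>x. \<phi> (s i x)) \<in> borel_measurable (completion M)" for i
      by (rule borel_measurable_simple_function[OF simple_function_compose1[OF s(1)]])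
    show "AE x in completion M. (\<lambda>i. \<phi> (s i x)) \<longlonglongrightarrow> \<phi> (f x)"
      using s(2)
    proof eventually_elim
      case (elim x)
      have "isCont \<phi> (f x)" using \<phi> by (simp add: continuous_on_eq_continuous_at)
      thus ?case using elim by (rule isCont_tendsto_compose)
    qed
  qed
qed

lemma strongly_measurable_scaleC:
  fixes f :: "'a \<Rightarrow> 'b::complex_hilbert_space"
  assumes a: "a \<in> borel_measurable M" and f: "strongly_measurable M f"
  shows "strongly_measurable M (\<lambda>x. a x *\<^sub>C f x)"
proof -
  from f obtain s where s: "\<And>i::nat. simple_function M (s i)"
      "AE x in M. (\<lambda>i. s i x) \<longlonglongrightarrow> f x"
    by (rule strongly_measurableE) (rule that)
  obtain r where r': "\<forall>i. simple_function M (r i)" "\<forall>x\<in>space M. (\<lambda>i. r i x) \<longlonglongrightarrow> a x"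
    using borel_measurable_implies_sequence_metric[OF a, of 0] by (elim exE conjE) (rule that)
  note r = r'[rule_format]
  have "simple_function M (\<lambda>x. r i x *\<^sub>C s i x)" for i
    by (rule simple_function_compose2[OF r(1) s(1)])
  moreover have "AE x in M. (\<lambda>i. r i x *\<^sub>C s i x) \<longlonglongrightarrow> a x *\<^sub>C f x"
    using s(2) AE_space
  proof eventually_elim
    case (elim x)
    \<comment> \<open>Majorant obtained from r s - a f = r (s - f) + (r - a) f.\<close>
    have "(\<lambda>i. cmod (r i x) * norm (s i x - f x) + cmod (r i x - a x) * norm (f x))
        \<longlonglongrightarrow> cmod (a x) * norm (f x - f x) + cmod (a x - a x) * norm (f x)"
      using elim r(2)[of x] by (intro tendsto_intros)
    hence z: "(\<lambda>i. cmod (r i x) * norm (s i x - f x) + cmod (r i x - a x) * norm (f x)) \<longlonglongrightarrow> 0"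
      by simp
    have "norm (r i x *\<^sub>C s i x - a x *\<^sub>C f x)
        \<le> cmod (r i x) * norm (s i x - f x) + cmod (r i x - a x) * norm (f x)" for i
    proof -
      have "r i x *\<^sub>C s i x = r i x *\<^sub>C (s i x - f x) + ((r i x - a x) *\<^sub>C f x + a x *\<^sub>C f x)"
        by (simp flip: scaleC_add_right scaleC_add_left)
      hence "r i x *\<^sub>C s i x - a x *\<^sub>C f x = r i x *\<^sub>C (s i x - f x) + (r i x - a x) *\<^sub>C f x"
        by simp
      thus ?thesis by (metis norm_scaleC norm_triangle_ineq)
    qed
    hence "(\<lambda>i. r i x *\<^sub>C s i x - a x *\<^sub>C f x) \<longlonglongrightarrow> 0"
      by (intro Lim_null_comparison[OF _ z]) simp
    thus ?case using Lim_null by blast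
  qed
  ultimately show ?thesis by (rule strongly_measurableI)
qed

text \<open>Separability is taken from the domain, not from the range: simple functions approximate
  the identity of the domain, and \<open>f\<close> is composed with them. The point \<open>z\<close>
  in the proof merely anchors those approximants.\<close>

lemma strongly_measurable_continuous:
  fixes f :: "'a::{metric_space,second_countable_topology} \<Rightarrow> 'b::real_normed_vector"
  assumes "continuous_on UNIV f" and id: "(\<lambda>x. x) \<in> borel_measurable M"
  shows "strongly_measurable M f"
proof -
  fix z :: 'a
  obtain r where r': "\<forall>i. simple_function M (r i)" "\<forall>x\<in>space M. (\<lambda>i. r i x) \<longlonglongrightarrow> x"
    using borel_measurable_implies_sequence_metric[OF id, of z] by (elim exE conjE) (rule that)
  note r = r'[rule_format]
  have "simple_function M (\<lambda>x. f (r i x))" for i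
    by (rule simple_function_compose1[OF r(1)])
  moreover have "(\<lambda>i. f (r i x)) \<longlonglongrightarrow> f x" if "x \<in> space M" for x
    using assms(1) r(2)[OF that] by (intro isCont_tendsto_compose[of x f]) (simp_all add: continuous_on_eq_continuous_at)
  ultimately show ?thesis by (intro strongly_measurableI[where s="\<lambda>i x. f (r i x)"]) auto
qed

text \<open>The given approximants need not be integrable, so each is cut to 0 where its norm
  exceeds twice a simple minorant \<open>q\<close> of \<open>norm (f x)\<close>. The threshold uses
  \<open>q\<close> rather than the norm itself to keep the cut function simple. The factor 2 leaves
  strict room, so the cut is eventually inactive wherever \<open>f x\<close> is nonzero.\<close>

lemma strongly_measurable_approx:
  fixes f :: "'a \<Rightarrow> 'b::real_normed_vector"
  assumes f: "strongly_measurable (completion M) f"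
  obtains s where "\<And>i::nat. simple_function (completion M) (s i)"
    "AE x in completion M. (\<lambda>i. s i x) \<longlonglongrightarrow> f x"
    "\<And>i x. norm (s i x) \<le> 2 * norm (f x)"
proof -
  let ?M = "completion M"
  from f obtain s where s: "\<And>i::nat. simple_function ?M (s i)"
      "AE x in ?M. (\<lambda>i. s i x) \<longlonglongrightarrow> f x"
    by (rule strongly_measurableE) (rule that)
  have nf: "(\<lambda>x. ennreal (norm (f x))) \<in> borel_measurable ?M"
    using strongly_measurable_compose_measurable[OF f, of norm]
    by (auto intro: continuous_on_norm_id)
  from borel_measurable_implies_simple_function_sequence'[OF nf] obtain U where
    U: "\<And>i. simple_function ?M (U i)" "incseq U" "\<And>i x. U i x < top"
    "\<And>x. (SUP i. U i x) = ennreal (norm (f x))" by blast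
  define q where "q i x = enn2real (U i x)" for i x
  have Ule: "U i x \<le> ennreal (norm (f x))" for i x by (metis U(4) SUP_upper UNIV_I)
  have q0: "0 \<le> q i x" and qle: "q i x \<le> norm (f x)" for i x
    using enn2real_mono[OF Ule[of i x]] by (auto simp: q_def)
  have qlim: "(\<lambda>i. q i x) \<longlonglongrightarrow> norm (f x)" for x
  proof -
    have "(\<lambda>i. U i x) \<longlonglongrightarrow> ennreal (norm (f x))"
      unfolding U(4)[symmetric] using U(2) by (intro LIMSEQ_SUP) (auto simp: incseq_def le_fun_def)
    from tendsto_enn2real[OF this] show ?thesis by (simp add: q_def)
  qed
  define S where "S i x = (if norm (s i x) \<le> 2 * q i x then s i x else 0)" for i x
  show ?thesis
  proof
    have *: "simple_function ?M (\<lambda>x. (s i x, U i x))" for i by (intro simple_function_Pair s U)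
    show "simple_function ?M (S i)" for i
      unfolding S_def q_def
      using simple_function_compose1[OF *[of i], of "\<lambda>(a, b). if norm a \<le> 2 * enn2real b then a else 0"]
      by simp
    show "norm (S i x) \<le> 2 * norm (f x)" for i x
      using qle[of i x] by (auto simp: S_def)
    show "AE x in ?M. (\<lambda>i. S i x) \<longlonglongrightarrow> f x"
      using s(2)
    proof eventually_elim
      case (elim x)
      show ?case
      proof (cases "f x = 0")
        case True
        hence "S i x = 0" for i using qle[of i x] q0[of i x] by (auto simp: S_def)
        thus ?thesis using True by simp
      next
        case False
        have "(\<lambda>i. 2 * q i x - norm (s i x)) \<longlonglongrightarrow> 2 * norm (f x) - norm (f x)"
          by (intro tendsto_intros qlim elim)
        moreover have "2 * norm (f x) - norm (f x) > 0" using False by simp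
        ultimately have "eventually (\<lambda>i. 2 * q i x - norm (s i x) > 0) sequentially"
          by (rule order_tendstoD)
        hence "eventually (\<lambda>i. s i x = S i x) sequentially" by eventually_elim (simp add: S_def)
        from Lim_transform_eventually[OF elim this] show ?thesis .
      qed
    qed
  qed
qed

section \<open>Existence, linear images and norm bounds of strong integrals\<close>

lemma has_strong_integralI_bounded:
  fixes f :: "'a \<Rightarrow> 'b::banach"
  assumes f: "strongly_measurable (completion M) f"
    and fin: "(\<integral>\<^sup>+x. ennreal (norm (f x)) \<partial>completion M) < \<infinity>"
  shows "\<exists>I. has_strong_integral (completion M) f I"
proof -
  let ?M = "completion M"
  from strongly_measurable_approx[OF f] obtain s where
    s: "\<And>i::nat. simple_function ?M (s i)" "AE x in ?M. (\<lambda>i. s i x) \<longlonglongrightarrow> f x"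
      "\<And>i x. norm (s i x) \<le> 2 * norm (f x)" by blast
  have nf [measurable]: "(\<lambda>x. norm (f x)) \<in> borel_measurable ?M"
    using strongly_measurable_compose_measurable[OF f, of norm] by (auto intro: continuous_on_norm_id)
  have sm: "strongly_measurable ?M (\<lambda>x. f x - s i x)" for i
  proof -
    have "AE x in ?M. (\<lambda>j. s j x - s i x) \<longlonglongrightarrow> f x - s i x"
      using s(2) by eventually_elim (intro tendsto_intros)
    thus ?thesis
      by (rule strongly_measurableI[rotated]) (intro simple_function_compose2[where h="(-)"] s)
  qed
  have nd [measurable]: "(\<lambda>x. norm (f x - s i x)) \<in> borel_measurable ?M" for i
    using strongly_measurable_compose_measurable[OF sm, of norm] by (auto intro: continuous_on_norm_id)
  have int: "Bochner_Integration.simple_bochner_integrable ?M (s i)" for i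
  proof (rule simple_bochner_integrableI_bounded[OF s(1)])
    have "(\<integral>\<^sup>+x. ennreal (norm (s i x)) \<partial>?M) \<le> (\<integral>\<^sup>+x. 2 * ennreal (norm (f x)) \<partial>?M)"
    proof (rule nn_integral_mono)
      fix x
      have "ennreal (norm (s i x)) \<le> ennreal (2 * norm (f x))" using s(3) by (rule ennreal_leI)
      thus "ennreal (norm (s i x)) \<le> 2 * ennreal (norm (f x))" by (simp add: ennreal_mult')
    qed
    also have "\<dots> = 2 * (\<integral>\<^sup>+x. ennreal (norm (f x)) \<partial>?M)" by (intro nn_integral_cmult) simp
    also have "\<dots> < \<infinity>" using fin by (simp add: ennreal_mult_less_top)
    finally show "(\<integral>\<^sup>+x. ennreal (norm (s i x)) \<partial>?M) < \<infinity>" .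
  qed
  have lim: "(\<lambda>i. \<integral>\<^sup>+x. ennreal (norm (f x - s i x)) \<partial>?M) \<longlonglongrightarrow> 0"
  proof -
    have "(\<lambda>i. \<integral>\<^sup>+x. ennreal (norm (f x - s i x)) \<partial>?M) \<longlonglongrightarrow> (\<integral>\<^sup>+x. 0 \<partial>?M)"
    \<comment> \<open>The constant 3 is one \<open>norm (f x)\<close> for \<open>f\<close> itself
      and two for the truncated approximant.\<close>
    proof (rule nn_integral_dominated_convergence[where w="\<lambda>x. 3 * ennreal (norm (f x))"])
      show "(\<integral>\<^sup>+x. 3 * ennreal (norm (f x)) \<partial>?M) < \<infinity>"
        using fin by (subst nn_integral_cmult) (auto simp: ennreal_mult_less_top)
      show "AE x in ?M. ennreal (norm (f x - s i x)) \<le> 3 * ennreal (norm (f x))" for i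
      proof (rule AE_I2)
        fix x
        have "norm (f x - s i x) \<le> 3 * norm (f x)"
          using norm_triangle_ineq4[of "f x" "s i x"] s(3)[of i x] by simp
        hence "ennreal (norm (f x - s i x)) \<le> ennreal (3 * norm (f x))" by (rule ennreal_leI)
        thus "ennreal (norm (f x - s i x)) \<le> 3 * ennreal (norm (f x))" by (simp add: ennreal_mult')
      qed
      show "AE x in ?M. (\<lambda>i. ennreal (norm (f x - s i x))) \<longlonglongrightarrow> 0"
        using s(2)
      proof eventually_elim
        case (elim x)
        have "(\<lambda>i. ennreal (norm (f x - s i x))) \<longlonglongrightarrow> ennreal (norm (f x - f x))"
          by (intro tendsto_intros elim)
        thus ?case by simp
      qed
    qed simp_all
    thus ?thesis by simp
  qed
  have bd: "ennreal (norm (Bochner_Integration.simple_bochner_integral ?M (s i) - Bochner_Integration.simple_bochner_integral ?M (s j)))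
    \<le> (\<integral>\<^sup>+x. ennreal (norm (f x - s i x)) \<partial>?M) + (\<integral>\<^sup>+x. ennreal (norm (f x - s j x)) \<partial>?M)" for i j
  proof -
    let ?d = "\<lambda>x. s i x - s j x"
    have d: "Bochner_Integration.simple_bochner_integrable ?M ?d"
      using Bochner_Integration.simple_bochner_integrable_compose2[of "(-)" ?M "s i" "s j"] int by simp
    have "ennreal (norm (Bochner_Integration.simple_bochner_integral ?M (s i) - Bochner_Integration.simple_bochner_integral ?M (s j)))
        = ennreal (norm (Bochner_Integration.simple_bochner_integral ?M ?d))"
      using int by (subst Bochner_Integration.simple_bochner_integral_diff) auto
    also have "\<dots> \<le> ennreal (Bochner_Integration.simple_bochner_integral ?M (\<lambda>x. norm (?d x)))"
      by (intro ennreal_leI Bochner_Integration.simple_bochner_integral_norm_bound d)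
    also have "\<dots> = (\<integral>\<^sup>+x. ennreal (norm (?d x)) \<partial>?M)"
      using Bochner_Integration.simple_bochner_integrable_compose2[of "\<lambda>x y. norm (x - y)" ?M "s i" "s j"] int
      by (intro Bochner_Integration.simple_bochner_integral_eq_nn_integral) auto
    also have "\<dots> \<le> (\<integral>\<^sup>+x. ennreal (norm (f x - s i x)) + ennreal (norm (f x - s j x)) \<partial>?M)"
    proof (rule nn_integral_mono)
      fix x
      have "norm (?d x) \<le> norm (f x - s i x) + norm (f x - s j x)"
        using norm_triangle_ineq4[of "f x - s j x" "f x - s i x"] by simp
      from ennreal_leI[OF this]
      show "ennreal (norm (?d x)) \<le> ennreal (norm (f x - s i x)) + ennreal (norm (f x - s j x))" by simp
    qed
    also have "\<dots> = (\<integral>\<^sup>+x. ennreal (norm (f x - s i x)) \<partial>?M) + (\<integral>\<^sup>+x. ennreal (norm (f x - s j x)) \<partial>?M)"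
      by (intro nn_integral_add) auto
    finally show ?thesis .
  qed
  \<comment> \<open>The mean distances to \<open>f\<close> tend to 0, so \<open>bd\<close> makes the
    integrals of the approximants a Cauchy sequence; completeness of the range supplies the
    value.\<close>
  have "Cauchy (\<lambda>i. Bochner_Integration.simple_bochner_integral ?M (s i))"
  proof (rule metric_CauchyI)
    fix e :: real assume e: "e > 0"
    hence "0 < ennreal (e / 2)" by simp
    from order_tendstoD(2)[OF lim this] obtain N where
      N: "\<And>i. i \<ge> N \<Longrightarrow> (\<integral>\<^sup>+x. ennreal (norm (f x - s i x)) \<partial>?M) < ennreal (e / 2)"
      by (auto simp: eventually_sequentially)
    show "\<exists>N. \<forall>m\<ge>N. \<forall>n\<ge>N. dist (Bochner_Integration.simple_bochner_integral ?M (s m)) (Bochner_Integration.simple_bochner_integral ?M (s n)) < e"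
    proof (intro exI[of _ N] allI impI)
      fix m n assume mn: "N \<le> m" "N \<le> n"
      have "ennreal (norm (Bochner_Integration.simple_bochner_integral ?M (s m) - Bochner_Integration.simple_bochner_integral ?M (s n)))
        < ennreal (e / 2) + ennreal (e / 2)"
        by (rule le_less_trans[OF bd]) (intro add_strict_mono N mn)
      also have "\<dots> = ennreal e" using e by (simp flip: ennreal_plus)
      finally show "dist (Bochner_Integration.simple_bochner_integral ?M (s m)) (Bochner_Integration.simple_bochner_integral ?M (s n)) < e"
        using e by (simp add: dist_norm ennreal_less_iff)
    qed
  qed
  then obtain I where "(\<lambda>i. Bochner_Integration.simple_bochner_integral ?M (s i)) \<longlonglongrightarrow> I"
    by (auto simp: Cauchy_convergent_iff convergent_def)
  with f int lim show ?thesis unfolding has_strong_integral_def by blast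
qed

text \<open>A bounded linear map commutes with integrals of simple functions and enlarges mean
  distances by at most a constant factor. With a separable target the strong integral thereby
  becomes an ordinary Bochner integral.\<close>

lemma has_strong_integral_bounded_linear:
  fixes f :: "'a \<Rightarrow> 'b::real_normed_vector" and T :: "'b \<Rightarrow> 'c::{banach,second_countable_topology}"
  assumes "has_strong_integral (completion M) f I" and "bounded_linear T"
  shows "has_bochner_integral (completion M) (\<lambda>x. T (f x)) (T I)"
proof -
  let ?M = "completion M"
  interpret T: bounded_linear T by fact
  from assms(1) obtain s where f: "strongly_measurable ?M f"
    and s: "\<And>i::nat. Bochner_Integration.simple_bochner_integrable ?M (s i)"
      "(\<lambda>i. \<integral>\<^sup>+x. ennreal (norm (f x - s i x)) \<partial>?M) \<longlonglongrightarrow> 0"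
      "(\<lambda>i. Bochner_Integration.simple_bochner_integral ?M (s i)) \<longlonglongrightarrow> I"
    unfolding has_strong_integral_def by blast
  obtain K where K: "K > 0" "\<And>x. norm (T x) \<le> norm x * K" using T.pos_bounded by blast
  have ssf: "simple_function ?M (s i)" for i using s(1) by (blast elim: Bochner_Integration.simple_bochner_integrable.cases)
  have nd [measurable]: "(\<lambda>x. norm (f x - s i x)) \<in> borel_measurable ?M" for i
  proof -
    from f obtain r where r: "\<And>j::nat. simple_function ?M (r j)" "AE x in ?M. (\<lambda>j. r j x) \<longlonglongrightarrow> f x"
      by (rule strongly_measurableE) (rule that)
    have "AE x in ?M. (\<lambda>j. r j x - s i x) \<longlonglongrightarrow> f x - s i x"
      using r(2) by eventually_elim (intro tendsto_intros)
    hence "strongly_measurable ?M (\<lambda>x. f x - s i x)"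
      by (rule strongly_measurableI[rotated]) (intro simple_function_compose2[where h="(-)"] r ssf)
    from strongly_measurable_compose_measurable[OF this, of norm] show ?thesis
      by (auto intro: continuous_on_norm_id)
  qed
  show ?thesis
  proof (rule has_bochner_integral.intros)
    show "(\<lambda>x. T (f x)) \<in> borel_measurable ?M"
      by (rule strongly_measurable_compose_measurable[OF f]) (intro T.continuous_on continuous_on_id)
    show "Bochner_Integration.simple_bochner_integrable ?M (\<lambda>x. T (s i x))" for i
      using Bochner_Integration.simple_bochner_integrable_compose2[of "\<lambda>x y. T x", OF T.zero s(1) s(1)] .
    show "(\<lambda>i. Bochner_Integration.simple_bochner_integral ?M (\<lambda>x. T (s i x))) \<longlonglongrightarrow> T I"
      using s by (auto intro!: T.tendsto simp: Bochner_Integration.simple_bochner_integral_linear T.linear_axioms)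
    show "(\<lambda>i. \<integral>\<^sup>+x. ennreal (norm (T (f x) - T (s i x))) \<partial>?M) \<longlonglongrightarrow> 0" (is "?f \<longlonglongrightarrow> 0")
    proof (rule tendsto_sandwich[where f="\<lambda>_. 0" and h="\<lambda>i. ennreal K * (\<integral>\<^sup>+x. ennreal (norm (f x - s i x)) \<partial>?M)"])
      show "eventually (\<lambda>i. ?f i \<le> K * (\<integral>\<^sup>+x. ennreal (norm (f x - s i x)) \<partial>?M)) sequentially"
      proof (intro always_eventually allI)
        fix i
        have "?f i \<le> (\<integral>\<^sup>+x. ennreal K * ennreal (norm (f x - s i x)) \<partial>?M)"
        proof (rule nn_integral_mono)
          fix x
          have "norm (T (f x) - T (s i x)) \<le> K * norm (f x - s i x)"
            using K(2)[of "f x - s i x"] by (simp add: T.diff mult.commute)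
          from ennreal_leI[OF this] show "ennreal (norm (T (f x) - T (s i x))) \<le> ennreal K * ennreal (norm (f x - s i x))"
            using K(1) by (simp add: ennreal_mult)
        qed
        also have "\<dots> = K * (\<integral>\<^sup>+x. ennreal (norm (f x - s i x)) \<partial>?M)"
          by (intro nn_integral_cmult) auto
        finally show "?f i \<le> K * (\<integral>\<^sup>+x. ennreal (norm (f x - s i x)) \<partial>?M)" .
      qed
      show "(\<lambda>i. ennreal K * (\<integral>\<^sup>+x. ennreal (norm (f x - s i x)) \<partial>?M)) \<longlonglongrightarrow> 0"
        using ennreal_tendsto_cmult[OF _ s(2), of "ennreal K"] by simp
    qed auto
  qed
qed

lemma has_strong_integral_cinner:
  assumes "has_strong_integral (completion M) f I"
  shows "has_bochner_integral (completion M) (\<lambda>x. cinner (f x) e) (cinner I e)"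
  using assms bounded_linear_cinner_left by (rule has_strong_integral_bounded_linear)

lemma has_strong_integral_unique:
  fixes f :: "'a \<Rightarrow> 'b::complex_hilbert_space"
  assumes "has_strong_integral (completion M) f I" "has_strong_integral (completion M) f J"
  shows "I = J"
  by (rule cinner_eqI)
     (metis assms has_strong_integral_cinner has_bochner_integral_eq)

lemma strong_integral_eq:
  fixes f :: "'a \<Rightarrow> 'b::complex_hilbert_space"
  assumes "has_strong_integral (completion M) f I"
  shows "strong_integral (completion M) f = I"
  unfolding strong_integral_def using assms has_strong_integral_unique by (auto intro!: the_equality)

lemma cinner_strong_integral:
  fixes f :: "'a \<Rightarrow> 'b::complex_hilbert_space"
  assumes "strongly_measurable (completion M) f"
    and "(\<integral>\<^sup>+x. ennreal (norm (f x)) \<partial>completion M) < \<infinity>"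
  shows "cinner (strong_integral (completion M) f) e = (LINT x|completion M. cinner (f x) e)"
proof -
  from has_strong_integralI_bounded[OF assms] obtain I
    where I: "has_strong_integral (completion M) f I" by blast
  show ?thesis
    using has_bochner_integral_integral_eq[OF has_strong_integral_cinner[OF I]] strong_integral_eq[OF I]
    by simp
qed

text \<open>Pairing with the integral itself gives |I|^2 \<le> |I| times the integral of the norms;
  one factor |I| cancels.\<close>

lemma norm_has_strong_integral_le:
  fixes f :: "'a \<Rightarrow> 'b::complex_hilbert_space"
  assumes "has_strong_integral (completion M) f I"
  shows "ennreal (norm I) \<le> (\<integral>\<^sup>+x. ennreal (norm (f x)) \<partial>completion M)"
proof (cases "I = 0")
  case False
  let ?M = "completion M"
  have nf [measurable]: "(\<lambda>x. norm (f x)) \<in> borel_measurable ?M"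
    using assms strongly_measurable_compose_measurable[of M f norm]
    by (auto intro: continuous_on_norm_id simp: has_strong_integral_def)
  have b: "has_bochner_integral ?M (\<lambda>x. cinner (f x) I) (cinner I I)"
    using assms by (rule has_strong_integral_cinner)
  have "ennreal (norm I * norm I) = ennreal (cmod (cinner I I))"
    by (simp add: cinner_self norm_mult power2_eq_square)
  also have "\<dots> = ennreal (cmod (LINT x|?M. cinner (f x) I))"
    using b by (simp add: has_bochner_integral_integral_eq)
  also have "\<dots> \<le> (\<integral>\<^sup>+x. ennreal (cmod (cinner (f x) I)) \<partial>?M)"
    by (rule integral_norm_bound_ennreal) (use b in \<open>simp add: has_bochner_integral_iff\<close>)
  also have "\<dots> \<le> (\<integral>\<^sup>+x. ennreal (norm I) * ennreal (norm (f x)) \<partial>?M)"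
  proof (rule nn_integral_mono)
    fix x
    have "cmod (cinner (f x) I) \<le> norm I * norm (f x)" by (metis cinner_Cauchy_Schwarz mult.commute)
    from ennreal_leI[OF this] show "ennreal (cmod (cinner (f x) I)) \<le> ennreal (norm I) * ennreal (norm (f x))"
      by (simp add: ennreal_mult)
  qed
  also have "\<dots> = ennreal (norm I) * (\<integral>\<^sup>+x. ennreal (norm (f x)) \<partial>?M)"
    by (intro nn_integral_cmult) auto
  finally have *: "ennreal (norm I) * ennreal (norm I) \<le> ennreal (norm I) * (\<integral>\<^sup>+x. ennreal (norm (f x)) \<partial>?M)"
    by (simp add: ennreal_mult)
  have "ennreal (norm I) \<noteq> 0" "ennreal (norm I) \<noteq> top" using False by auto
  with * show ?thesis by (simp add: ennreal_mult_le_mult_iff)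
qed simp

section \<open>Parametric integrals\<close>

text \<open>Dominated convergence speaks of sequences; in a metric space, limits at a point are
  determined by sequences.\<close>

lemma tendsto_parametric_integral:
  fixes u :: "'p::metric_space \<Rightarrow> 'a \<Rightarrow> 'b::{banach,second_countable_topology}"
  assumes "\<And>q. q \<in> T \<Longrightarrow> u q \<in> borel_measurable M" "g \<in> borel_measurable M"
    and "\<And>t. ((\<lambda>q. u q t) \<longlongrightarrow> g t) (at p within T)"
    and "integrable M B" "\<And>q t. q \<in> T \<Longrightarrow> norm (u q t) \<le> B t"
  shows "((\<lambda>q. \<integral>t. u q t \<partial>M) \<longlongrightarrow> (\<integral>t. g t \<partial>M)) (at p within T)"
  unfolding tendsto_at_iff_sequentially
proof (intro allI impI)
  fix X assume X: "\<forall>i. X i \<in> T - {p}" "X \<longlonglongrightarrow> p"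
  have "(\<lambda>i. u (X i) t) \<longlonglongrightarrow> g t" for t
    using assms(3)[of t] X unfolding tendsto_at_iff_sequentially o_def by blast
  thus "((\<lambda>q. \<integral>t. u q t \<partial>M) \<circ> X) \<longlonglongrightarrow> (\<integral>t. g t \<partial>M)"
    unfolding o_def using X assms by (intro integral_dominated_convergence[where w=B]) auto
qed

text \<open>Only a local majorant of the integrand is assumed. Cauchy's inequality on small discs
  turns it into a majorant of the derivative, hence of the difference quotients, and dominated
  convergence allows differentiation under the integral.\<close>

lemma holomorphic_on_parametric_integral:
  fixes u :: "complex \<Rightarrow> 'a \<Rightarrow> complex"
  assumes "open S"
    and meas: "\<And>z. z \<in> S \<Longrightarrow> u z \<in> borel_measurable M"
    and holo: "\<And>t. (\<lambda>z. u z t) holomorphic_on S"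
    and dom: "\<And>z. z \<in> S \<Longrightarrow> \<exists>r>0. \<exists>B. integrable M B \<and> (\<forall>w\<in>S \<inter> ball z r. \<forall>t. cmod (u w t) \<le> B t)"
  shows "(\<lambda>z. \<integral>t. u z t \<partial>M) holomorphic_on S"
  unfolding holomorphic_on_open[OF \<open>open S\<close>]
proof
  fix z assume z: "z \<in> S"
  from dom[OF z] obtain r B where r: "r > 0" and B: "integrable M B"
    "\<And>w t. w \<in> S \<inter> ball z r \<Longrightarrow> cmod (u w t) \<le> B t" by blast
  from \<open>open S\<close> z obtain r' where r': "r' > 0" "ball z r' \<subseteq> S" by (meson open_contains_ball)
  \<comment> \<open>A third, so that a disc of radius \<open>\<rho>\<close> about any point within
    \<open>\<rho>\<close> of \<open>z\<close> stays inside both balls.\<close>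
  define \<rho> where "\<rho> = min r r' / 3"
  have \<rho>: "\<rho> > 0" using r r' by (simp add: \<rho>_def)
  have sub: "w \<in> S \<inter> ball z r" if "dist z w \<le> 2 * \<rho>" for w
  proof -
    have "2 * \<rho> < r" "2 * \<rho> < r'" using r r' by (auto simp: \<rho>_def min_def)
    thus ?thesis using that r' by auto
  qed
  have int: "integrable M (u w)" if "w \<in> S \<inter> ball z r" for w
    by (rule Bochner_Integration.integrable_bound[OF B(1)])
       (use that meas B(2)[OF that] in \<open>auto intro!: AE_I2 order_trans[OF _ abs_ge_self]\<close>)
  have dbd: "cmod (deriv (\<lambda>z. u z t) w) \<le> B t / \<rho>" if w: "w \<in> ball z \<rho>" for w t
  proof -
    have s: "cball w \<rho> \<subseteq> S \<inter> ball z r"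
    proof
      fix x assume "x \<in> cball w \<rho>"
      hence "dist z x \<le> 2 * \<rho>" using w dist_triangle[of z x w] by simp
      thus "x \<in> S \<inter> ball z r" by (rule sub)
    qed
    have h: "(\<lambda>z. u z t) holomorphic_on cball w \<rho>"
      by (rule holomorphic_on_subset[OF holo]) (use s in auto)
    have "cmod ((deriv ^^ 1) (\<lambda>z. u z t) w) \<le> fact 1 * B t / \<rho> ^ 1"
    proof (rule Cauchy_inequality)
      show "(\<lambda>z. u z t) holomorphic_on ball w \<rho>" using h holomorphic_on_subset ball_subset_cball by blast
      show "continuous_on (cball w \<rho>) (\<lambda>z. u z t)" using h by (rule holomorphic_on_imp_continuous_on)
      show "cmod (u x t) \<le> B t" if "cmod (w - x) = \<rho>" for x
        using s that by (intro B(2)) (auto simp: dist_norm)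
    qed (use \<rho> in auto)
    thus ?thesis by simp
  qed
  have lip: "cmod ((u w t - u z t) / (w - z)) \<le> B t / \<rho>" if w: "w \<in> ball z \<rho> - {z}" for w t
  proof -
    have "cmod (u w t - u z t) \<le> (B t / \<rho>) * cmod (w - z)"
    proof (rule field_differentiable_bound[of "ball z \<rho>" "\<lambda>z. u z t" "deriv (\<lambda>z. u z t)"])
      fix x assume x: "x \<in> ball z \<rho>"
      hence "x \<in> S" using sub[of x] \<rho> by auto
      thus "((\<lambda>z. u z t) has_field_derivative deriv (\<lambda>z. u z t) x) (at x within ball z \<rho>)"
        using holomorphic_derivI[OF holo \<open>open S\<close>] has_field_derivative_at_within by blast
    qed (use w \<rho> dbd in auto)
    thus ?thesis using w \<rho> by (simp add: norm_divide divide_simps)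
  qed
  have lim: "((\<lambda>w. (u w t - u z t) / (w - z)) \<longlongrightarrow> deriv (\<lambda>z. u z t) z) (at z)" for t
    using holomorphic_derivI[OF holo \<open>open S\<close> z, of t] by (simp add: has_field_derivative_iff)
  have m: "(\<lambda>t. (u w t - u z t) / (w - z)) \<in> borel_measurable M" if "w \<in> ball z \<rho> - {z}" for w
    using meas[OF z] meas[of w] sub[of w] that \<rho> by auto
  have "((\<lambda>w. \<integral>t. (u w t - u z t) / (w - z) \<partial>M) \<longlongrightarrow> (\<integral>t. deriv (\<lambda>z. u z t) z \<partial>M)) (at z within (ball z \<rho> - {z}))"
  proof (rule tendsto_parametric_integral[where B="\<lambda>t. B t / \<rho>"])
    show "(\<lambda>t. deriv (\<lambda>z. u z t) z) \<in> borel_measurable M"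
    proof (rule borel_measurable_LIMSEQ_metric)
      \<comment> \<open>Measurability of the derivative in \<open>t\<close> comes from writing it as
        a limit of difference quotients along this sequence; \<open>i + 2\<close> keeps every term
        strictly inside the ball.\<close>
      let ?X = "\<lambda>i. z + of_real (\<rho> / real (i + 2))"
      have X: "?X i \<in> ball z \<rho> - {z}" for i
      proof -
        have "0 < \<rho> / real (i + 2)" "\<rho> / real (i + 2) < \<rho>" using \<rho> by (simp_all add: divide_simps)
        moreover have "dist z (?X i) = \<bar>\<rho> / real (i + 2)\<bar>" by (simp add: dist_norm del: of_real_divide)
        ultimately show ?thesis using zero_less_dist_iff[of z "?X i"] by simp
      qed
      show "(\<lambda>t. (u (?X i) t - u z t) / (?X i - z)) \<in> borel_measurable M" for i by (rule m[OF X])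
      fix t
      have "(\<lambda>i. \<rho> / real (i + 2)) \<longlonglongrightarrow> 0" by real_asymp
      hence "(\<lambda>i. z + of_real (\<rho> / real (i + 2))) \<longlonglongrightarrow> z + of_real 0" by (intro tendsto_intros)
      hence "?X \<longlonglongrightarrow> z" by simp
      hence "filterlim ?X (at z) sequentially"
        using X by (auto simp: filterlim_at intro!: always_eventually)
      from filterlim_compose[OF lim this]
      show "(\<lambda>i. (u (?X i) t - u z t) / (?X i - z)) \<longlonglongrightarrow> deriv (\<lambda>z. u z t) z" .
    qed
    show "((\<lambda>q. (u q t - u z t) / (q - z)) \<longlongrightarrow> deriv (\<lambda>z. u z t) z) (at z within ball z \<rho> - {z})" for t
      using lim by (rule tendsto_within_subset) auto
  qed (use m lip B in auto)
  moreover have "at z within (ball z \<rho> - {z}) = at z"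
    using \<rho> at_within_open[of z "ball z \<rho>"] by (simp add: at_within_def Diff_Diff_Int Int_absorb1 Diff_idemp)
  ultimately have l: "((\<lambda>w. \<integral>t. (u w t - u z t) / (w - z) \<partial>M) \<longlongrightarrow> (\<integral>t. deriv (\<lambda>z. u z t) z \<partial>M)) (at z)" by simp
  have "eventually (\<lambda>w. w \<in> ball z \<rho> - {z}) (at z)"
    unfolding eventually_at using \<rho> by (intro exI[of _ \<rho>]) (auto simp: dist_commute)
  hence "eventually (\<lambda>w. (\<integral>t. (u w t - u z t) / (w - z) \<partial>M) = ((\<integral>t. u w t \<partial>M) - (\<integral>t. u z t \<partial>M)) / (w - z)) (at z)"
  proof eventually_elim
    case (elim w)
    hence "integrable M (u w)" "integrable M (u z)" using int sub[of w] sub[of z] \<rho> by auto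
    thus ?case by simp
  qed
  from Lim_transform_eventually[OF l this]
  show "\<exists>f'. ((\<lambda>z. \<integral>t. u z t \<partial>M) has_field_derivative f') (at z)"
    unfolding has_field_derivative_iff by blast
qed

section \<open>Integrable weights on Euclidean space\<close>

text \<open>\<open>lborel\<close> on a Euclidean space is the image of the product measure over
  \<open>Basis\<close>. Coordinates are matched with basis elements through \<open>axis j 1\<close>,
  after which Fubini's theorem for finite products applies.\<close>

lemma
  fixes f :: "'n::finite \<Rightarrow> real \<Rightarrow> 'b::{real_normed_field,banach,second_countable_topology}"
  assumes f: "\<And>j. integrable lborel (f j)"
  shows integrable_lborel_cart_prod: "integrable lborel (\<lambda>x::real^'n. \<Prod>j\<in>UNIV. f j (x $ j))"
    and integral_lborel_cart_prod:
      "(LBINT x. (\<Prod>j\<in>UNIV. f j ((x::real^'n) $ j))) = (\<Prod>j\<in>UNIV. LBINT t. f j t)"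
proof -
  let ?B = "Basis :: (real^'n) set"
  let ?ax = "\<lambda>j::'n. axis j (1::real)"
  have inj: "inj ?ax" by (simp add: inj_on_def axis_eq_axis)
  have Beq: "?B = range ?ax" by (auto simp: Basis_vec_def)
  define f' where "f' b = f (the_inv ?ax b)" for b
  have f'ax: "f' (?ax j) = f j" for j by (simp add: f'_def the_inv_f_f[OF inj])
  have f': "integrable lborel (f' b)" for b by (simp add: f'_def f)
  have [measurable]: "f' b \<in> borel_measurable borel" for b using f' by auto
  interpret product_sigma_finite "\<lambda>_. lborel :: real measure" by standard
  let ?P = "Pi\<^sub>M ?B (\<lambda>_. lborel :: real measure)"
  let ?T = "\<lambda>g. \<Sum>b\<in>?B. g b *\<^sub>R b"
  have lb: "(lborel :: (real^'n) measure) = distr ?P borel ?T"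
    by (subst lborel_def) (simp add: lborel_eq_real)
  have pr: "(\<Prod>b\<in>?B. f' b (h b)) = (\<Prod>j\<in>UNIV. f j (h (?ax j)))" for h
    unfolding Beq by (subst prod.reindex[OF inj]) (simp add: f'ax)
  have comp: "?T g $ j = g (?ax j)" for g j
    unfolding Beq by (subst sum.reindex[OF inj]) (simp add: axis_def if_distrib cong: if_cong)
  have comp': "(\<Sum>b\<in>?B. g b * b $ j) = g (?ax j)" for g j using comp[of g j] by simp
  have [measurable]: "f j \<in> borel_measurable borel" for j using f by auto
  have meas: "(\<lambda>x::real^'n. \<Prod>j\<in>UNIV. f j (x $ j)) \<in> borel_measurable borel" by measurable
  have T: "?T \<in> measurable ?P borel" by measurable
  have "integrable ?P (\<lambda>h. \<Prod>b\<in>?B. f' b (h b))"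
    by (rule product_integrable_prod) (simp_all add: f')
  thus "integrable lborel (\<lambda>x::real^'n. \<Prod>j\<in>UNIV. f j (x $ j))"
    unfolding lb using meas T by (subst integrable_distr_eq) (simp_all add: comp' pr)
  have "(LBINT x. (\<Prod>j\<in>UNIV. f j ((x::real^'n) $ j))) = (\<integral>h. (\<Prod>b\<in>?B. f' b (h b)) \<partial>?P)"
    unfolding lb using meas T by (subst integral_distr) (simp_all add: comp' pr)
  also have "\<dots> = (\<Prod>b\<in>?B. LBINT t. f' b t)"
    by (rule product_integral_prod) (simp_all add: f')
  also have "\<dots> = (\<Prod>j\<in>UNIV. LBINT t. f j t)"
    unfolding Beq by (subst prod.reindex[OF inj]) (simp add: f'ax)
  finally show "(LBINT x. (\<Prod>j\<in>UNIV. f j ((x::real^'n) $ j))) = (\<Prod>j\<in>UNIV. LBINT t. f j t)" .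
qed

text \<open>The standard integrable majorant of the development: a product, so that integrability is
  a one-dimensional matter, and of polynomial decay, so that a translation costs only a
  constant.\<close>

definition pweight :: "real^'n \<Rightarrow> real"
  where "pweight x = (\<Prod>j\<in>UNIV. inverse (1 + (x $ j)\<^sup>2))"

lemma pweight_pos: "0 < pweight x"
  unfolding pweight_def by (intro prod_pos) (auto intro: add_pos_nonneg)

lemma pweight_nonneg: "0 \<le> pweight x"
  using pweight_pos[of x] by simp

lemma pweight_le_1: "pweight x \<le> 1"
  unfolding pweight_def by (intro prod_le_1) (auto simp: inverse_eq_divide divide_simps add_pos_nonneg add_nonneg_eq_0_iff)

lemma integrable_pweight: "integrable lborel pweight"
proof -
  have "integrable lborel (\<lambda>x::real. inverse (1 + x\<^sup>2))"
    using integrable_inverse_1_plus_square by (simp add: set_integrable_def)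
  from integrable_lborel_cart_prod[OF this] show ?thesis by (simp add: pweight_def[abs_def])
qed

lemma pweight_measurable [measurable]: "pweight \<in> borel_measurable borel"
  using borel_measurable_integrable[OF integrable_pweight] by simp

lemma integrable_pweight_bound:
  fixes f :: "real^'n \<Rightarrow> 'b::{banach,second_countable_topology}"
  assumes "f \<in> borel_measurable borel" "\<And>x. norm (f x) \<le> A * pweight x"
  shows "integrable lborel f"
  using integrable_mult_right[OF integrable_pweight, of A]
  by (rule Bochner_Integration.integrable_bound)
     (use assms in \<open>auto intro!: AE_I2 order_trans[OF _ abs_ge_self]\<close>)

text \<open>Coordinatewise Peetre inequality 1 + a^2 \<le> 2 (1 + b^2) (1 + (a + b)^2).\<close>

lemma pweight_translate: "pweight (x + s) \<le> (\<Prod>j\<in>UNIV. 2 * (1 + (s $ j)\<^sup>2)) * pweight x"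
  unfolding pweight_def prod.distrib[symmetric]
proof (intro prod_mono conjI)
  fix j
  let ?a = "x $ j" and ?b = "s $ j"
  \<comment> \<open>Expanded, this square is 2 (a + b)^2 + 2 b^2 - a^2.\<close>
  have "0 \<le> (?a + 2 * ?b)\<^sup>2" by simp
  hence "?a\<^sup>2 \<le> 2 * (?a + ?b)\<^sup>2 + 2 * ?b\<^sup>2" by (simp add: power2_eq_square algebra_simps)
  moreover have "0 \<le> 2 * (?b\<^sup>2 * (?a + ?b)\<^sup>2)" by simp
  moreover have "2 * (1 + ?b\<^sup>2) * (1 + (?a + ?b)\<^sup>2)
      = 2 + (2 * (?a + ?b)\<^sup>2 + 2 * ?b\<^sup>2) + 2 * (?b\<^sup>2 * (?a + ?b)\<^sup>2)" by (simp add: algebra_simps)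
  ultimately have "1 + ?a\<^sup>2 \<le> 2 * (1 + ?b\<^sup>2) * (1 + (?a + ?b)\<^sup>2)" by linarith
  moreover have "0 < 1 + ?a\<^sup>2" "0 < 1 + (?a + ?b)\<^sup>2" by (auto intro: add_pos_nonneg)
  ultimately show "inverse (1 + ((x + s) $ j)\<^sup>2) \<le> 2 * (1 + ?b\<^sup>2) * inverse (1 + ?a\<^sup>2)"
    by (simp add: divide_simps)
  show "0 \<le> inverse (1 + ((x + s) $ j)\<^sup>2)" by simp
qed

lemma pweight_translate_norm:
  assumes "norm s \<le> c"
  shows "pweight (x + s) \<le> (2 * (1 + c\<^sup>2)) ^ CARD('n) * pweight (x::real^'n)"
proof -
  have "(\<Prod>j\<in>(UNIV::'n set). 2 * (1 + (s $ j)\<^sup>2)) \<le> (\<Prod>j\<in>(UNIV::'n set). 2 * (1 + c\<^sup>2))"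
  proof (intro prod_mono conjI)
    fix j
    have "\<bar>s $ j\<bar> \<le> \<bar>c\<bar>" using component_le_norm_cart[of s j] assms by linarith
    thus "2 * (1 + (s $ j)\<^sup>2) \<le> 2 * (1 + c\<^sup>2)" by (simp add: abs_le_square_iff)
  qed auto
  hence "(\<Prod>j\<in>UNIV. 2 * (1 + (s $ j)\<^sup>2)) * pweight x \<le> (2 * (1 + c\<^sup>2)) ^ CARD('n) * pweight x"
    by (intro mult_right_mono pweight_nonneg) simp
  thus ?thesis using pweight_translate[of x s] by linarith
qed

lemma pweight_minus: "pweight (- x) = pweight x"
  by (simp add: pweight_def)

section \<open>Translations and reflections of Lebesgue integrals\<close>

lemma lborel_integral_translate:
  fixes f :: "'a::euclidean_space \<Rightarrow> 'b::{banach,second_countable_topology}"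
  assumes "f \<in> borel_measurable borel"
  shows "(LBINT x. f (x + c)) = (LBINT x. f x)"
proof -
  have "(LBINT x. f x) = (\<integral>x. f x \<partial>distr lborel borel ((+) c))" by (simp add: lborel_distr_plus)
  also have "\<dots> = (LBINT x. f (c + x))" using assms by (intro integral_distr) auto
  finally show ?thesis by (simp add: add.commute)
qed

lemma lborel_distr_reflect: "distr lborel borel (\<lambda>x::'a::euclidean_space. c - x) = lborel"
  using lborel_affine[of "-1" c] by (simp add: density_1)

lemma lborel_integrable_reflect:
  fixes f :: "'a::euclidean_space \<Rightarrow> 'b::{banach,second_countable_topology}"
  assumes "integrable lborel f"
  shows "integrable lborel (\<lambda>x. f (c - x))"
  using assms integrable_distr_eq[of "\<lambda>x. c - x" lborel borel f]
  by (simp add: lborel_distr_reflect borel_measurable_integrable)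

lemma lborel_integral_reflect:
  fixes f :: "real^'n \<Rightarrow> 'b::{banach,second_countable_topology}"
  assumes [measurable]: "f \<in> borel_measurable borel" and that: "d \<noteq> 0"
  shows "(LBINT x. f (c - d *\<^sub>R x)) = (inverse \<bar>d\<bar> ^ CARD('n)) *\<^sub>R (LBINT x. f x)"
proof -
  have l: "lborel = density (distr lborel borel (\<lambda>x::real^'n. c + (-d) *\<^sub>R x)) (\<lambda>_. ennreal (\<bar>d\<bar> ^ CARD('n)))"
    using lborel_affine[of "-d" c] that by (simp add: ennreal_power)
  have "(LBINT x. f x) = (\<integral>x. f x \<partial>density (distr lborel borel (\<lambda>x::real^'n. c + (-d) *\<^sub>R x)) (\<lambda>_. ennreal (\<bar>d\<bar> ^ CARD('n))))"
    by (subst l) simp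
  also have "\<dots> = (LBINT x. \<bar>d\<bar> ^ CARD('n) *\<^sub>R f (c - d *\<^sub>R x))"
    by (subst integral_density) (auto simp: integral_distr)
  also have "\<dots> = \<bar>d\<bar> ^ CARD('n) *\<^sub>R (LBINT x. f (c - d *\<^sub>R x))"
    by simp
  finally show ?thesis using that by (simp add: power_inverse)
qed

text \<open>From here on a function on the tube is curried: \<open>u x y\<close> is the value at \<open>x + iy\<close>.
  The integral below is holomorphic in the shift parameter and does not depend on its real part.\<close>

lemma integral_ray_const:
  fixes u :: "real^'n \<Rightarrow> real^'n \<Rightarrow> complex"
  assumes meas: "\<And>l. l > 0 \<Longrightarrow> (\<lambda>x. u x (l *\<^sub>R y)) \<in> borel_measurable borel"
    and holo: "\<And>x. (\<lambda>\<zeta>. u (x + Re \<zeta> *\<^sub>R y) (Im \<zeta> *\<^sub>R y)) holomorphic_on {\<zeta>. Im \<zeta> > 0}"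
    and bound: "\<And>a b. 0 < a \<Longrightarrow> \<exists>A. \<forall>x l. a \<le> l \<longrightarrow> l \<le> b \<longrightarrow> cmod (u x (l *\<^sub>R y)) \<le> A * pweight x"
    and lm: "0 < l" "0 < m"
  shows "(LBINT x. u x (l *\<^sub>R y)) = (LBINT x. u x (m *\<^sub>R y))"
proof -
  define S where "S = {\<zeta>. Im \<zeta> > 0}"
  have S: "open S" "convex S" by (simp_all add: S_def open_halfspace_Im_gt convex_halfspace_Im_gt)
  define H where "H \<zeta> = (LBINT x. u (x + Re \<zeta> *\<^sub>R y) (Im \<zeta> *\<^sub>R y))" for \<zeta>
  have ms: "(\<lambda>x. u (x + s *\<^sub>R y) (l *\<^sub>R y)) \<in> borel_measurable borel" if "l > 0" for s l
    using measurable_compose[OF _ meas[OF that], of "\<lambda>x. x + s *\<^sub>R y"] by simp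
  have "H holomorphic_on S"
    unfolding H_def
  proof (rule holomorphic_on_parametric_integral[OF S(1)])
    show "(\<lambda>x. u (x + Re z *\<^sub>R y) (Im z *\<^sub>R y)) \<in> borel_measurable lborel" if "z \<in> S" for z
      using ms that by (simp add: S_def)
    show "(\<lambda>z. u (t + Re z *\<^sub>R y) (Im z *\<^sub>R y)) holomorphic_on S" for t
      using holo by (simp add: S_def)
    fix z assume z: "z \<in> S"
    \<comment> \<open>Half the height keeps all heights over the ball about \<open>z\<close> between
      \<open>r\<close> and \<open>3 * r\<close>, where a single majorant is available.\<close>
    define r where "r = Im z / 2"
    have r: "r > 0" using z by (simp add: r_def S_def)
    from bound[OF r, of "3 * r"] obtain A where
      A: "\<And>x l. r \<le> l \<Longrightarrow> l \<le> 3 * r \<Longrightarrow> cmod (u x (l *\<^sub>R y)) \<le> A * pweight x" by blast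
    define c where "c = (\<bar>Re z\<bar> + r) * norm y"
    define D where "D = (2 * (1 + c\<^sup>2)) ^ CARD('n)"
    have "cmod (u (x + Re w *\<^sub>R y) (Im w *\<^sub>R y)) \<le> (\<bar>A\<bar> * D) * pweight x" if w: "w \<in> ball z r" for w x
    proof -
      have "cmod (w - z) < r" using w by (simp add: dist_norm norm_minus_commute)
      hence "\<bar>Re (w - z)\<bar> < r" "\<bar>Im (w - z)\<bar> < r"
        using abs_Re_le_cmod[of "w - z"] abs_Im_le_cmod[of "w - z"] by linarith+
      hence wr: "\<bar>Re w\<bar> \<le> \<bar>Re z\<bar> + r" "r \<le> Im w" "Im w \<le> 3 * r"
        unfolding minus_complex.simps r_def by linarith+
      have "cmod (u (x + Re w *\<^sub>R y) (Im w *\<^sub>R y)) \<le> A * pweight (x + Re w *\<^sub>R y)" using wr by (intro A)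
      also have "\<dots> \<le> \<bar>A\<bar> * pweight (x + Re w *\<^sub>R y)" by (intro mult_right_mono pweight_nonneg) simp
      also have "\<dots> \<le> \<bar>A\<bar> * (D * pweight x)"
        unfolding D_def c_def using wr
        by (intro mult_left_mono pweight_translate_norm) (auto intro: mult_right_mono)
      finally show ?thesis by (simp add: mult.assoc)
    qed
    thus "\<exists>r>0. \<exists>B. integrable lborel B \<and> (\<forall>w\<in>S \<inter> ball z r. \<forall>t. cmod (u (t + Re w *\<^sub>R y) (Im w *\<^sub>R y)) \<le> B t)"
      using r by (intro exI[of _ r] conjI exI[of _ "\<lambda>x. (\<bar>A\<bar> * D) * pweight x"] integrable_mult_right integrable_pweight) auto
  qed
  have Hre: "H \<zeta> = (LBINT x. u x (Im \<zeta> *\<^sub>R y))" if "\<zeta> \<in> S" for \<zeta>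
    unfolding H_def using lborel_integral_translate[OF meas[of "Im \<zeta>"], of "Re \<zeta> *\<^sub>R y"] that by (simp add: S_def)
  \<comment> \<open>\<open>H\<close> does not vary in the real direction; for a holomorphic function
    this directional derivative is the complex derivative, which therefore vanishes.\<close>
  have "(H has_field_derivative 0) (at z within S)" if z: "z \<in> S" for z
  proof -
    from \<open>H holomorphic_on S\<close> S(1) z obtain D where D: "(H has_field_derivative D) (at z)"
      by (auto simp: holomorphic_on_open)
    have "((\<lambda>s. z + of_real s) has_vector_derivative 1) (at 0)"
      by (auto intro!: derivative_eq_intros simp: has_vector_derivative_def scaleR_conv_of_real)
    hence "((H \<circ> (\<lambda>s. z + of_real s)) has_vector_derivative (1 * D)) (at 0)"
      by (rule field_vector_diff_chain_at) (use D in simp)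
    moreover have "(H \<circ> (\<lambda>s. z + of_real s)) = (\<lambda>s. H z)"
    proof
      fix s :: real
      have "z + of_real s \<in> S" using z by (simp add: S_def)
      thus "(H \<circ> (\<lambda>s. z + of_real s)) s = H z" using Hre[of "z + of_real s"] Hre[OF z] by simp
    qed
    ultimately have "((\<lambda>s::real. H z) has_vector_derivative D) (at 0)" by simp
    hence "D = 0" using has_vector_derivative_const vector_derivative_unique_at by blast
    thus ?thesis using D has_field_derivative_at_within by blast
  qed
  from has_field_derivative_zero_constant[OF S(2) this] obtain c where c: "\<And>\<zeta>. \<zeta> \<in> S \<Longrightarrow> H \<zeta> = c" by blast
  have "\<i> * of_real l \<in> S" "\<i> * of_real m \<in> S" using lm by (auto simp: S_def)
  thus ?thesis using c Hre by (metis Im_i_times Re_complex_of_real)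
qed

section \<open>Gaussians\<close>

lemma one_plus_sum_le_prod:
  fixes a :: "'a \<Rightarrow> real"
  assumes "finite A" "\<And>i. i \<in> A \<Longrightarrow> 0 \<le> a i"
  shows "1 + sum a A \<le> (\<Prod>i\<in>A. 1 + a i)"
  using assms
proof (induction rule: finite_induct)
  case (insert x A)
  have "1 + sum a (insert x A) \<le> (1 + a x) * (1 + sum a A)"
    using insert by (simp add: algebra_simps sum_nonneg)
  also have "\<dots> \<le> (1 + a x) * (\<Prod>i\<in>A. 1 + a i)"
    using insert by (intro mult_left_mono) auto
  finally show ?case using insert by simp
qed simp

lemma one_plus_norm_le_prod: "1 + norm (x::real^'n) \<le> (\<Prod>j\<in>UNIV. 1 + \<bar>x $ j\<bar>)"
  using norm_le_l1_cart[of x] one_plus_sum_le_prod[of UNIV "\<lambda>j. \<bar>x $ j\<bar>"] by simp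

lemma power_div_fact_le_exp:
  assumes "0 \<le> (x::real)"
  shows "x ^ n / fact n \<le> exp x"
proof -
  have s: "(\<lambda>n. x ^ n /\<^sub>R fact n) sums exp x" by (rule exp_converges)
  have "sum (\<lambda>n. x ^ n /\<^sub>R fact n) {n} \<le> (\<Sum>n. x ^ n /\<^sub>R fact n)"
    using s assms by (intro sum_le_suminf) (auto simp: sums_iff)
  thus ?thesis using s by (simp add: sums_iff divide_inverse mult.commute)
qed

lemma one_plus_power_times_exp_bound:
  assumes "0 < (c::real)"
  shows "\<exists>A\<ge>0. \<forall>x. (1 + \<bar>x\<bar>) ^ N * exp (- (c * x\<^sup>2)) \<le> A * inverse (1 + x\<^sup>2)"
\<comment> \<open>The witness collects 2^(N+2) from (1 + |x|)^2 \<le> 2 (1 + x^2), the quotient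
  (N+2)!/c^(N+2) from one term of the exponential series in c (1 + x^2), and exp c from the summand
  1 in that argument. Two powers beyond N pay for the factor 1 + x^2.\<close>
proof (intro exI[of _ "2 ^ (N + 2) * (exp c * (fact (N + 2) / c ^ (N + 2)))"] conjI allI)
  let ?K = "N + 2"
  show "0 \<le> 2 ^ ?K * (exp c * (fact ?K / c ^ ?K))" using assms by simp
  fix x :: real
  have p: "0 < 1 + x\<^sup>2" by (auto intro: add_pos_nonneg)
  have "1 + x\<^sup>2 \<le> (1 + \<bar>x\<bar>)\<^sup>2" by (simp add: power2_eq_square algebra_simps)
  hence "(1 + \<bar>x\<bar>) ^ N * (1 + x\<^sup>2) \<le> (1 + \<bar>x\<bar>) ^ N * (1 + \<bar>x\<bar>)\<^sup>2" by (intro mult_left_mono) auto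
  also have "\<dots> = (1 + \<bar>x\<bar>) ^ ?K" by (simp only: power_add)
  also have "\<dots> \<le> ((1 + \<bar>x\<bar>)\<^sup>2) ^ ?K"
    unfolding power_mult[symmetric] by (intro power_increasing) auto
  also have "\<dots> \<le> (2 * (1 + x\<^sup>2)) ^ ?K"
  proof (intro power_mono)
    have "0 \<le> (1 - \<bar>x\<bar>)\<^sup>2" by simp
    thus "(1 + \<bar>x\<bar>)\<^sup>2 \<le> 2 * (1 + x\<^sup>2)" by (simp add: power2_eq_square algebra_simps)
  qed auto
  finally have 1: "(1 + \<bar>x\<bar>) ^ N * (1 + x\<^sup>2) \<le> 2 ^ ?K * (1 + x\<^sup>2) ^ ?K" by (simp only: power_mult_distrib)
  have 2: "(1 + x\<^sup>2) ^ K \<le> fact K / c ^ K * exp (c * (1 + x\<^sup>2))" for K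
    using power_div_fact_le_exp[of "c * (1 + x\<^sup>2)" K] assms p
    by (simp add: power_mult_distrib divide_simps mult.commute)
  have "(1 + \<bar>x\<bar>) ^ N * (1 + x\<^sup>2) \<le> 2 ^ ?K * (fact ?K / c ^ ?K * exp (c * (1 + x\<^sup>2)))"
    by (rule order_trans[OF 1 mult_left_mono[OF 2]]) simp
  hence "((1 + \<bar>x\<bar>) ^ N * (1 + x\<^sup>2)) * exp (- (c * x\<^sup>2))
      \<le> 2 ^ ?K * (fact ?K / c ^ ?K * exp (c * (1 + x\<^sup>2))) * exp (- (c * x\<^sup>2))"
    by (intro mult_right_mono) auto
  also have "\<dots> = 2 ^ ?K * (fact ?K / c ^ ?K * (exp (c * (1 + x\<^sup>2)) * exp (- (c * x\<^sup>2))))"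
    by (simp only: mult.assoc)
  also have "exp (c * (1 + x\<^sup>2)) * exp (- (c * x\<^sup>2)) = exp c"
    by (simp add: exp_add[symmetric] algebra_simps)
  finally have "(1 + \<bar>x\<bar>) ^ N * exp (- (c * x\<^sup>2)) * (1 + x\<^sup>2) \<le> 2 ^ ?K * (exp c * (fact ?K / c ^ ?K))"
    by (simp only: ac_simps)
  thus "(1 + \<bar>x\<bar>) ^ N * exp (- (c * x\<^sup>2)) \<le> 2 ^ ?K * (exp c * (fact ?K / c ^ ?K)) * inverse (1 + x\<^sup>2)"
    using p by (simp only: divide_inverse[symmetric] pos_le_divide_eq)
qed

text \<open>\<open>gauss d x y\<close> is the entire extension of the normalized Gaussian of width \<open>d\<close> at \<open>x + iy\<close>.\<close>

definition rgauss :: "real \<Rightarrow> real^'n \<Rightarrow> real"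
  where "rgauss d x = (\<Prod>j\<in>UNIV. 1 / d * exp (- (pi / d\<^sup>2 * (x $ j)\<^sup>2)))"

definition gauss :: "real \<Rightarrow> real^'n \<Rightarrow> real^'n \<Rightarrow> complex"
  where "gauss d x y = (\<Prod>j\<in>UNIV. of_real (1 / d) * exp (- (of_real (pi / d\<^sup>2) * (Complex (x $ j) (y $ j))\<^sup>2)))"

lemma rgauss_nonneg: "0 < d \<Longrightarrow> 0 \<le> rgauss d x"
  unfolding rgauss_def by (intro prod_nonneg) auto

lemma abs_rgauss: "0 < d \<Longrightarrow> \<bar>rgauss d x\<bar> = rgauss d x"
  by (simp add: rgauss_nonneg)

lemma gauss_real: "gauss d x 0 = of_real (rgauss d x)"
  by (simp add: gauss_def rgauss_def complex_of_real_def[symmetric] exp_of_real[symmetric])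

lemma norm_power2_cart: "(norm (y::real^'n))\<^sup>2 = (\<Sum>j\<in>UNIV. (y $ j)\<^sup>2)"
  unfolding power2_norm_eq_inner inner_vec_def by (simp add: power2_eq_square)

text \<open>The real part of (x + iy)^2 is x^2 - y^2 in each coordinate, so an imaginary shift costs
  a factor that does not depend on \<open>x\<close>.\<close>

lemma cmod_gauss:
  assumes "0 < d"
  shows "cmod (gauss d x y) = rgauss d x * exp (pi / d\<^sup>2 * (norm y)\<^sup>2)"
proof -
  have "cmod (gauss d x y)
      = (\<Prod>j\<in>UNIV. (1 / d * exp (- (pi / d\<^sup>2 * (x $ j)\<^sup>2))) * exp (pi / d\<^sup>2 * (y $ j)\<^sup>2))"
    unfolding gauss_def prod_norm[symmetric]
  proof (rule prod.cong)
    fix j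
    have "cmod (exp (- (of_real (pi / d\<^sup>2) * (Complex (x $ j) (y $ j))\<^sup>2)))
      = exp (- (pi / d\<^sup>2 * ((x $ j)\<^sup>2 - (y $ j)\<^sup>2)))"
      by (simp add: norm_exp_eq_Re Re_power2 mult_ac)
    also have "\<dots> = exp (- (pi / d\<^sup>2 * (x $ j)\<^sup>2)) * exp (pi / d\<^sup>2 * (y $ j)\<^sup>2)"
      by (simp add: exp_add[symmetric] algebra_simps)
    finally show "cmod (of_real (1 / d) * exp (- (of_real (pi / d\<^sup>2) * (Complex (x $ j) (y $ j))\<^sup>2)))
      = 1 / d * exp (- (pi / d\<^sup>2 * (x $ j)\<^sup>2)) * exp (pi / d\<^sup>2 * (y $ j)\<^sup>2)"
      using assms by (simp add: norm_mult norm_divide)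
  qed simp
  also have "\<dots> = rgauss d x * exp (pi / d\<^sup>2 * (norm y)\<^sup>2)"
    unfolding rgauss_def norm_power2_cart sum_distrib_left exp_sum[OF finite] prod.distrib ..
  finally show ?thesis .
qed

lemma rgauss_bound:
  assumes "0 < d"
  shows "\<exists>A\<ge>0. \<forall>x::real^'n. (1 + norm x) ^ N * rgauss d x \<le> A * pweight x"
proof -
  have "0 < pi / d\<^sup>2" using assms by simp
  from one_plus_power_times_exp_bound[OF this, of N] obtain A where A: "A \<ge> 0"
    "\<And>t. (1 + \<bar>t\<bar>) ^ N * exp (- (pi / d\<^sup>2 * t\<^sup>2)) \<le> A * inverse (1 + t\<^sup>2)" by blast
  show ?thesis
  proof (intro exI[of _ "\<Prod>j\<in>(UNIV::'n set). 1 / d * A"] conjI allI)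
    show "0 \<le> (\<Prod>j\<in>(UNIV::'n set). 1 / d * A)" using A assms by (intro prod_nonneg) simp
    fix x :: "real^'n"
    have "(1 + norm x) ^ N * rgauss d x \<le> (\<Prod>j\<in>UNIV. 1 + \<bar>x $ j\<bar>) ^ N * rgauss d x"
      by (intro mult_right_mono power_mono one_plus_norm_le_prod rgauss_nonneg assms) simp
    also have "\<dots> = (\<Prod>j\<in>UNIV. 1 / d * ((1 + \<bar>x $ j\<bar>) ^ N * exp (- (pi / d\<^sup>2 * (x $ j)\<^sup>2))))"
      by (simp add: rgauss_def prod_power_distrib prod.distrib[symmetric] mult_ac)
    also have "\<dots> \<le> (\<Prod>j\<in>UNIV. 1 / d * (A * inverse (1 + (x $ j)\<^sup>2)))"
      using assms by (intro prod_mono conjI mult_left_mono A) auto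
    also have "\<dots> = (\<Prod>j\<in>(UNIV::'n set). 1 / d * A) * pweight x"
      by (simp only: pweight_def prod.distrib[symmetric] mult.assoc)
    finally show "(1 + norm x) ^ N * rgauss d x \<le> (\<Prod>j\<in>(UNIV::'n set). 1 / d * A) * pweight x" .
  qed
qed

lemma rgauss_continuous: "continuous_on UNIV (rgauss d)"
  unfolding rgauss_def by (intro continuous_intros)

lemma gauss_continuous: "continuous_on UNIV (\<lambda>p. gauss d (fst p) (snd p))"
proof -
  have "Complex a b = of_real a + \<i> * of_real b" for a b by (simp add: complex_eq_iff)
  thus ?thesis unfolding gauss_def by (intro continuous_intros)
qed

lemma rgauss_measurable [measurable]: "rgauss d \<in> borel_measurable borel"
  by (rule borel_measurable_continuous_onI[OF rgauss_continuous])

lemma gauss_measurable: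
  assumes [measurable]: "a \<in> borel_measurable M" "b \<in> borel_measurable M"
  shows "(\<lambda>t. gauss d (a t) (b t)) \<in> borel_measurable M"
proof -
  have "(\<lambda>p. gauss d (fst p) (snd p)) \<in> borel_measurable (borel \<Otimes>\<^sub>M borel)"
    using borel_measurable_continuous_onI[OF gauss_continuous] by (simp add: borel_prod)
  from measurable_compose[OF _ this, of "\<lambda>t. (a t, b t)"] show ?thesis by simp
qed

text \<open>On a complex line each coordinate is affine in \<zeta>; this is how curried functions of
  real and imaginary part are recognized as holomorphic in \<zeta>.\<close>

lemma Complex_line: "Complex (a + Re \<zeta> * c) (b + Im \<zeta> * c) = Complex a b + \<zeta> * of_real c"
  by (simp add: complex_eq_iff)

lemma gauss_holomorphic: "(\<lambda>\<zeta>. gauss d (a + Re \<zeta> *\<^sub>R c) (b + Im \<zeta> *\<^sub>R c)) holomorphic_on S"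
  unfolding gauss_def vector_add_component vector_scaleR_component real_scaleR_def Complex_line
  by (intro holomorphic_intros)

text \<open>The exponential exp (2 \<pi> i <x + iy, \<eta>>), with the complex pairing split into
  real inner products.\<close>

definition tube_char :: "real^'n \<Rightarrow> real^'n \<Rightarrow> real^'n \<Rightarrow> complex"
  where "tube_char x y \<eta> = exp (of_real (2 * pi) * (\<i> * of_real (x \<bullet> \<eta>) - of_real (y \<bullet> \<eta>)))"

lemma cmod_tube_char: "cmod (tube_char x y \<eta>) = exp (- (2 * pi * (y \<bullet> \<eta>)))"
  by (simp add: tube_char_def norm_exp_eq_Re)

lemma tube_char_add: "tube_char (x + x') (y + y') \<eta> = tube_char x y \<eta> * tube_char x' y' \<eta>"
  by (simp add: tube_char_def exp_add[symmetric] inner_add_left algebra_simps)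

lemma cnj_tube_char: "cnj (tube_char x y \<eta>) = tube_char (- x) y \<eta>"
  by (simp add: tube_char_def exp_cnj)

lemma tube_char_imaginary: "tube_char 0 y \<eta> = of_real (exp (- (2 * pi * (y \<bullet> \<eta>))))"
  by (simp add: tube_char_def exp_of_real[symmetric])

lemma tube_char_measurable [measurable]:
  assumes [measurable]: "a \<in> borel_measurable M" "b \<in> borel_measurable M" "c \<in> borel_measurable M"
  shows "(\<lambda>t. tube_char (a t) (b t) (c t)) \<in> borel_measurable M"
  unfolding tube_char_def by measurable

lemma tube_char_holomorphic: "(\<lambda>\<zeta>. tube_char (a + Re \<zeta> *\<^sub>R c) (b + Im \<zeta> *\<^sub>R c) \<eta>) holomorphic_on S"
proof -
  have "tube_char (a + Re \<zeta> *\<^sub>R c) (b + Im \<zeta> *\<^sub>R c) \<eta>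
      = exp (of_real (2 * pi) * (\<i> * of_real (a \<bullet> \<eta>) - of_real (b \<bullet> \<eta>) + \<i> * \<zeta> * of_real (c \<bullet> \<eta>)))" for \<zeta>
    unfolding tube_char_def
    by (rule arg_cong[where f=exp]) (simp add: complex_eq_iff inner_add_left algebra_simps)
  thus ?thesis by (simp add: holomorphic_intros)
qed

section \<open>Fourier transforms of Gaussians\<close>

lemma
  assumes d: "0 < d"
  shows integrable_gauss_1d: "integrable lborel (\<lambda>t::real. exp (- (pi * d\<^sup>2 * t\<^sup>2)))"
    and fourier_gauss_1d: "(LBINT t. exp (\<i> * of_real (2 * pi * (s * t))) * of_real (exp (- (pi * d\<^sup>2 * t\<^sup>2))))
      = of_real (1 / d * exp (- (pi / d\<^sup>2 * s\<^sup>2)))"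
proof -
  \<comment> \<open>This dilation turns exp (- s^2 / 2) into exp (- \<pi> d^2 t^2), so the transform
    is read off from the characteristic function of the normal distribution.\<close>
  define c where "c = d * sqrt (2 * pi)"
  have c: "c > 0" using d by (simp add: c_def)
  have c2: "c\<^sup>2 = 2 * pi * d\<^sup>2" by (simp add: c_def power_mult_distrib)
  have nd: "std_normal_density (0 + c * t) = 1 / sqrt (2 * pi) * exp (- (pi * d\<^sup>2 * t\<^sup>2))" for t
    by (simp add: std_normal_density_def power_mult_distrib c2)
  have "integrable lborel (\<lambda>t. std_normal_density (0 + c * t))"
    using c by (intro lborel_integrable_real_affine) (auto intro: integrable_normal_density)
  hence "integrable lborel (\<lambda>t. sqrt (2 * pi) * (1 / sqrt (2 * pi) * exp (- (pi * d\<^sup>2 * t\<^sup>2))))"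
    unfolding nd by (rule integrable_mult_right)
  thus "integrable lborel (\<lambda>t::real. exp (- (pi * d\<^sup>2 * t\<^sup>2)))" by simp
  define r where "r = 2 * pi * s / c"
  have "char std_normal_distribution r = (LBINT t. std_normal_density t *\<^sub>R iexp (r * t))"
    unfolding char_def by (subst integral_density) (auto intro: AE_I2 normal_density_nonneg)
  also have "\<dots> = \<bar>c\<bar> *\<^sub>R (LBINT t. std_normal_density (0 + c * t) *\<^sub>R iexp (r * (0 + c * t)))"
    using c by (intro lborel_integral_real_affine) simp
  also have "\<dots> = c *\<^sub>R (LBINT t. of_real (1 / sqrt (2 * pi)) * (exp (\<i> * of_real (2 * pi * (s * t))) * of_real (exp (- (pi * d\<^sup>2 * t\<^sup>2)))))"
    unfolding nd using c by (simp add: r_def scaleR_conv_of_real mult_ac)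
  also have "\<dots> = of_real d * (LBINT t. exp (\<i> * of_real (2 * pi * (s * t))) * of_real (exp (- (pi * d\<^sup>2 * t\<^sup>2))))"
    by (simp only: integral_mult_right_zero) (simp add: c_def scaleR_conv_of_real)
  finally have 1: "of_real d * (LBINT t. exp (\<i> * of_real (2 * pi * (s * t))) * of_real (exp (- (pi * d\<^sup>2 * t\<^sup>2))))
      = complex_of_real (exp (- (r\<^sup>2) / 2))" by (simp add: char_std_normal_distribution)
  have "r\<^sup>2 / 2 = pi / d\<^sup>2 * s\<^sup>2" using d
    by (simp add: r_def power_divide power_mult_distrib c2) (simp add: power2_eq_square field_simps)
  hence "exp (- (r\<^sup>2) / 2) = exp (- (pi / d\<^sup>2 * s\<^sup>2))" by simp
  with 1 d show "(LBINT t. exp (\<i> * of_real (2 * pi * (s * t))) * of_real (exp (- (pi * d\<^sup>2 * t\<^sup>2))))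
      = of_real (1 / d * exp (- (pi / d\<^sup>2 * s\<^sup>2)))"
    by (simp add: field_simps)
qed

text \<open>In this normalization a factor exp (- \<pi> d^2 |\<eta>|^2) in frequency corresponds to
  convolution with the probability density \<open>rgauss d\<close>: Gaussian summability of an
  inversion integral is mollification at width \<open>d\<close>.\<close>

lemma
  assumes d: "0 < d"
  shows integrable_gauss_freq: "integrable lborel (\<lambda>\<eta>::real^'n. exp (- (pi * d\<^sup>2 * (norm \<eta>)\<^sup>2)))"
    and fourier_gauss: "(LBINT \<eta>. tube_char s 0 \<eta> * of_real (exp (- (pi * d\<^sup>2 * (norm (\<eta>::real^'n))\<^sup>2))))
      = of_real (rgauss d s)"
proof -
  have e: "exp (- (pi * d\<^sup>2 * (norm \<eta>)\<^sup>2)) = (\<Prod>j\<in>UNIV. exp (- (pi * d\<^sup>2 * (\<eta> $ j)\<^sup>2)))" for \<eta> :: "real^'n"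
    by (simp add: norm_power2_cart sum_distrib_left exp_sum[symmetric] sum_negf)
  show "integrable lborel (\<lambda>\<eta>::real^'n. exp (- (pi * d\<^sup>2 * (norm \<eta>)\<^sup>2)))"
    unfolding e by (intro integrable_lborel_cart_prod integrable_gauss_1d d)
  have t: "tube_char s 0 \<eta> = (\<Prod>j\<in>UNIV. exp (\<i> * of_real (2 * pi * (s $ j * \<eta> $ j))))" for \<eta> :: "real^'n"
    by (simp add: tube_char_def exp_sum[symmetric] inner_vec_def sum_distrib_left mult_ac)
  have i: "integrable lborel (\<lambda>t. exp (\<i> * of_real (2 * pi * (r * t))) * complex_of_real (exp (- (pi * d\<^sup>2 * t\<^sup>2))))" for r
    by (rule Bochner_Integration.integrable_bound[OF integrable_gauss_1d[OF d]])
       (auto simp: norm_mult)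
  have "(LBINT \<eta>. tube_char s 0 \<eta> * of_real (exp (- (pi * d\<^sup>2 * (norm (\<eta>::real^'n))\<^sup>2))))
      = (LBINT \<eta>. (\<Prod>j\<in>UNIV. exp (\<i> * of_real (2 * pi * (s $ j * (\<eta>::real^'n) $ j))) * of_real (exp (- (pi * d\<^sup>2 * (\<eta> $ j)\<^sup>2)))))"
    unfolding e t by (simp add: prod.distrib)
  also have "\<dots> = (\<Prod>j\<in>UNIV. of_real (1 / d * exp (- (pi / d\<^sup>2 * (s $ j)\<^sup>2))))"
    by (subst integral_lborel_cart_prod[OF i]) (simp only: fourier_gauss_1d[OF d])
  also have "\<dots> = of_real (rgauss d s)" unfolding rgauss_def by (simp only: of_real_prod)
  finally show "(LBINT \<eta>. tube_char s 0 \<eta> * of_real (exp (- (pi * d\<^sup>2 * (norm (\<eta>::real^'n))\<^sup>2))))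
      = of_real (rgauss d s)" .
qed

lemma
  assumes d: "0 < d"
  shows integrable_rgauss: "integrable lborel (rgauss d :: real^'n \<Rightarrow> real)"
    and integral_rgauss: "(LBINT x. rgauss d (x::real^'n)) = 1"
proof -
  have i: "integrable lborel (\<lambda>t::real. 1 / d * exp (- (pi / d\<^sup>2 * t\<^sup>2)))"
    using integrable_gauss_1d[of "1 / d"] d by (simp add: power_divide)
  show "integrable lborel (rgauss d :: real^'n \<Rightarrow> real)"
    using integrable_lborel_cart_prod[OF i] by (simp add: rgauss_def[abs_def])
  \<comment> \<open>The total mass is the transform with parameter \<open>1 / d\<close> at frequency
    0.\<close>
  have "complex_of_real (LBINT t. exp (- (pi / d\<^sup>2 * t\<^sup>2))) = of_real d"
    using fourier_gauss_1d[of "1 / d" 0] d by (simp add: power_divide)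
  hence "(LBINT t. exp (- (pi / d\<^sup>2 * t\<^sup>2))) = d" using of_real_eq_iff by blast
  hence "(LBINT t. 1 / d * exp (- (pi / d\<^sup>2 * t\<^sup>2))) = 1" using d by simp
  thus "(LBINT x. rgauss d (x::real^'n)) = 1"
    unfolding rgauss_def by (subst integral_lborel_cart_prod[OF i]) (simp del: integral_mult_right_zero)
qed

section \<open>Gaussian mollification\<close>

lemma rgauss_minus: "rgauss d (x - y) = rgauss d (y - x)"
  by (simp add: rgauss_def power2_commute)

lemma rgauss_scale:
  assumes "0 < d"
  shows "rgauss d (d *\<^sub>R (s::real^'n)) = inverse d ^ CARD('n) * rgauss 1 s"
proof -
  have "rgauss d (d *\<^sub>R s) = (\<Prod>j\<in>UNIV. inverse d * (1 / 1 * exp (- (pi / 1\<^sup>2 * (s $ j)\<^sup>2))))"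
    unfolding rgauss_def using assms by (intro prod.cong) (auto simp: power_mult_distrib inverse_eq_divide)
  thus ?thesis by (simp add: rgauss_def prod.distrib)
qed

text \<open>After the substitution t = x - d s the width sits in the argument of \<open>u\<close>,
  and the Gaussian weight no longer changes with \<open>d\<close>.\<close>

lemma mollify_eq:
  fixes u :: "real^'n \<Rightarrow> 'b::{banach,second_countable_topology}"
  assumes "0 < d" and [measurable]: "u \<in> borel_measurable borel"
  shows "(LBINT t. rgauss d (x - t) *\<^sub>R u t) = (LBINT s. rgauss 1 s *\<^sub>R u (x - d *\<^sub>R s))"
proof -
  have "(LBINT s. rgauss d (x - (x - d *\<^sub>R s)) *\<^sub>R u (x - d *\<^sub>R s))
      = (inverse \<bar>d\<bar> ^ CARD('n)) *\<^sub>R (LBINT t. rgauss d (x - t) *\<^sub>R u t)"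
    by (rule lborel_integral_reflect) (use assms(1) in simp_all)
  hence "(inverse d ^ CARD('n)) *\<^sub>R (LBINT s. rgauss 1 s *\<^sub>R u (x - d *\<^sub>R s))
      = (inverse d ^ CARD('n)) *\<^sub>R (LBINT t. rgauss d (x - t) *\<^sub>R u t)"
    using assms(1) by (simp add: rgauss_scale flip: scaleR_scaleR)
  thus ?thesis using assms(1) by simp
qed

text \<open>Polynomial growth of \<open>u\<close> is harmless: 1 + |x - d s| \<le> (1 + |x|) (1 +
  |s|) for d \<le> 1, and the Gaussian absorbs every power of 1 + |s|.\<close>

lemma mollify_tendsto:
  fixes u :: "real^'n \<Rightarrow> 'b::{banach,second_countable_topology}"
  assumes [measurable]: "u \<in> borel_measurable borel" and cont: "isCont u x"
    and bd: "\<And>t. norm (u t) \<le> M * (1 + norm t) ^ N"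
  shows "(\<lambda>m. LBINT t. rgauss (inverse (real (Suc m))) (x - t) *\<^sub>R u t) \<longlonglongrightarrow> u x"
proof -
  let ?d = "\<lambda>m. inverse (real (Suc m))"
  from rgauss_bound[of 1 N] obtain A where A: "A \<ge> 0"
    "\<And>s::real^'n. (1 + norm s) ^ N * rgauss 1 s \<le> A * pweight s" by auto
  have M: "0 \<le> M" using order_trans[OF norm_ge_zero bd, of 0] by simp
  have "(\<lambda>m. LBINT s. rgauss 1 s *\<^sub>R u (x - ?d m *\<^sub>R s)) \<longlonglongrightarrow> (LBINT s. rgauss 1 (s::real^'n) *\<^sub>R u x)"
  proof (rule integral_dominated_convergence[where w="\<lambda>s::real^'n. M * (1 + norm x) ^ N * A * pweight s"])
    show "AE s in lborel. (\<lambda>m. rgauss 1 s *\<^sub>R u (x - ?d m *\<^sub>R s)) \<longlonglongrightarrow> rgauss 1 s *\<^sub>R u x"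
    proof (intro AE_I2 tendsto_intros)
      fix s
      have "(\<lambda>m. x - ?d m *\<^sub>R s) \<longlonglongrightarrow> x - 0 *\<^sub>R s" by (intro tendsto_intros LIMSEQ_inverse_real_of_nat)
      thus "(\<lambda>m. u (x - ?d m *\<^sub>R s)) \<longlonglongrightarrow> u x" using isCont_tendsto_compose[OF cont] by simp
    qed
    show "AE s in lborel. norm (rgauss 1 s *\<^sub>R u (x - ?d m *\<^sub>R s)) \<le> M * (1 + norm x) ^ N * A * pweight s" for m
    proof (rule AE_I2)
      fix s
      have "norm (x - ?d m *\<^sub>R s) \<le> norm x + norm s"
      proof -
        have "?d m \<le> 1" by (simp add: inverse_eq_divide)
        hence "?d m * norm s \<le> norm s" by (intro mult_left_le_one_le) auto
        thus ?thesis using norm_triangle_ineq4[of x "?d m *\<^sub>R s"] by simp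
      qed
      hence "1 + norm (x - ?d m *\<^sub>R s) \<le> (1 + norm x) * (1 + norm s)"
        by (simp add: algebra_simps) (smt (verit) mult_nonneg_nonneg norm_ge_zero)
      hence "(1 + norm (x - ?d m *\<^sub>R s)) ^ N \<le> (1 + norm x) ^ N * (1 + norm s) ^ N"
        unfolding power_mult_distrib[symmetric] by (intro power_mono) auto
      hence "norm (u (x - ?d m *\<^sub>R s)) \<le> M * ((1 + norm x) ^ N * (1 + norm s) ^ N)"
        by (intro order_trans[OF bd] mult_left_mono M)
      hence "rgauss 1 s * norm (u (x - ?d m *\<^sub>R s)) \<le> rgauss 1 s * (M * ((1 + norm x) ^ N * (1 + norm s) ^ N))"
        by (intro mult_left_mono rgauss_nonneg) auto
      also have "\<dots> = M * (1 + norm x) ^ N * ((1 + norm s) ^ N * rgauss 1 s)" by (simp only: ac_simps)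
      also have "\<dots> \<le> M * (1 + norm x) ^ N * (A * pweight s)"
        using M by (intro mult_left_mono A(2)) simp
      finally show "norm (rgauss 1 s *\<^sub>R u (x - ?d m *\<^sub>R s)) \<le> M * (1 + norm x) ^ N * A * pweight s"
        using rgauss_nonneg[of 1 s] by (simp add: mult.assoc)
    qed
    show "integrable lborel (\<lambda>s::real^'n. M * (1 + norm x) ^ N * A * pweight s)"
      by (intro integrable_mult_right integrable_pweight)
  qed measurable
  moreover have "(LBINT s. rgauss 1 (s::real^'n) *\<^sub>R u x) = u x"
    using integrable_rgauss[of 1, where 'n='n] integral_rgauss[of 1, where 'n='n]
    by (subst integral_scaleR_left) auto
  ultimately show ?thesis using mollify_eq[of "?d m" u x for m] by simp
qed

text \<open>The multiplication formula of Fourier analysis, from Fubini's theorem. The kernel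
  \<open>e\<close> is any measurable one bounded by 1, so that characters of either sign are
  covered.\<close>

lemma fourier_exchange:
  fixes a b :: "real^'n \<Rightarrow> complex" and e :: "real^'n \<Rightarrow> real^'n \<Rightarrow> complex"
  assumes a: "integrable lborel a" and b: "integrable lborel b"
    and [measurable]: "case_prod e \<in> borel_measurable (borel \<Otimes>\<^sub>M borel)"
    and e: "\<And>x \<eta>. cmod (e x \<eta>) \<le> 1"
  shows "(LBINT x. (LBINT \<eta>. a \<eta> * e x \<eta>) * b x)
       = (LBINT \<eta>. a \<eta> * (LBINT x. b x * e x \<eta>))"
proof -
  let ?f = "\<lambda>(x, \<eta>). a \<eta> * e x \<eta> * b x"
  have [measurable]: "a \<in> borel_measurable borel" "b \<in> borel_measurable borel" using a b by auto
  have ex: "(\<lambda>\<eta>. e x \<eta>) \<in> borel_measurable borel" for x by measurable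
  have i: "integrable lborel (\<lambda>\<eta>. a \<eta> * e x \<eta>)" for x
    by (rule Bochner_Integration.integrable_bound[OF a])
       (use ex in \<open>auto intro!: mult_left_le e simp: norm_mult\<close>)
  have m2: "(\<lambda>p. e (fst p) (snd p)) \<in> borel_measurable (lborel \<Otimes>\<^sub>M lborel)"
    using assms(3) by (simp add: case_prod_beta' cong: measurable_cong_sets)
  have mf: "?f \<in> borel_measurable (lborel \<Otimes>\<^sub>M lborel)"
    using m2 by (simp add: case_prod_beta')
  have "integrable (lborel \<Otimes>\<^sub>M lborel) ?f"
  proof (rule lborel_pair.Fubini_integrable[OF mf])
    show "AE x in lborel. integrable lborel (\<lambda>\<eta>. ?f (x, \<eta>))" using i by (intro AE_I2) simp
    show "integrable lborel (\<lambda>x. LBINT \<eta>. norm (?f (x, \<eta>)))"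
    proof (rule Bochner_Integration.integrable_bound)
      show "integrable lborel (\<lambda>x. (LBINT \<eta>. cmod (a \<eta>)) * cmod (b x))" using b by simp
      show "(\<lambda>x. LBINT \<eta>. norm (?f (x, \<eta>))) \<in> borel_measurable lborel"
        using mf by (intro lborel.borel_measurable_lebesgue_integral) (simp add: case_prod_beta')
      show "AE x in lborel. norm (LBINT \<eta>. norm (?f (x, \<eta>))) \<le> norm ((LBINT \<eta>. cmod (a \<eta>)) * cmod (b x))"
      proof (rule AE_I2)
        fix x
        have "(LBINT \<eta>. norm (?f (x, \<eta>))) = (LBINT \<eta>. norm (a \<eta> * e x \<eta>)) * cmod (b x)"
          by (simp add: norm_mult)
        also have "\<dots> \<le> (LBINT \<eta>. cmod (a \<eta>)) * cmod (b x)"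
          using i a by (intro mult_right_mono integral_mono integrable_norm)
            (auto intro!: mult_left_le e simp: norm_mult)
        finally show "norm (LBINT \<eta>. norm (?f (x, \<eta>))) \<le> norm ((LBINT \<eta>. cmod (a \<eta>)) * cmod (b x))"
          by (simp add: order_trans[OF _ abs_ge_self] integral_nonneg)
      qed
    qed
  qed
  from lborel_pair.Fubini_integral[OF this]
  have "(LBINT \<eta>. (LBINT x. a \<eta> * e x \<eta> * b x))
      = (LBINT x. (LBINT \<eta>. a \<eta> * e x \<eta> * b x))" by simp
  moreover have "(LBINT x. a \<eta> * e x \<eta> * b x) = a \<eta> * (LBINT x. b x * e x \<eta>)" for \<eta>
    by (simp add: mult_ac flip: integral_mult_right_zero)
  ultimately show ?thesis by simp
qed

text \<open>In dimension n the term of degree 2n of the exponential series suffices, since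
  \<open>pweight x\<close> is at least the inverse of (1 + |x|)^(2n).\<close>

lemma exp_norm_le_pweight:
  assumes "0 < c"
  shows "\<exists>A\<ge>0. \<forall>x::real^'n. exp (- (c * norm x)) \<le> A * pweight x"
proof (intro exI conjI allI)
  let ?K = "2 * CARD('n)"
  show "0 \<le> exp c * (fact ?K / c ^ ?K)" using assms by simp
  fix x :: "real^'n"
  have p: "0 < 1 + norm x" by (auto intro: add_pos_nonneg)
  have "(c * (1 + norm x)) ^ ?K / fact ?K \<le> exp (c * (1 + norm x))"
    using assms by (intro power_div_fact_le_exp) simp
  hence 1: "(1 + norm x) ^ ?K \<le> fact ?K / c ^ ?K * exp (c * (1 + norm x))"
    using assms by (simp add: power_mult_distrib divide_simps mult.commute)
  have "(\<Prod>j\<in>(UNIV::'n set). inverse ((1 + norm x)\<^sup>2)) \<le> pweight x"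
    unfolding pweight_def
  proof (intro prod_mono conjI le_imp_inverse_le)
    fix j
    have "(x $ j)\<^sup>2 \<le> (norm x)\<^sup>2" using component_le_norm_cart[of x j] by (simp add: abs_le_square_iff[symmetric])
    moreover have "1 + (norm x)\<^sup>2 \<le> (1 + norm x)\<^sup>2" by (simp add: power2_eq_square algebra_simps)
    ultimately show "1 + (x $ j)\<^sup>2 \<le> (1 + norm x)\<^sup>2" by linarith
  qed (auto intro: add_pos_nonneg)
  hence 2: "inverse ((1 + norm x) ^ ?K) \<le> pweight x"
    by (simp add: power_mult power_inverse)
  have "exp (- (c * norm x)) = exp c * (exp (- (c * (1 + norm x))))"
    by (simp add: exp_add[symmetric] algebra_simps)
  also have "exp (- (c * (1 + norm x))) \<le> fact ?K / c ^ ?K * inverse ((1 + norm x) ^ ?K)"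
  proof -
    have "P \<le> Q * E \<Longrightarrow> 0 < P \<Longrightarrow> 0 < E \<Longrightarrow> inverse E \<le> Q * inverse P" for P Q E :: real
      by (simp add: field_simps)
    from this[OF 1 zero_less_power[OF p] exp_gt_zero] show ?thesis by (simp only: exp_minus)
  qed
  also have "\<dots> \<le> fact ?K / c ^ ?K * pweight x" using assms by (intro mult_left_mono 2) simp
  finally show "exp (- (c * norm x)) \<le> exp c * (fact ?K / c ^ ?K) * pweight x" by simp
qed

section \<open>The Cauchy and Poisson kernels\<close>

locale tube_cone =
  fixes C :: "(real^'n) set" and v :: "nat^'n"
  assumes open_C: "open C" and convex_C: "convex C" and cone_C: "vertex_cone C"
    and C_subset_nrant: "C \<subseteq> nrant v"
begin

lemma scaleR_in_C: "y \<in> C \<Longrightarrow> 0 < c \<Longrightarrow> c *\<^sub>R y \<in> C"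
  using cone_C by (simp add: vertex_cone_def)

lemma add_in_C:
  assumes "y \<in> C" "y' \<in> C"
  shows "y + y' \<in> C"
proof -
  have "(1/2) *\<^sub>R y + (1/2) *\<^sub>R y' \<in> C" using assms convex_C by (intro convexD) auto
  from scaleR_in_C[OF this, of 2] show ?thesis by (simp add: scaleR_add_right)
qed

lemma dual_cone_inner_nonneg: "\<eta> \<in> dual_cone C \<Longrightarrow> y \<in> C \<Longrightarrow> 0 \<le> y \<bullet> \<eta>"
  unfolding dual_cone_def by (subst inner_commute) simp

lemma closed_dual_cone: "closed (dual_cone C)"
proof -
  have "dual_cone C = (\<Inter>y\<in>C. {t. 0 \<le> t \<bullet> y})" by (auto simp: dual_cone_def)
  thus ?thesis by (auto intro!: closed_INT closed_Collect_le continuous_intros)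
qed

lemma dual_cone_measurable [measurable]: "dual_cone C \<in> sets borel"
  using closed_dual_cone by auto

text \<open>\<open>C\<close> is open: moving \<open>y\<close> against \<eta> by the length r/2 stays
  in \<open>C\<close>, and the pairing with \<eta> is still nonnegative there. This linear lower
  bound is what makes the kernel integral converge.\<close>

lemma dual_cone_coercive:
  assumes "y \<in> C"
  obtains \<delta> where "0 < \<delta>" "\<And>\<eta>. \<eta> \<in> dual_cone C \<Longrightarrow> \<delta> * norm \<eta> \<le> y \<bullet> \<eta>"
proof -
  from open_C assms obtain r where r: "0 < r" "ball y r \<subseteq> C" by (meson open_contains_ball)
  show thesis
  proof
    show "0 < r / 2" using r by simp
    fix \<eta> assume \<eta>: "\<eta> \<in> dual_cone C"
    show "r / 2 * norm \<eta> \<le> y \<bullet> \<eta>"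
    proof (cases "\<eta> = 0")
      case False
      have "y - (r / 2) *\<^sub>R (inverse (norm \<eta>) *\<^sub>R \<eta>) \<in> ball y r"
        using r False by (simp add: dist_norm)
      hence "0 \<le> (y - (r / 2) *\<^sub>R (inverse (norm \<eta>) *\<^sub>R \<eta>)) \<bullet> \<eta>"
        using r \<eta> by (intro dual_cone_inner_nonneg) auto
      hence "0 \<le> y \<bullet> \<eta> - r / 2 * ((inverse (norm \<eta>) *\<^sub>R \<eta>) \<bullet> \<eta>)"
        by (simp only: inner_diff_left inner_scaleR_left[of "r / 2"])
      moreover have eq: "(inverse (norm \<eta>) *\<^sub>R \<eta>) \<bullet> \<eta> = norm \<eta>"
        using False by (simp add: power2_norm_eq_inner[symmetric] power2_eq_square)
      ultimately show ?thesis unfolding eq by linarith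
    qed simp
  qed
qed

text \<open>Coordinates with matching signs have nonnegative products. The dual cone thus contains a
  closed orthant and is not a null set, from which positivity of the kernel at imaginary points
  follows.\<close>

lemma orthant_subset_dual_cone:
  assumes "\<And>j. 0 \<le> (-1) ^ (v $ j) * t $ j"
  shows "t \<in> dual_cone C"
  unfolding dual_cone_def
proof (intro CollectI ballI)
  fix y assume "y \<in> C"
  hence y: "0 < (-1) ^ (v $ j) * y $ j" for j using C_subset_nrant by (auto simp: nrant_def)
  have e: "t $ j * y $ j = ((-1) ^ (v $ j) * t $ j) * ((-1) ^ (v $ j) * y $ j)" for j
    by (simp add: power_add[symmetric] mult_ac flip: power_add)
  have n: "0 \<le> ((-1) ^ (v $ j) * t $ j) * ((-1) ^ (v $ j) * y $ j)" for j
    by (rule mult_nonneg_nonneg[OF assms less_imp_le[OF y]])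
  show "0 \<le> t \<bullet> y" unfolding inner_vec_def inner_real_def by (rule sum_nonneg) (subst e, rule n)
qed

text \<open>The modulus of the integrand of the Cauchy kernel at height \<open>y\<close>; its square
  is the same weight at height \<open>2 *\<^sub>R y\<close>.\<close>

definition laplace :: "real^'n \<Rightarrow> real^'n \<Rightarrow> real"
  where "laplace y \<eta> = indicator (dual_cone C) \<eta> * exp (- (2 * pi * (y \<bullet> \<eta>)))"

lemma laplace_measurable [measurable]: "laplace y \<in> borel_measurable borel"
  unfolding laplace_def by measurable

lemma laplace_nonneg: "0 \<le> laplace y \<eta>"
  by (simp add: laplace_def)

lemma integrable_laplace:
  assumes "y \<in> C"
  shows "integrable lborel (laplace y)"
proof -
  from dual_cone_coercive[OF assms] obtain \<delta> where
    d: "0 < \<delta>" "\<And>\<eta>. \<eta> \<in> dual_cone C \<Longrightarrow> \<delta> * norm \<eta> \<le> y \<bullet> \<eta>" by blast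
  obtain A where A: "0 \<le> A" "\<And>x::real^'n. exp (- (2 * pi * \<delta> * norm x)) \<le> A * pweight x"
    using exp_norm_le_pweight[of "2 * pi * \<delta>"] d(1) by auto
  show ?thesis
  proof (rule integrable_pweight_bound)
    show "norm (laplace y \<eta>) \<le> A * pweight \<eta>" for \<eta>
    proof (cases "\<eta> \<in> dual_cone C")
      case True
      have "2 * pi * (\<delta> * norm \<eta>) \<le> 2 * pi * (y \<bullet> \<eta>)" using d(2)[OF True] by (intro mult_left_mono) auto
      hence "exp (- (2 * pi * (y \<bullet> \<eta>))) \<le> exp (- (2 * pi * \<delta> * norm \<eta>))" by (simp add: mult.assoc)
      also have "\<dots> \<le> A * pweight \<eta>" by (rule A)
      finally show ?thesis using True by (simp add: laplace_def)
    next
      case False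
      thus ?thesis using A(1) pweight_nonneg[of \<eta>] by (simp add: laplace_def)
    qed
  qed simp
qed

text \<open>The condition on \<open>y'\<close> is nonnegativity on the dual cone instead of
  membership in \<open>C\<close>, so that \<open>y' = 0\<close> is allowed.\<close>

lemma laplace_add_le:
  assumes "\<And>\<eta>. \<eta> \<in> dual_cone C \<Longrightarrow> 0 \<le> y' \<bullet> \<eta>"
  shows "laplace (y + y') \<eta> \<le> laplace y \<eta>"
  using assms[of \<eta>] by (auto simp: laplace_def inner_add_left indicator_def)

definition kern :: "real^'n \<Rightarrow> real^'n \<Rightarrow> complex"
  where "kern x y = (LBINT \<eta>. of_real (laplace y \<eta>) * tube_char x 0 \<eta>)"

text \<open>The Cauchy kernel at the imaginary point iy, where it is real; the denominator of the
  Poisson kernel is \<open>kern0 (2 *\<^sub>R y)\<close>.\<close>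

definition kern0 :: "real^'n \<Rightarrow> real"
  where "kern0 y = (LBINT \<eta>. laplace y \<eta>)"

lemma cmod_tube_char_real [simp]: "cmod (tube_char x 0 \<eta>) = 1"
  by (simp add: cmod_tube_char)

lemma integrable_laplace_char:
  assumes "y \<in> C"
  shows "integrable lborel (\<lambda>\<eta>. of_real (laplace y \<eta>) * tube_char x 0 \<eta>)"
  by (rule Bochner_Integration.integrable_bound[OF integrable_laplace[OF assms]])
     (simp_all add: norm_mult)

lemma cmod_kern_le: "y \<in> C \<Longrightarrow> cmod (kern x y) \<le> kern0 y"
  unfolding kern_def kern0_def
  using integral_norm_bound[of lborel "\<lambda>\<eta>. of_real (laplace y \<eta>) * tube_char x 0 \<eta>"]
  by (simp add: norm_mult laplace_nonneg)

lemma kern0_nonneg: "0 \<le> kern0 y"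
  unfolding kern0_def by (rule Bochner_Integration.integral_nonneg) (rule laplace_nonneg)

lemma kern_zero: "kern 0 y = of_real (kern0 y)"
  by (simp add: kern_def kern0_def tube_char_def)

lemma kern0_pos:
  assumes "y \<in> C"
  shows "0 < kern0 y"
proof -
  have "kern0 y \<noteq> 0"
  proof
    assume "kern0 y = 0"
    hence "AE \<eta> in lborel. laplace y \<eta> = 0"
      using integral_nonneg_eq_0_iff_AE[OF integrable_laplace[OF assms]] laplace_nonneg
      by (simp add: kern0_def)
    hence ae: "AE \<eta> in lborel. \<eta> \<notin> dual_cone C" by eventually_elim (auto simp: laplace_def)
    \<comment> \<open>The sign vector of the n-rant: on the closed unit ball about it every
      coordinate is 0 or has the right sign, so the ball lies in the dual cone.\<close>
    define a :: "real^'n" where "a = (\<chi> j. (-1) ^ (v $ j))"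
    have "cball a 1 \<subseteq> dual_cone C"
    proof
      fix t assume "t \<in> cball a 1"
      hence "norm (t - a) \<le> 1" by (simp add: dist_norm norm_minus_commute)
      hence t: "\<bar>t $ j - a $ j\<bar> \<le> 1" for j using component_le_norm_cart[of "t - a" j] by simp
      show "t \<in> dual_cone C"
      proof (rule orthant_subset_dual_cone)
        fix j
        consider "(-1::real) ^ (v $ j) = 1" | "(-1::real) ^ (v $ j) = -1" using neg_one_even_power neg_one_odd_power by blast
        thus "0 \<le> (-1) ^ (v $ j) * t $ j" using t[of j] by cases (auto simp: a_def)
      qed
    qed
    hence "ball a 1 \<subseteq> dual_cone C" using ball_subset_cball by blast
    with ae have "AE \<eta> in lborel. \<eta> \<notin> ball a 1" by (blast intro: eventually_mono)
    hence "emeasure lborel (ball a 1) = 0" by (subst (asm) AE_iff_measurable[where N="ball a 1"]) auto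
    hence "open (ball a 1) \<and> ball a 1 \<in> null_sets lborel" by (auto intro!: null_setsI)
    thus False using open_not_negligible[of "ball a 1"] by (auto simp: negligible_iff_null_sets null_sets_completionI)
  qed
  thus ?thesis using kern0_nonneg[of y] by linarith
qed

lemma kern0_mono:
  assumes "y \<in> C" "\<And>\<eta>. \<eta> \<in> dual_cone C \<Longrightarrow> 0 \<le> y' \<bullet> \<eta>" "y + y' \<in> C"
  shows "kern0 (y + y') \<le> kern0 y"
  unfolding kern0_def
  using assms by (intro integral_mono integrable_laplace laplace_add_le)

lemma kern_minus: "kern (- x) y = cnj (kern x y)"
proof -
  have "cnj (kern x y) = (LBINT \<eta>. cnj (of_real (laplace y \<eta>) * tube_char x 0 \<eta>))"
    unfolding kern_def by (rule Bochner_Integration.integral_cnj[symmetric])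
  thus ?thesis by (simp add: kern_def cnj_tube_char)
qed

lemma kern_measurable [measurable]:
  assumes [measurable]: "a \<in> borel_measurable M"
  shows "(\<lambda>t. kern (a t) y) \<in> borel_measurable M"
proof -
  have "(\<lambda>x. kern x y) \<in> borel_measurable borel"
    unfolding kern_def
    by (rule lborel.borel_measurable_lebesgue_integral[of "\<lambda>x \<eta>. of_real (laplace y \<eta>) * tube_char x 0 \<eta>" borel]) measurable
  from measurable_compose[OF assms this] show ?thesis .
qed

lemma continuous_tube_char:
  "continuous_on UNIV (\<lambda>x. tube_char x y \<eta>)" "continuous_on UNIV (\<lambda>y. tube_char x y \<eta>)"
  unfolding tube_char_def by (intro continuous_intros)+

lemma isCont_kern:
  assumes "y \<in> C"
  shows "isCont (\<lambda>x. kern x y) x"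
  unfolding isCont_def kern_def
proof (rule tendsto_parametric_integral[where B="laplace y"])
  show "((\<lambda>q. of_real (laplace y t) * tube_char q 0 t) \<longlongrightarrow> of_real (laplace y t) * tube_char x 0 t) (at x)" for t
    using continuous_tube_char(1)[of 0 t]
    by (intro tendsto_intros) (simp add: continuous_on_eq_continuous_at isCont_def)
qed (auto simp: norm_mult laplace_nonneg integrable_laplace assms)

text \<open>Neither factor on the left is holomorphic in x + iy; recombined they form one
  exponential of the complex point.\<close>

lemma of_real_laplace:
  "of_real (laplace y \<eta>) * tube_char x 0 \<eta> = of_real (indicator (dual_cone C) \<eta>) * tube_char x y \<eta>"
  using tube_char_add[of 0 x y 0 \<eta>] by (simp add: laplace_def tube_char_imaginary)

text \<open>The offset \<open>y0\<close> keeps the argument away from the boundary of the tube, so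
  \<open>laplace y0\<close> dominates on the whole half-plane; the radius 1 in the proof is
  arbitrary.\<close>

lemma kern_holomorphic:
  assumes y: "y \<in> C" and y0: "y0 \<in> C"
  shows "(\<lambda>\<zeta>. kern (x + Re \<zeta> *\<^sub>R y) (y0 + Im \<zeta> *\<^sub>R y)) holomorphic_on {\<zeta>. Im \<zeta> > 0}"
  unfolding kern_def
proof (rule holomorphic_on_parametric_integral[OF open_halfspace_Im_gt])
  show "(\<lambda>\<zeta>. of_real (laplace (y0 + Im \<zeta> *\<^sub>R y) t) * tube_char (x + Re \<zeta> *\<^sub>R y) 0 t) holomorphic_on {\<zeta>. 0 < Im \<zeta>}" for t
    unfolding of_real_laplace by (intro holomorphic_intros tube_char_holomorphic)
  fix z :: complex assume "z \<in> {\<zeta>. 0 < Im \<zeta>}"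
  show "\<exists>r>0. \<exists>B. integrable lborel B \<and> (\<forall>w\<in>{\<zeta>. 0 < Im \<zeta>} \<inter> ball z r.
     \<forall>t. cmod (complex_of_real (laplace (y0 + Im w *\<^sub>R y) t) * tube_char (x + Re w *\<^sub>R y) 0 t) \<le> B t)"
  proof (intro exI[of _ 1] exI[of _ "laplace y0"] conjI ballI allI integrable_laplace y0)
    fix w t assume "w \<in> {\<zeta>. 0 < Im \<zeta>} \<inter> ball z 1"
    hence "laplace (y0 + Im w *\<^sub>R y) t \<le> laplace y0 t"
      by (intro laplace_add_le) (simp add: dual_cone_inner_nonneg y)
    thus "cmod (complex_of_real (laplace (y0 + Im w *\<^sub>R y) t) * tube_char (x + Re w *\<^sub>R y) 0 t) \<le> laplace y0 t"
      by (simp add: norm_mult laplace_nonneg)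
  qed simp
qed simp

lemma kern_tendsto:
  assumes y: "y \<in> C" and y0: "y0 \<in> C"
  shows "((\<lambda>l. kern x (y0 + l *\<^sub>R y)) \<longlongrightarrow> kern x y0) (at_right 0)"
  unfolding kern_def
proof (rule tendsto_parametric_integral[where B="laplace y0"])
  fix t
  have "((\<lambda>l. indicator (dual_cone C) t * exp (- (2 * pi * ((y0 + l *\<^sub>R y) \<bullet> t))))
      \<longlongrightarrow> indicator (dual_cone C) t * exp (- (2 * pi * ((y0 + 0 *\<^sub>R y) \<bullet> t)))) (at_right 0)"
    by (intro tendsto_intros)
  hence "((\<lambda>l. laplace (y0 + l *\<^sub>R y) t) \<longlongrightarrow> laplace y0 t) (at_right 0)"
    by (simp add: laplace_def)
  thus "((\<lambda>l. of_real (laplace (y0 + l *\<^sub>R y) t) * tube_char x 0 t) \<longlongrightarrow> of_real (laplace y0 t) * tube_char x 0 t) (at_right 0)"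
    by (intro tendsto_mult tendsto_of_real tendsto_const)
next
  fix l t :: "_" assume "l \<in> {0::real<..}"
  hence "laplace (y0 + l *\<^sub>R y) t \<le> laplace y0 t" for t
    by (intro laplace_add_le) (simp add: dual_cone_inner_nonneg y)
  thus "norm (of_real (laplace (y0 + l *\<^sub>R y) t) * tube_char x 0 t) \<le> laplace y0 t" for t
    by (simp add: norm_mult laplace_nonneg)
qed (auto simp: integrable_laplace y0)

text \<open>A Gaussian factor makes Fubini's theorem applicable; the mass of the Gaussian in
  \<open>\<eta> - \<xi>\<close> and \<open>2 a b \<le> a\<^sup>2 + b\<^sup>2\<close> replace Plancherel's theorem.\<close>

lemma gauss_integral_kern_square_le:
  assumes y: "y \<in> C" and d: "0 < d"
  shows "(LBINT x. (cmod (kern x y))\<^sup>2 * exp (- (pi * d\<^sup>2 * (norm x)\<^sup>2))) \<le> kern0 (2 *\<^sub>R y)"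
proof -
  let ?g = "\<lambda>x::real^'n. exp (- (pi * d\<^sup>2 * (norm x)\<^sup>2))"
  let ?l = "\<lambda>\<eta>. complex_of_real (laplace y \<eta>)"
  have il: "integrable lborel ?l" using integrable_laplace[OF y] by simp
  have ig: "integrable lborel ?g" by (rule integrable_gauss_freq[OF d])
  have y2: "2 *\<^sub>R y \<in> C" using scaleR_in_C[OF y, of 2] by simp
  \<comment> \<open>This doubling is the reason why K(2iy) normalizes the Poisson kernel.\<close>
  have sq: "(laplace y \<eta>)\<^sup>2 = laplace (2 *\<^sub>R y) \<eta>" for \<eta>
    by (auto simp: laplace_def power_mult_distrib exp_double[symmetric] indicator_def)
  have ilc: "integrable lborel (\<lambda>x. cnj (kern x y) * complex_of_real (?g x))"
    by (rule Bochner_Integration.integrable_bound[OF integrable_mult_right[OF ig, of "kern0 y"]])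
       (auto simp: norm_mult kern0_nonneg kern_minus[symmetric] intro!: mult_right_mono cmod_kern_le y)
  \<comment> \<open>Integration over \<open>x\<close> replaces the Gaussian by its transform, so the
    square integral becomes a double integral of \<open>laplace y\<close> against itself with the
    approximate identity \<open>rgauss d\<close> in between.\<close>
  have inner: "(LBINT x. (cnj (kern x y) * complex_of_real (?g x)) * tube_char x 0 \<eta>)
      = of_real (LBINT \<xi>. laplace y \<xi> * rgauss d (\<eta> - \<xi>))" for \<eta>
  proof -
    have 1: "cnj (kern x y) = (LBINT \<xi>. ?l \<xi> * tube_char (- x) 0 \<xi>)" for x
      unfolding kern_minus[symmetric] by (rule kern_def)
    have ib: "integrable lborel (\<lambda>x. complex_of_real (?g x) * tube_char x 0 \<eta>)"
      by (rule Bochner_Integration.integrable_bound[OF ig]) (auto simp: norm_mult)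
    have "(LBINT x. (cnj (kern x y) * complex_of_real (?g x)) * tube_char x 0 \<eta>)
       = (LBINT x. (LBINT \<xi>. ?l \<xi> * tube_char (- x) 0 \<xi>) * (complex_of_real (?g x) * tube_char x 0 \<eta>))"
      by (simp only: 1 mult.assoc)
    also have "\<dots> = (LBINT \<xi>. ?l \<xi> * (LBINT x. complex_of_real (?g x) * tube_char x 0 \<eta> * tube_char (- x) 0 \<xi>))"
      by (rule fourier_exchange[OF il ib]) simp_all
    also have "(\<lambda>\<xi>. (LBINT x. complex_of_real (?g x) * tube_char x 0 \<eta> * tube_char (- x) 0 \<xi>))
        = (\<lambda>\<xi>. of_real (rgauss d (\<eta> - \<xi>)))"
    proof
      fix \<xi>
      have e: "tube_char x 0 \<eta> * tube_char (- x) 0 \<xi> = tube_char (\<eta> - \<xi>) 0 x" for x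
        by (simp add: tube_char_def exp_add[symmetric] inner_commute inner_diff_left algebra_simps)
      have e': "complex_of_real (?g x) * tube_char x 0 \<eta> * tube_char (- x) 0 \<xi>
          = tube_char (\<eta> - \<xi>) 0 x * complex_of_real (?g x)" for x
        by (simp only: e[symmetric] ac_simps)
      show "(LBINT x. complex_of_real (?g x) * tube_char x 0 \<eta> * tube_char (- x) 0 \<xi>) = of_real (rgauss d (\<eta> - \<xi>))"
        unfolding e' by (rule fourier_gauss[OF d])
    qed
    finally show ?thesis by (simp flip: of_real_mult)
  qed
  have "complex_of_real (LBINT x. (cmod (kern x y))\<^sup>2 * ?g x)
      = (LBINT x. kern x y * (cnj (kern x y) * complex_of_real (?g x)))"
    by (simp add: complex_norm_square mult.assoc flip: integral_complex_of_real of_real_power)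
  also have "\<dots> = (LBINT \<eta>. ?l \<eta> * (LBINT x. (cnj (kern x y) * complex_of_real (?g x)) * tube_char x 0 \<eta>))"
    unfolding kern_def[of _ y, symmetric]
    using fourier_exchange[OF il ilc, of "\<lambda>x. tube_char x 0"] by (simp add: kern_def)
  also have "\<dots> = of_real (LBINT \<eta>. laplace y \<eta> * (LBINT \<xi>. laplace y \<xi> * rgauss d (\<eta> - \<xi>)))"
    unfolding inner by (simp flip: of_real_mult)
  finally have eq: "(LBINT x. (cmod (kern x y))\<^sup>2 * ?g x)
      = (LBINT \<eta>. laplace y \<eta> * (LBINT \<xi>. laplace y \<xi> * rgauss d (\<eta> - \<xi>)))"
    using of_real_eq_iff by blast
  show ?thesis
  proof -
    let ?L = "laplace (2 *\<^sub>R y)"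
    let ?N = "\<lambda>f. \<integral>\<^sup>+\<eta>. \<integral>\<^sup>+\<xi>. ennreal (f \<eta> \<xi>) \<partial>lborel \<partial>lborel"
    have r1: "(\<integral>\<^sup>+\<xi>. ennreal (rgauss d (\<eta> - \<xi>)) \<partial>lborel) = 1" for \<eta> :: "real^'n"
    proof -
      have "integrable lborel (\<lambda>\<xi>. rgauss d (\<eta> - \<xi>))"
        using integrable_rgauss[OF d, where 'n='n] lborel_integrable_reflect by blast
      moreover have "(LBINT \<xi>. rgauss d (\<eta> - \<xi>)) = 1"
        using lborel_integral_reflect[of "rgauss d" 1 \<eta>] integral_rgauss[OF d, where 'n='n] by simp
      ultimately show ?thesis using rgauss_nonneg[OF d] by (subst nn_integral_eq_integral) auto
    qed
    have il': "integrable lborel (\<lambda>\<xi>. laplace y \<xi> * rgauss d (\<eta> - \<xi>))" for \<eta>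
    proof (rule Bochner_Integration.integrable_bound)
      show "integrable lborel (\<lambda>\<xi>. rgauss d (\<eta> - \<xi>))"
        using integrable_rgauss[OF d, where 'n='n] lborel_integrable_reflect by blast
      have "laplace y \<xi> \<le> 1" for \<xi>
        using dual_cone_inner_nonneg[OF _ y, of \<xi>] by (auto simp: laplace_def indicator_def)
      thus "AE \<xi> in lborel. norm (laplace y \<xi> * rgauss d (\<eta> - \<xi>)) \<le> norm (rgauss d (\<eta> - \<xi>))"
        using laplace_nonneg rgauss_nonneg[OF d] by (auto simp: abs_mult intro!: mult_left_le_one_le)
    qed simp
    have L: "(\<integral>\<^sup>+\<eta>. ennreal (1/2 * ?L \<eta>) \<partial>lborel) = ennreal (1/2 * kern0 (2 *\<^sub>R y))"
      unfolding kern0_def using integrable_laplace[OF y2] laplace_nonneg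
      by (subst nn_integral_eq_integral) auto
    have le: "ennreal (laplace y \<eta> * (LBINT \<xi>. laplace y \<xi> * rgauss d (\<eta> - \<xi>)))
        \<le> ennreal (1/2 * ?L \<eta>) + (\<integral>\<^sup>+\<xi>. ennreal (1/2 * ?L \<xi>) * ennreal (rgauss d (\<eta> - \<xi>)) \<partial>lborel)" for \<eta>
    proof -
      have "ennreal (laplace y \<eta> * (LBINT \<xi>. laplace y \<xi> * rgauss d (\<eta> - \<xi>)))
          = ennreal (LBINT \<xi>. laplace y \<eta> * (laplace y \<xi> * rgauss d (\<eta> - \<xi>)))" by simp
      also have "\<dots> = (\<integral>\<^sup>+\<xi>. ennreal (laplace y \<eta> * (laplace y \<xi> * rgauss d (\<eta> - \<xi>))) \<partial>lborel)"
        using il' laplace_nonneg rgauss_nonneg[OF d]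
        by (subst nn_integral_eq_integral) (auto intro!: AE_I2 mult_nonneg_nonneg)
      also have "\<dots> \<le> (\<integral>\<^sup>+\<xi>. ennreal (1/2 * ?L \<eta>) * ennreal (rgauss d (\<eta> - \<xi>)) + ennreal (1/2 * ?L \<xi>) * ennreal (rgauss d (\<eta> - \<xi>)) \<partial>lborel)"
      proof (rule nn_integral_mono)
        fix \<xi>
        have "0 \<le> (laplace y \<eta> - laplace y \<xi>)\<^sup>2" by simp
        hence "laplace y \<eta> * laplace y \<xi> \<le> 1/2 * ?L \<eta> + 1/2 * ?L \<xi>"
          unfolding sq[symmetric] by (simp add: power2_eq_square algebra_simps)
        hence "laplace y \<eta> * laplace y \<xi> * rgauss d (\<eta> - \<xi>) \<le> (1/2 * ?L \<eta> + 1/2 * ?L \<xi>) * rgauss d (\<eta> - \<xi>)"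
          by (intro mult_right_mono rgauss_nonneg d)
        hence "ennreal (laplace y \<eta> * (laplace y \<xi> * rgauss d (\<eta> - \<xi>)))
            \<le> ennreal (1/2 * ?L \<eta> * rgauss d (\<eta> - \<xi>) + 1/2 * ?L \<xi> * rgauss d (\<eta> - \<xi>))"
          by (intro ennreal_leI) (simp only: distrib_right mult.assoc)
        also have "\<dots> = ennreal (1/2 * ?L \<eta>) * ennreal (rgauss d (\<eta> - \<xi>)) + ennreal (1/2 * ?L \<xi>) * ennreal (rgauss d (\<eta> - \<xi>))"
        proof -
          have *: "0 \<le> a \<Longrightarrow> 0 \<le> b \<Longrightarrow> 0 \<le> r \<Longrightarrow>
            ennreal (a * r + b * r) = ennreal a * ennreal r + ennreal b * ennreal r" for a b r
            by (simp add: ennreal_mult)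
          show ?thesis by (rule *) (simp_all add: laplace_nonneg rgauss_nonneg d)
        qed
        finally show "ennreal (laplace y \<eta> * (laplace y \<xi> * rgauss d (\<eta> - \<xi>)))
            \<le> ennreal (1/2 * ?L \<eta>) * ennreal (rgauss d (\<eta> - \<xi>)) + ennreal (1/2 * ?L \<xi>) * ennreal (rgauss d (\<eta> - \<xi>))" .
      qed
      also have "\<dots> = ennreal (1/2 * ?L \<eta>) + (\<integral>\<^sup>+\<xi>. ennreal (1/2 * ?L \<xi>) * ennreal (rgauss d (\<eta> - \<xi>)) \<partial>lborel)"
        by (subst nn_integral_add) (auto simp: nn_integral_cmult r1)
      finally show ?thesis .
    qed
    have "(\<integral>\<^sup>+\<eta>. ennreal (laplace y \<eta> * (LBINT \<xi>. laplace y \<xi> * rgauss d (\<eta> - \<xi>))) \<partial>lborel)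
       \<le> (\<integral>\<^sup>+\<eta>. ennreal (1/2 * ?L \<eta>) + (\<integral>\<^sup>+\<xi>. ennreal (1/2 * ?L \<xi>) * ennreal (rgauss d (\<eta> - \<xi>)) \<partial>lborel) \<partial>lborel)"
      by (rule nn_integral_mono) (rule le)
    also have "\<dots> = (\<integral>\<^sup>+\<eta>. ennreal (1/2 * ?L \<eta>) \<partial>lborel)
        + (\<integral>\<^sup>+\<eta>. \<integral>\<^sup>+\<xi>. ennreal (1/2 * ?L \<xi>) * ennreal (rgauss d (\<eta> - \<xi>)) \<partial>lborel \<partial>lborel)"
      by (rule nn_integral_add) measurable
    also have "(\<integral>\<^sup>+\<eta>. \<integral>\<^sup>+\<xi>. ennreal (1/2 * ?L \<xi>) * ennreal (rgauss d (\<eta> - \<xi>)) \<partial>lborel \<partial>lborel)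
        = (\<integral>\<^sup>+\<xi>. \<integral>\<^sup>+\<eta>. ennreal (1/2 * ?L \<xi>) * ennreal (rgauss d (\<eta> - \<xi>)) \<partial>lborel \<partial>lborel)"
      by (rule lborel_pair.Fubini') measurable
    also have "\<dots> = (\<integral>\<^sup>+\<xi>. ennreal (1/2 * ?L \<xi>) \<partial>lborel)"
      by (simp add: nn_integral_cmult rgauss_minus[of d _ "_::real^'n"] r1)
    also have "(\<integral>\<^sup>+\<eta>. ennreal (1/2 * ?L \<eta>) \<partial>lborel) + (\<integral>\<^sup>+\<eta>. ennreal (1/2 * ?L \<eta>) \<partial>lborel) = ennreal (kern0 (2 *\<^sub>R y))"
      unfolding L using kern0_nonneg[of "2 *\<^sub>R y"] by (subst ennreal_plus[symmetric]) auto
    finally show ?thesis unfolding eq by (rule integral_real_bounded[OF kern0_nonneg])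
  qed
qed

text \<open>Fatou's lemma as the width parameter tends to 0. An inequality is enough, since it
  serves to bound the mass of the Poisson kernel by 1.\<close>

lemma nn_integral_kern_square_le:
  assumes y: "y \<in> C"
  shows "(\<integral>\<^sup>+x. ennreal ((cmod (kern x y))\<^sup>2) \<partial>lborel) \<le> ennreal (kern0 (2 *\<^sub>R y))"
proof -
  define d where "d m = inverse (real (Suc m))" for m
  have d: "0 < d m" for m by (simp add: d_def)
  let ?F = "\<lambda>m x. (cmod (kern x y))\<^sup>2 * exp (- (pi * (d m)\<^sup>2 * (norm x)\<^sup>2))"
  have lim: "(\<lambda>m. ennreal (?F m x)) \<longlonglongrightarrow> ennreal ((cmod (kern x y))\<^sup>2)" for x
  proof -
    have "(\<lambda>m. ?F m x) \<longlonglongrightarrow> (cmod (kern x y))\<^sup>2 * exp (- (pi * 0\<^sup>2 * (norm x)\<^sup>2))"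
      unfolding d_def by (intro tendsto_intros LIMSEQ_inverse_real_of_nat)
    thus ?thesis by (intro tendsto_ennrealI) simp
  qed
  have b: "(\<integral>\<^sup>+x. ennreal (?F m x) \<partial>lborel) \<le> ennreal (kern0 (2 *\<^sub>R y))" for m
  proof -
    have "integrable lborel (?F m)"
    proof (rule Bochner_Integration.integrable_bound[OF integrable_mult_right[OF integrable_gauss_freq[OF d], of "(kern0 y)\<^sup>2"]])
      show "AE x in lborel. norm (?F m x) \<le> norm ((kern0 y)\<^sup>2 * exp (- (pi * (d m)\<^sup>2 * (norm x)\<^sup>2)))"
        using cmod_kern_le[OF y] by (auto simp: abs_mult intro!: mult_right_mono power_mono)
    qed measurable
    thus ?thesis
      using gauss_integral_kern_square_le[OF y d] by (subst nn_integral_eq_integral) (auto intro: ennreal_leI)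
  qed
  have "(\<integral>\<^sup>+x. ennreal ((cmod (kern x y))\<^sup>2) \<partial>lborel) = (\<integral>\<^sup>+x. liminf (\<lambda>m. ennreal (?F m x)) \<partial>lborel)"
    using lim by (intro nn_integral_cong lim_imp_Liminf[symmetric] lim) simp
  also have "\<dots> \<le> liminf (\<lambda>m. \<integral>\<^sup>+x. ennreal (?F m x) \<partial>lborel)"
    by (rule nn_integral_liminf) measurable
  also have "\<dots> \<le> ennreal (kern0 (2 *\<^sub>R y))"
    using b by (intro Liminf_le) auto
  finally show ?thesis .
qed

end

section \<open>Cauchy's formula for dominated functions\<close>

text \<open>Confines the limit of small heights to heights below 1, where exponentials of the height
  are uniformly bounded.\<close>

lemma at_within_unit_interval: "at (0::real) within {0<..<1} = at 0 within {0<..}"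
  by (rule at_within_nhd[of _ "{-1<..<1}"]) auto

context tube_cone
begin

text \<open>One majorant for all heights does double duty: it makes the boundary values integrable
  and lets the height tend to infinity. Holomorphy enters through a single fact: if \<Phi> is the
  transform of the boundary values, then the transform at height y is \<Phi>(\<eta>) exp (- 2 \<pi>
  <y, \<eta>>).\<close>

lemma cauchy_formula:
  fixes G :: "real^'n \<Rightarrow> real^'n \<Rightarrow> complex"
  assumes holo: "\<And>x y. y \<in> C \<Longrightarrow> (\<lambda>\<zeta>. G (x + Re \<zeta> *\<^sub>R y) (Im \<zeta> *\<^sub>R y)) holomorphic_on {\<zeta>. Im \<zeta> > 0}"
    and meas: "\<And>y. y \<in> C \<Longrightarrow> (\<lambda>x. G x y) \<in> borel_measurable borel"
    and meas0 [measurable]: "(\<lambda>x. G x 0) \<in> borel_measurable borel"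
    and bound: "\<And>y. y \<in> C \<Longrightarrow> \<exists>A. \<forall>x l. 0 \<le> l \<longrightarrow> cmod (G x (l *\<^sub>R y)) \<le> A * pweight x"
    and lim: "\<And>x y. y \<in> C \<Longrightarrow> ((\<lambda>l. G x (l *\<^sub>R y)) \<longlongrightarrow> G x 0) (at_right 0)"
    and y0: "y0 \<in> C" and cont: "isCont (\<lambda>x. G x y0) x0"
  shows "G x0 y0 = (LBINT t. G t 0 * kern (x0 - t) y0)"
proof -
  define \<Phi> where "\<Phi> \<eta> = (LBINT t. G t 0 * tube_char (- t) 0 \<eta>)" for \<eta>
  have G0: "integrable lborel (\<lambda>x. G x 0)"
  proof -
    from bound[OF y0] obtain A where A: "\<And>x l. 0 \<le> l \<Longrightarrow> cmod (G x (l *\<^sub>R y0)) \<le> A * pweight x" by blast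
    show ?thesis using A[of 0] by (intro integrable_pweight_bound[where A=A]) simp_all
  qed
  \<comment> \<open>The exponential is shifted along with \<open>G\<close>, so the product is
    holomorphic along the ray and its integral is the same at every height; the common value is
    found by letting the height tend to 0.\<close>
  have shift: "(LBINT t. G t y * tube_char (- t) (- y) \<eta>) = \<Phi> \<eta>" if y: "y \<in> C" for y \<eta>
  proof -
    let ?T = "\<lambda>t l. G t (l *\<^sub>R y) * tube_char (- t) (- (l *\<^sub>R y)) \<eta>"
    from bound[OF y] obtain A where A: "\<And>x l. 0 \<le> l \<Longrightarrow> cmod (G x (l *\<^sub>R y)) \<le> A * pweight x" by blast
    have A0: "0 \<le> A * pweight x" for x :: "real^'n" using order_trans[OF norm_ge_zero A[of 0 x]] by simp
    have const: "(LBINT t. ?T t l)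
        = (LBINT t. ?T t 1)" if "0 < l" for l
    proof (rule integral_ray_const[where u="\<lambda>x Y. G x Y * tube_char (- x) (- Y) \<eta>"])
      show "(\<lambda>x. ?T x l) \<in> borel_measurable borel" if "0 < l" for l
        using meas[OF scaleR_in_C[OF y that]] by measurable
      fix x
      have "(\<lambda>\<zeta>. tube_char (- x + Re \<zeta> *\<^sub>R (- y)) (0 + Im \<zeta> *\<^sub>R (- y)) \<eta>) holomorphic_on {\<zeta>. 0 < Im \<zeta>}"
        by (rule tube_char_holomorphic)
      hence "(\<lambda>\<zeta>. tube_char (- (x + Re \<zeta> *\<^sub>R y)) (- (Im \<zeta> *\<^sub>R y)) \<eta>) holomorphic_on {\<zeta>. 0 < Im \<zeta>}"
        by simp
      thus "(\<lambda>\<zeta>. G (x + Re \<zeta> *\<^sub>R y) (Im \<zeta> *\<^sub>R y) * tube_char (- (x + Re \<zeta> *\<^sub>R y)) (- (Im \<zeta> *\<^sub>R y)) \<eta>) holomorphic_on {\<zeta>. 0 < Im \<zeta>}"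
        by (intro holomorphic_on_mult holo y)
    next
      fix a b :: real assume a: "0 < a"
      show "\<exists>A. \<forall>x l. a \<le> l \<longrightarrow> l \<le> b \<longrightarrow> cmod (?T x l) \<le> A * pweight x"
      proof (intro exI[of _ "A * exp (2 * pi * (b * \<bar>y \<bullet> \<eta>\<bar>))"] allI impI)
        fix x l assume l: "a \<le> l" "l \<le> b"
        have "l * (y \<bullet> \<eta>) \<le> l * \<bar>y \<bullet> \<eta>\<bar>" using l a by (intro mult_left_mono) auto
        also have "\<dots> \<le> b * \<bar>y \<bullet> \<eta>\<bar>" using l by (intro mult_right_mono) auto
        finally have "cmod (tube_char (- x) (- (l *\<^sub>R y)) \<eta>) \<le> exp (2 * pi * (b * \<bar>y \<bullet> \<eta>\<bar>))"
          by (simp add: cmod_tube_char)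
        hence "cmod (G x (l *\<^sub>R y)) * cmod (tube_char (- x) (- (l *\<^sub>R y)) \<eta>) \<le> A * pweight x * exp (2 * pi * (b * \<bar>y \<bullet> \<eta>\<bar>))"
          using l a A0 by (intro mult_mono A) auto
        thus "cmod (?T x l) \<le> A * exp (2 * pi * (b * \<bar>y \<bullet> \<eta>\<bar>)) * pweight x"
          by (simp add: norm_mult mult_ac)
      qed
    qed (use that in auto)
    have "((\<lambda>l. LBINT t. ?T t l) \<longlongrightarrow> \<Phi> \<eta>) (at 0 within {0<..<1})"
      unfolding \<Phi>_def
    proof (rule tendsto_parametric_integral[where B="\<lambda>x. A * exp (2 * pi * \<bar>y \<bullet> \<eta>\<bar>) * pweight x"])
      show "(\<lambda>t. ?T t l) \<in> borel_measurable lborel" if "l \<in> {0<..<1}" for l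
        using meas[OF scaleR_in_C[OF y, of l]] that by simp
      show "integrable lborel (\<lambda>x::real^'n. A * exp (2 * pi * \<bar>y \<bullet> \<eta>\<bar>) * pweight x)"
        by (intro integrable_mult_right integrable_pweight)
      fix t
      have "((\<lambda>l. tube_char (- t) (- (l *\<^sub>R y)) \<eta>) \<longlongrightarrow> tube_char (- t) (- (0 *\<^sub>R y)) \<eta>) (at 0 within {0<..<1})"
        unfolding tube_char_def by (intro tendsto_intros)
      thus "((\<lambda>l. ?T t l) \<longlongrightarrow> G t 0 * tube_char (- t) 0 \<eta>) (at 0 within {0<..<1})"
        using lim[OF y, of t] unfolding at_within_unit_interval by (intro tendsto_mult) simp_all
      fix l assume l: "l \<in> {0<..<1::real}"
      have "l * (y \<bullet> \<eta>) \<le> l * \<bar>y \<bullet> \<eta>\<bar>" using l by (intro mult_left_mono) auto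
      also have "\<dots> \<le> \<bar>y \<bullet> \<eta>\<bar>" using l by (intro mult_left_le_one_le) auto
      finally have "cmod (tube_char (- t) (- (l *\<^sub>R y)) \<eta>) \<le> exp (2 * pi * \<bar>y \<bullet> \<eta>\<bar>)"
        by (simp add: cmod_tube_char)
      hence "cmod (G t (l *\<^sub>R y)) * cmod (tube_char (- t) (- (l *\<^sub>R y)) \<eta>) \<le> A * pweight t * exp (2 * pi * \<bar>y \<bullet> \<eta>\<bar>)"
        using l A0 by (intro mult_mono A) auto
      thus "norm (?T t l) \<le> A * exp (2 * pi * \<bar>y \<bullet> \<eta>\<bar>) * pweight t"
        by (simp add: norm_mult mult_ac)
    qed simp
    hence "((\<lambda>l. LBINT t. ?T t l) \<longlongrightarrow> \<Phi> \<eta>) (at_right 0)"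
      unfolding at_within_unit_interval .
    moreover have "((\<lambda>l. LBINT t. ?T t l)
        \<longlongrightarrow> (LBINT t. G t y * tube_char (- t) (- y) \<eta>)) (at_right 0)"
      using const by (intro tendsto_eventually) (auto simp: eventually_at intro!: exI[of _ 1])
    ultimately show ?thesis using tendsto_unique[OF trivial_limit_at_right_real] by blast
  qed
  \<comment> \<open>A vector \<eta> outside the dual cone has negative pairing with some
    \<open>y\<close> in \<open>C\<close>. Along this ray the exponential decays while the majorant
    of \<open>G\<close> stays fixed.\<close>
  have \<Phi>_zero: "\<Phi> \<eta> = 0" if "\<eta> \<notin> dual_cone C" for \<eta>
  proof -
    from that obtain y where y: "y \<in> C" "y \<bullet> \<eta> < 0" by (auto simp: dual_cone_def inner_commute not_le)
    from bound[OF y(1)] obtain A where A: "\<And>x l. 0 \<le> l \<Longrightarrow> cmod (G x (l *\<^sub>R y)) \<le> A * pweight x" by blast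
    let ?E = "\<lambda>l. exp (2 * pi * (l * (y \<bullet> \<eta>)))"
    let ?W = "A * (LBINT x. pweight (x::real^'n))"
    have le: "cmod (\<Phi> \<eta>) \<le> ?E l * ?W" if l: "0 < l" for l
    proof -
      have "cmod (\<Phi> \<eta>) \<le> (LBINT t. cmod (G t (l *\<^sub>R y) * tube_char (- t) (- (l *\<^sub>R y)) \<eta>))"
        unfolding shift[OF scaleR_in_C[OF y(1) l], symmetric] by (rule integral_norm_bound)
      also have "\<dots> \<le> (LBINT t. ?E l * A * pweight (t::real^'n))"
      proof (rule integral_mono')
        show "integrable lborel (\<lambda>t::real^'n. ?E l * A * pweight t)"
          by (intro integrable_mult_right integrable_pweight)
        fix t
        have "cmod (G t (l *\<^sub>R y)) * ?E l \<le> A * pweight t * ?E l"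
          using l by (intro mult_right_mono A) auto
        thus b: "cmod (G t (l *\<^sub>R y) * tube_char (- t) (- (l *\<^sub>R y)) \<eta>) \<le> ?E l * A * pweight t"
          by (simp add: norm_mult cmod_tube_char mult_ac)
        show "0 \<le> ?E l * A * pweight t" by (rule order_trans[OF norm_ge_zero b])
      qed
      also have "\<dots> = ?E l * ?W" by simp
      finally show ?thesis .
    qed
    have "((\<lambda>l. exp (2 * pi * (l * k))) \<longlongrightarrow> 0) at_top" if "k < 0" for k :: real
    proof -
      have "filterlim (\<lambda>l. (2 * pi * k) * l) at_bot at_top"
        using that by (intro filterlim_tendsto_neg_mult_at_bot[OF tendsto_const _ filterlim_ident])
          (simp add: mult_pos_neg)
      from filterlim_compose[OF exp_at_bot this] show ?thesis by (simp add: mult_ac)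
    qed
    from this[OF y(2)] have "((\<lambda>l. ?E l * ?W) \<longlongrightarrow> 0 * ?W) at_top"
      by (intro tendsto_mult tendsto_const)
    moreover have "eventually (\<lambda>l. cmod (\<Phi> \<eta>) \<le> ?E l * ?W) at_top"
      using eventually_gt_at_top[of 0] by eventually_elim (rule le)
    ultimately have "cmod (\<Phi> \<eta>) \<le> 0 * ?W"
      by (rule tendsto_lowerbound) simp
    thus ?thesis by simp
  qed
  from bound[OF y0] obtain A where A: "\<And>x l. 0 \<le> l \<Longrightarrow> cmod (G x (l *\<^sub>R y0)) \<le> A * pweight x" by blast
  have A0: "0 \<le> A * pweight x" for x :: "real^'n" using order_trans[OF norm_ge_zero A[of 0 x]] by simp
  have A': "cmod (G x 0) \<le> A * pweight x" "cmod (G x y0) \<le> A * pweight x" for x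
    using A[of 0 x] A[of 1 x] by simp_all
  have Ap: "0 \<le> A" using A0[of 0] by (simp add: pweight_def)
  have [measurable]: "(\<lambda>x. G x y0) \<in> borel_measurable borel" by (rule meas[OF y0])
  have Gy: "integrable lborel (\<lambda>x. G x y0)" using A' by (intro integrable_pweight_bound) auto
  have \<Phi>_le: "cmod (\<Phi> \<eta>) \<le> A * (LBINT x. pweight (x::real^'n))" for \<eta>
  proof -
    have "cmod (\<Phi> \<eta>) \<le> (LBINT t. cmod (G t 0 * tube_char (- t) 0 \<eta>))"
      unfolding \<Phi>_def by (rule integral_norm_bound)
    also have "\<dots> \<le> (LBINT t. A * pweight (t::real^'n))"
      using A' A0 by (intro integral_mono' integrable_mult_right integrable_pweight) (auto simp: norm_mult)
    finally show ?thesis by simp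
  qed
  have [measurable]: "\<Phi> \<in> borel_measurable borel"
    unfolding \<Phi>_def
    by (rule lborel.borel_measurable_lebesgue_integral[of "\<lambda>\<eta> t. G t 0 * tube_char (- t) 0 \<eta>" borel]) measurable
  \<comment> \<open>Off the dual cone \<Phi> vanishes, so the exponential, which may grow there, can
    be replaced by the integrable weight \<open>laplace y0\<close>.\<close>
  have \<Phi>_y0: "(LBINT t. G t y0 * tube_char (- t) 0 \<eta>) = \<Phi> \<eta> * of_real (laplace y0 \<eta>)" for \<eta>
  proof -
    have e: "G t y0 * tube_char (- t) 0 \<eta> = (G t y0 * tube_char (- t) (- y0) \<eta>) * of_real (exp (- (2 * pi * (y0 \<bullet> \<eta>))))" for t
      using tube_char_add[of "- t" 0 "- y0" y0 \<eta>] by (simp add: tube_char_imaginary)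
    have "(LBINT t. G t y0 * tube_char (- t) 0 \<eta>) = \<Phi> \<eta> * of_real (exp (- (2 * pi * (y0 \<bullet> \<eta>))))"
      unfolding e by (simp only: integral_mult_left_zero shift[OF y0])
    thus ?thesis using \<Phi>_zero[of \<eta>] by (auto simp: laplace_def indicator_def)
  qed
  define d where "d m = inverse (real (Suc m))" for m
  have d: "0 < d m" for m by (simp add: d_def)
  let ?g = "\<lambda>m (\<eta>::real^'n). exp (- (pi * (d m)\<^sup>2 * (norm \<eta>)\<^sup>2))"
  let ?F = "\<lambda>m \<eta>. \<Phi> \<eta> * of_real (laplace y0 \<eta>) * (tube_char x0 0 \<eta> * of_real (?g m \<eta>))"
  let ?L = "\<lambda>\<eta>. \<Phi> \<eta> * of_real (laplace y0 \<eta>) * tube_char x0 0 \<eta>"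
  have reg: "(LBINT \<eta>. ?F m \<eta>)
      = (LBINT t. rgauss (d m) (x0 - t) *\<^sub>R G t y0)" for m
  proof -
    have ib: "integrable lborel (\<lambda>\<eta>. tube_char x0 0 \<eta> * complex_of_real (?g m \<eta>))"
      by (rule Bochner_Integration.integrable_bound[OF integrable_gauss_freq[OF d[of m]]]) (auto simp: norm_mult)
    have "(LBINT \<eta>. ?F m \<eta>)
      = (LBINT t. G t y0 * (LBINT \<eta>. (tube_char x0 0 \<eta> * of_real (?g m \<eta>)) * tube_char (- t) 0 \<eta>))"
      unfolding \<Phi>_y0[symmetric] by (rule fourier_exchange[OF Gy ib]) simp_all
    also have "(\<lambda>t. LBINT \<eta>. (tube_char x0 0 \<eta> * of_real (?g m \<eta>)) * tube_char (- t) 0 \<eta>)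
       = (\<lambda>t. of_real (rgauss (d m) (x0 - t)))"
    proof
      fix t
      have "tube_char (x0 - t) 0 \<eta> = tube_char x0 0 \<eta> * tube_char (- t) 0 \<eta>" for \<eta>
        using tube_char_add[of x0 "- t" 0 0 \<eta>] by simp
      hence e: "(tube_char x0 0 \<eta> * of_real (?g m \<eta>)) * tube_char (- t) 0 \<eta> = tube_char (x0 - t) 0 \<eta> * of_real (?g m \<eta>)" for \<eta>
        by (simp only: ac_simps)
      show "(LBINT \<eta>. (tube_char x0 0 \<eta> * of_real (?g m \<eta>)) * tube_char (- t) 0 \<eta>) = of_real (rgauss (d m) (x0 - t))"
        unfolding e by (rule fourier_gauss[OF d])
    qed
    finally show ?thesis by (simp add: scaleR_conv_of_real mult.commute)
  qed
  \<comment> \<open>One sequence with two limits: in space it mollifies \<open>G\<close> at height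
    \<open>y0\<close> and tends to the value at \<open>x0\<close> by continuity; in frequency the
    Gaussian factor tends to 1 under an integrable majorant.\<close>
  have "(\<lambda>m. LBINT t. rgauss (d m) (x0 - t) *\<^sub>R G t y0) \<longlonglongrightarrow> G x0 y0"
    unfolding d_def
  proof (rule mollify_tendsto[where N=0 and M=A])
    show "cmod (G t y0) \<le> A * (1 + norm t) ^ 0" for t
      using order_trans[OF A'(2) mult_left_mono[OF pweight_le_1 Ap]] by simp
  qed (use cont in simp_all)
  moreover have "(\<lambda>m. LBINT t. rgauss (d m) (x0 - t) *\<^sub>R G t y0)
      \<longlonglongrightarrow> (LBINT \<eta>. ?L \<eta>)"
    unfolding reg[symmetric]
  proof (rule integral_dominated_convergence[where w="\<lambda>\<eta>. A * (LBINT x. pweight (x::real^'n)) * laplace y0 \<eta>"])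
    show "integrable lborel (\<lambda>\<eta>. A * (LBINT x. pweight (x::real^'n)) * laplace y0 \<eta>)"
      by (intro integrable_mult_right integrable_laplace y0)
    show "AE \<eta> in lborel. (\<lambda>m. ?F m \<eta>)
        \<longlonglongrightarrow> ?L \<eta>"
    proof (rule AE_I2)
      fix \<eta> :: "real^'n"
      have "(\<lambda>m. ?F m \<eta>)
        \<longlonglongrightarrow> \<Phi> \<eta> * of_real (laplace y0 \<eta>) * (tube_char x0 0 \<eta> * of_real (exp (- (pi * 0\<^sup>2 * (norm \<eta>)\<^sup>2))))"
        unfolding d_def by (intro tendsto_intros LIMSEQ_inverse_real_of_nat)
      thus "(\<lambda>m. ?F m \<eta>)
        \<longlonglongrightarrow> ?L \<eta>" by simp
    qed
    show "AE \<eta> in lborel. norm (?F m \<eta>)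
        \<le> A * (LBINT x. pweight (x::real^'n)) * laplace y0 \<eta>" for m
    proof (rule AE_I2)
      fix \<eta>
      have "cmod (\<Phi> \<eta>) * laplace y0 \<eta> * ?g m \<eta> \<le> cmod (\<Phi> \<eta>) * laplace y0 \<eta> * 1"
        using laplace_nonneg[of y0 \<eta>] by (intro mult_left_mono) auto
      also have "\<dots> \<le> A * (LBINT x. pweight (x::real^'n)) * laplace y0 \<eta>"
        using \<Phi>_le laplace_nonneg by (simp add: mult_right_mono)
      finally show "norm (?F m \<eta>)
        \<le> A * (LBINT x. pweight (x::real^'n)) * laplace y0 \<eta>"
        by (simp add: norm_mult laplace_nonneg)
    qed
  qed measurable
  ultimately have "G x0 y0 = (LBINT \<eta>. ?L \<eta>)"
    by (rule LIMSEQ_unique)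
  also have "\<dots> = (LBINT \<eta>. \<Phi> \<eta> * (of_real (laplace y0 \<eta>) * tube_char x0 0 \<eta>))"
    by (simp only: mult.assoc)
  also have "\<dots> = (LBINT t. G t 0 * (LBINT \<eta>. of_real (laplace y0 \<eta>) * tube_char x0 0 \<eta> * tube_char (- t) 0 \<eta>))"
    unfolding \<Phi>_def by (rule fourier_exchange[OF G0 integrable_laplace_char[OF y0]]) simp_all
  also have "(\<lambda>t. LBINT \<eta>. of_real (laplace y0 \<eta>) * tube_char x0 0 \<eta> * tube_char (- t) 0 \<eta>) = (\<lambda>t. kern (x0 - t) y0)"
  proof
    fix t
    show "(LBINT \<eta>. of_real (laplace y0 \<eta>) * tube_char x0 0 \<eta> * tube_char (- t) 0 \<eta>) = kern (x0 - t) y0"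
      unfolding kern_def mult.assoc using tube_char_add[of x0 "- t" 0 0] by simp
  qed
  finally show ?thesis .
qed

end

section \<open>Damping factors\<close>

text \<open>The constant is uniform over centres \<open>p\<close> in a ball, as needed when the
  argument of a convolution varies. Powers of 1 + |t| are moved to the Gaussian by 1 + |t| \<le> (1
  + |p|) (1 + |p - t|).\<close>

lemma gauss_translate_bound:
  assumes d: "0 < d"
  shows "\<exists>A\<ge>0. \<forall>p t::real^'n. norm p \<le> c \<longrightarrow> (1 + norm t) ^ N * rgauss d (p - t) \<le> A * pweight t"
proof -
  from rgauss_bound[OF d, of N] obtain A where A: "0 \<le> A"
    "\<And>x::real^'n. (1 + norm x) ^ N * rgauss d x \<le> A * pweight x" by blast
  let ?A = "(1 + \<bar>c\<bar>) ^ N * (A * (2 * (1 + c\<^sup>2)) ^ CARD('n))"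
  show ?thesis
  proof (intro exI[of _ ?A] conjI allI impI)
    show "0 \<le> ?A" using A by (intro mult_nonneg_nonneg zero_le_power) auto
    fix p t :: "real^'n" assume p: "norm p \<le> c"
    have "1 + norm t \<le> 1 + (norm p + norm (p - t))" using norm_triangle_ineq4[of p "p - t"] by simp
    also have "\<dots> \<le> (1 + norm p) * (1 + norm (p - t))" by (simp add: algebra_simps)
    also have "\<dots> \<le> (1 + \<bar>c\<bar>) * (1 + norm (p - t))" using p by (intro mult_right_mono) auto
    finally have "(1 + norm t) ^ N \<le> (1 + \<bar>c\<bar>) ^ N * (1 + norm (p - t)) ^ N"
      unfolding power_mult_distrib[symmetric] by (intro power_mono) auto
    hence "(1 + norm t) ^ N * rgauss d (p - t) \<le> (1 + \<bar>c\<bar>) ^ N * (1 + norm (p - t)) ^ N * rgauss d (p - t)"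
      by (intro mult_right_mono rgauss_nonneg d)
    also have "\<dots> = (1 + \<bar>c\<bar>) ^ N * ((1 + norm (p - t)) ^ N * rgauss d (p - t))" by (simp only: mult.assoc)
    also have "\<dots> \<le> (1 + \<bar>c\<bar>) ^ N * (A * pweight (p - t))" by (intro mult_left_mono A) simp
    also have "pweight (p - t) \<le> (2 * (1 + c\<^sup>2)) ^ CARD('n) * pweight t"
      using pweight_translate_norm[of "- p" c t] pweight_minus[of "p - t"] p by simp
    hence "(1 + \<bar>c\<bar>) ^ N * (A * pweight (p - t)) \<le> (1 + \<bar>c\<bar>) ^ N * (A * ((2 * (1 + c\<^sup>2)) ^ CARD('n) * pweight t))"
      using A by (intro mult_left_mono) auto
    finally show "(1 + norm t) ^ N * rgauss d (p - t) \<le> ?A * pweight t" by (simp only: mult.assoc)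
  qed
qed

lemma gauss_tendsto:
  assumes "(a \<longlongrightarrow> A) F" "(b \<longlongrightarrow> B) F"
  shows "((\<lambda>t. gauss d (a t) (b t)) \<longlongrightarrow> gauss d A B) F"
proof -
  have "isCont (\<lambda>p. gauss d (fst p) (snd p)) (A, B)"
    using gauss_continuous[of d] unfolding continuous_on_eq_continuous_at[OF open_UNIV] by blast
  from isCont_tendsto_compose[OF this tendsto_Pair[OF assms]] show ?thesis by simp
qed

text \<open>With s the sign of the coordinate this is 1 - i e s z. For e > 0, on the tube over the
  closed n-rant, its real part is at least 1, so it has no zeros there, and its imaginary part grows
  linearly in the real direction.\<close>

definition damp_base :: "nat^'n \<Rightarrow> real \<Rightarrow> 'n \<Rightarrow> complex \<Rightarrow> complex"
  where "damp_base v e j z = 1 - \<i> * of_real (e * (-1) ^ (v $ j)) * z"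

definition damp :: "nat^'n \<Rightarrow> nat \<Rightarrow> real \<Rightarrow> real^'n \<Rightarrow> real^'n \<Rightarrow> complex"
  where "damp v N e x y = (\<Prod>j\<in>UNIV. inverse (damp_base v e j (Complex (x $ j) (y $ j)) ^ N))"

lemma damp_base_ge:
  fixes v :: "nat^'n"
  assumes "0 \<le> e" "0 \<le> (-1) ^ (v $ j) * b"
  shows "1 \<le> cmod (damp_base v e j (Complex a b))" "e * \<bar>a\<bar> \<le> cmod (damp_base v e j (Complex a b))"
proof -
  have "Re (damp_base v e j (Complex a b)) = 1 + e * ((-1) ^ (v $ j) * b)"
    by (simp add: damp_base_def)
  thus "1 \<le> cmod (damp_base v e j (Complex a b))"
    using mult_nonneg_nonneg[OF assms] abs_Re_le_cmod[of "damp_base v e j (Complex a b)"] by linarith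
  have "\<bar>Im (damp_base v e j (Complex a b))\<bar> = e * \<bar>a\<bar>"
    using assms(1) by (simp add: damp_base_def abs_mult power_abs)
  thus "e * \<bar>a\<bar> \<le> cmod (damp_base v e j (Complex a b))"
    using abs_Im_le_cmod[of "damp_base v e j (Complex a b)"] by simp
qed

lemma cmod_damp_le_1:
  fixes v :: "nat^'n"
  assumes "0 \<le> e" "\<And>j. 0 \<le> (-1) ^ (v $ j) * y $ j"
  shows "cmod (damp v N e x y) \<le> 1"
  unfolding damp_def prod_norm[symmetric]
proof (intro prod_le_1 conjI)
  fix j
  have "1 \<le> cmod (damp_base v e j (Complex (x $ j) (y $ j))) ^ N"
    using damp_base_ge(1)[OF assms(1) assms(2)] by (intro one_le_power)
  thus "cmod (inverse (damp_base v e j (Complex (x $ j) (y $ j)) ^ N)) \<le> 1"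
    by (simp add: norm_inverse norm_power inverse_le_1_iff)
qed auto

text \<open>Of the \<open>N + 2\<close> powers, \<open>N\<close> absorb the polynomial factor and
  two produce \<open>pweight\<close>. The constant does not depend on the height, as Cauchy's
  formula demands of its majorants.\<close>

lemma damp_bound:
  fixes v :: "nat^'n"
  assumes e: "0 < e"
  shows "\<exists>A\<ge>0. \<forall>x y::real^'n. (\<forall>j. 0 \<le> (-1) ^ (v $ j) * y $ j) \<longrightarrow>
    (1 + norm x) ^ N * cmod (damp v (N + 2) e x y) \<le> A * pweight x"
proof -
  \<comment> \<open>For the base b at real part a, 1 \<le> |b| and e |a| \<le> |b| give 1 + |a|
    \<le> (1 + 1/e) |b|; the factor 2 is slack.\<close>
  define c where "c = 2 * (1 + 1 / e)"
  have c: "0 < c" using e by (simp add: c_def add_pos_nonneg)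
  show ?thesis
  proof (intro exI[of _ "\<Prod>j\<in>(UNIV::'n set). c ^ (N + 2)"] conjI allI impI)
    show "0 \<le> (\<Prod>j\<in>(UNIV::'n set). c ^ (N + 2))" using c by (intro prod_nonneg) simp
    fix x y :: "real^'n" assume y: "\<forall>j. 0 \<le> (-1) ^ (v $ j) * y $ j"
    let ?b = "\<lambda>j. cmod (damp_base v e j (Complex (x $ j) (y $ j)))"
    have "(1 + norm x) ^ N * cmod (damp v (N + 2) e x y)
        \<le> (\<Prod>j\<in>UNIV. 1 + \<bar>x $ j\<bar>) ^ N * cmod (damp v (N + 2) e x y)"
      by (intro mult_right_mono power_mono one_plus_norm_le_prod) auto
    also have "\<dots> = (\<Prod>j\<in>UNIV. (1 + \<bar>x $ j\<bar>) ^ N * inverse (?b j ^ (N + 2)))"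
      unfolding damp_def prod_norm[symmetric] prod_power_distrib prod.distrib[symmetric]
      by (simp only: norm_inverse norm_power)
    also have "\<dots> \<le> (\<Prod>j\<in>UNIV. c ^ (N + 2) * inverse (1 + (x $ j)\<^sup>2))"
    proof (intro prod_mono conjI)
      fix j
      let ?a = "\<bar>x $ j\<bar>"
      have b1: "1 \<le> ?b j" and b2: "e * ?a \<le> ?b j" using damp_base_ge[of e v j "y $ j" "x $ j"] e y by auto
      have "?a \<le> 1 / e * ?b j" using b2 e by (simp add: field_simps)
      hence "1 + ?a \<le> (1 + 1 / e) * ?b j" using b1 by (simp add: distrib_right)
      also have "\<dots> \<le> c * ?b j"
      proof (intro mult_right_mono)
        show "1 + 1 / e \<le> c" using mult_right_mono[of 1 2 "1 + 1 / e"] e by (simp add: c_def add_nonneg_nonneg)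
      qed simp
      finally have "(1 + ?a) ^ (N + 2) \<le> c ^ (N + 2) * ?b j ^ (N + 2)"
        unfolding power_mult_distrib[symmetric] by (intro power_mono) auto
      moreover have "1 + (x $ j)\<^sup>2 \<le> (1 + ?a)\<^sup>2" by (simp add: power2_eq_square algebra_simps)
      hence "(1 + ?a) ^ N * (1 + (x $ j)\<^sup>2) \<le> (1 + ?a) ^ N * (1 + ?a)\<^sup>2" by (intro mult_left_mono) auto
      hence "(1 + ?a) ^ N * (1 + (x $ j)\<^sup>2) \<le> (1 + ?a) ^ (N + 2)" by (simp only: power_add)
      ultimately have le: "(1 + ?a) ^ N * (1 + (x $ j)\<^sup>2) \<le> c ^ (N + 2) * ?b j ^ (N + 2)" by linarith
      have "P * Q \<le> K * B \<Longrightarrow> 0 < Q \<Longrightarrow> 0 < B \<Longrightarrow> P * inverse B \<le> K * inverse Q" for P Q K B :: real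
        by (simp add: field_simps)
      moreover have "0 < 1 + (x $ j)\<^sup>2" by (intro add_pos_nonneg) auto
      moreover have "0 < ?b j ^ (N + 2)" using b1 by (intro zero_less_power) linarith
      ultimately show "(1 + ?a) ^ N * inverse (?b j ^ (N + 2)) \<le> c ^ (N + 2) * inverse (1 + (x $ j)\<^sup>2)"
        using le by blast
      show "0 \<le> (1 + ?a) ^ N * inverse (?b j ^ (N + 2))" by simp
    qed
    also have "\<dots> = (\<Prod>j\<in>(UNIV::'n set). c ^ (N + 2)) * pweight x"
      by (simp only: pweight_def prod.distrib[symmetric])
    finally show "(1 + norm x) ^ N * cmod (damp v (N + 2) e x y) \<le> (\<Prod>j\<in>(UNIV::'n set). c ^ (N + 2)) * pweight x" .
  qed
qed

text \<open>Parameter and point move simultaneously: one statement yields continuity in space, the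
  limit of small height, and the removal of the damping at e = 0.\<close>

lemma damp_tendsto:
  fixes v :: "nat^'n"
  assumes "(E \<longlongrightarrow> e) F" "(a \<longlongrightarrow> x) F" "(b \<longlongrightarrow> y) F" and e: "0 \<le> e" "\<And>j. 0 \<le> (-1) ^ (v $ j) * y $ j"
  shows "((\<lambda>t. damp v N (E t) (a t) (b t)) \<longlongrightarrow> damp v N e x y) F"
proof -
  have C: "Complex r s = of_real r + \<i> * of_real s" for r s by (simp add: complex_eq_iff)
  have nz: "damp_base v e j (Complex (x $ j) (y $ j)) \<noteq> 0" for j
    using damp_base_ge(1)[OF e] by (metis norm_zero not_one_le_zero)
  show ?thesis
    unfolding damp_def
  proof (intro tendsto_prod tendsto_inverse tendsto_power)
    fix j
    show "((\<lambda>t. damp_base v (E t) j (Complex (a t $ j) (b t $ j))) \<longlongrightarrow> damp_base v e j (Complex (x $ j) (y $ j))) F"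
      unfolding damp_base_def C by (intro tendsto_intros assms)
  qed (use nz in simp)
qed

lemma damp_zero: "damp v N 0 x y = 1"
  by (simp add: damp_def damp_base_def)

lemma damp_holomorphic:
  fixes v :: "nat^'n"
  assumes e: "0 \<le> e" and y: "\<And>j. 0 \<le> (-1) ^ (v $ j) * y $ j"
  shows "(\<lambda>\<zeta>. damp v N e (x + Re \<zeta> *\<^sub>R y) (Im \<zeta> *\<^sub>R y)) holomorphic_on {\<zeta>. Im \<zeta> > 0}"
proof -
  have C: "Complex ((x + Re \<zeta> *\<^sub>R y) $ j) ((Im \<zeta> *\<^sub>R y) $ j) = of_real (x $ j) + \<zeta> * of_real (y $ j)" for \<zeta> j
    by (simp add: complex_eq_iff)
  have nz: "damp_base v e j (of_real (x $ j) + \<zeta> * of_real (y $ j)) \<noteq> 0" if "0 < Im \<zeta>" for \<zeta> j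
  proof -
    have "0 \<le> (-1) ^ (v $ j) * (Im \<zeta> *\<^sub>R y) $ j"
      using mult_nonneg_nonneg[OF less_imp_le[OF that] y[of j]] by (simp add: mult_ac)
    from damp_base_ge(1)[OF e this, of "(x + Re \<zeta> *\<^sub>R y) $ j"] show ?thesis
      unfolding C by (metis norm_zero not_one_le_zero)
  qed
  show ?thesis
    unfolding damp_def C
  proof (intro holomorphic_on_prod holomorphic_on_inverse holomorphic_on_power)
    fix j
    show "(\<lambda>\<zeta>. damp_base v e j (of_real (x $ j) + \<zeta> * of_real (y $ j))) holomorphic_on {\<zeta>. 0 < Im \<zeta>}"
      unfolding damp_base_def by (intro holomorphic_intros)
  qed (use nz in simp)
qed

section \<open>The Poisson integral of scalar boundary values\<close>

lemma nn_integral_lborel_reflect: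
  fixes f :: "'a::euclidean_space \<Rightarrow> ennreal"
  assumes [measurable]: "f \<in> borel_measurable borel"
  shows "(\<integral>\<^sup>+x. f (c - x) \<partial>lborel) = (\<integral>\<^sup>+x. f x \<partial>lborel)"
proof -
  have "(\<integral>\<^sup>+x. f x \<partial>lborel) = (\<integral>\<^sup>+x. f x \<partial>distr lborel borel (\<lambda>x. c - x))"
    by (simp only: lborel_distr_reflect)
  also have "\<dots> = (\<integral>\<^sup>+x. f (c - x) \<partial>lborel)" by (rule nn_integral_distr) measurable
  finally show ?thesis ..
qed

lemma nn_integral_lborel_translate:
  fixes f :: "'a::euclidean_space \<Rightarrow> ennreal"
  assumes [measurable]: "f \<in> borel_measurable borel"
  shows "(\<integral>\<^sup>+x. f (x - c) \<partial>lborel) = (\<integral>\<^sup>+x. f x \<partial>lborel)"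
proof -
  have "(\<integral>\<^sup>+x. f (x - c) \<partial>lborel) = (\<integral>\<^sup>+x. f (0 - (c - x)) \<partial>lborel)" by simp
  also have "\<dots> = (\<integral>\<^sup>+x. f (0 - x) \<partial>lborel)"
    by (rule nn_integral_lborel_reflect) measurable
  also have "\<dots> = (\<integral>\<^sup>+x. f x \<partial>lborel)" by (rule nn_integral_lborel_reflect) measurable
  finally show ?thesis .
qed

text \<open>With equal masses the positive and negative parts of the difference have the same
  integral, so the distance in mean is twice the integral of the positive part of f - F, which
  \<open>f\<close> dominates.\<close>

lemma scheffe:
  fixes f :: "'a \<Rightarrow> real"
  assumes f: "integrable M f" "\<And>x. 0 \<le> f x"
    and fm: "\<And>m. integrable M (F m)" "\<And>m x. 0 \<le> F m x"
    and lim: "\<And>x. (\<lambda>m. F m x) \<longlonglongrightarrow> f x" and eq: "\<And>m. (\<integral>x. F m x \<partial>M) = (\<integral>x. f x \<partial>M)"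
  shows "(\<lambda>m. \<integral>x. \<bar>F m x - f x\<bar> \<partial>M) \<longlonglongrightarrow> 0"
proof -
  have im: "integrable M (\<lambda>x. max 0 (f x - F m x))" for m
    using f fm by (intro integrable_max) auto
  have "(\<lambda>m. \<integral>x. max 0 (f x - F m x) \<partial>M) \<longlonglongrightarrow> (\<integral>x. 0 \<partial>M)"
  proof (rule integral_dominated_convergence[where w=f])
    show "AE x in M. (\<lambda>m. max 0 (f x - F m x)) \<longlonglongrightarrow> 0"
    proof (rule AE_I2)
      fix x
      have "(\<lambda>m. max 0 (f x - F m x)) \<longlonglongrightarrow> max 0 (f x - f x)" by (intro tendsto_intros lim)
      thus "(\<lambda>m. max 0 (f x - F m x)) \<longlonglongrightarrow> 0" by simp
    qed
    show "AE x in M. norm (max 0 (f x - F m x)) \<le> f x" for m using f(2) fm(2) by (auto intro!: AE_I2)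
  qed (use f im in auto)
  hence "(\<lambda>m. 2 * (\<integral>x. max 0 (f x - F m x) \<partial>M)) \<longlonglongrightarrow> 2 * 0" by (intro tendsto_intros) simp
  moreover have "(\<integral>x. \<bar>F m x - f x\<bar> \<partial>M) = 2 * (\<integral>x. max 0 (f x - F m x) \<partial>M)" for m
  proof -
    have "(\<integral>x. \<bar>F m x - f x\<bar> \<partial>M) = (\<integral>x. (F m x - f x) + 2 * max 0 (f x - F m x) \<partial>M)"
      by (intro Bochner_Integration.integral_cong) (auto simp: abs_real_def max_def)
    also have "\<dots> = (\<integral>x. F m x \<partial>M) - (\<integral>x. f x \<partial>M) + 2 * (\<integral>x. max 0 (f x - F m x) \<partial>M)"
      using f(1) fm(1) im by simp
    finally show ?thesis using eq by simp
  qed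
  ultimately show ?thesis by simp
qed

context tube_cone
begin

text \<open>Q(x + iy; t) as a real function, possible because K(2iy) is real.\<close>

definition poisson :: "real^'n \<Rightarrow> real^'n \<Rightarrow> real^'n \<Rightarrow> real"
  where "poisson x y t = (cmod (kern (x - t) y))\<^sup>2 / kern0 (2 *\<^sub>R y)"

lemma poisson_nonneg: "0 \<le> poisson x y t"
  by (simp add: poisson_def kern0_nonneg)

lemma poisson_measurable [measurable]:
  assumes [measurable]: "a \<in> borel_measurable M" "b \<in> borel_measurable M"
  shows "(\<lambda>t. poisson (a t) y (b t)) \<in> borel_measurable M"
  unfolding poisson_def by measurable

lemma poisson_le: "y \<in> C \<Longrightarrow> poisson x y t \<le> (kern0 y)\<^sup>2 / kern0 (2 *\<^sub>R y)"
  unfolding poisson_def by (intro divide_right_mono power_mono cmod_kern_le kern0_nonneg) auto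

lemma isCont_poisson:
  assumes "y \<in> C"
  shows "isCont (poisson x y) t"
proof -
  have "isCont (\<lambda>t. kern (x - t) y) t"
    by (rule isCont_o2[where g="\<lambda>x. kern x y"]) (auto intro: isCont_kern assms)
  thus ?thesis unfolding poisson_def using kern0_pos[OF scaleR_in_C[OF assms, of 2]]
    by (intro continuous_intros) auto
qed

text \<open>The kernel depends on x - t only, so reflection and translation reduce both integrals to
  the square integral of the Cauchy kernel. The bound in \<open>t\<close> serves integrability and
  Jensen's inequality, the bound in \<open>x\<close> the estimate after the exchange of
  integrals.\<close>

lemma nn_integral_poisson_le_1:
  assumes y: "y \<in> C"
  shows "(\<integral>\<^sup>+t. ennreal (poisson x y t) \<partial>lborel) \<le> 1" "(\<integral>\<^sup>+x. ennreal (poisson x y t) \<partial>lborel) \<le> 1"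
proof -
  have k: "0 < kern0 (2 *\<^sub>R y)" by (intro kern0_pos scaleR_in_C y) simp
  let ?c = "ennreal (inverse (kern0 (2 *\<^sub>R y)))"
  have p: "ennreal (poisson x y t) = ?c * ennreal ((cmod (kern (x - t) y))\<^sup>2)" for x t
    using k by (simp add: poisson_def divide_inverse mult.commute flip: ennreal_mult')
  have le: "?c * (\<integral>\<^sup>+x. ennreal ((cmod (kern x y))\<^sup>2) \<partial>lborel) \<le> 1"
  proof -
    have "?c * (\<integral>\<^sup>+x. ennreal ((cmod (kern x y))\<^sup>2) \<partial>lborel) \<le> ?c * ennreal (kern0 (2 *\<^sub>R y))"
      by (intro mult_left_mono nn_integral_kern_square_le y) simp
    also have "\<dots> = 1" using k by (simp flip: ennreal_mult')
    finally show ?thesis .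
  qed
  show "(\<integral>\<^sup>+t. ennreal (poisson x y t) \<partial>lborel) \<le> 1"
    unfolding p using le nn_integral_lborel_reflect[of "\<lambda>x. ennreal ((cmod (kern x y))\<^sup>2)" x]
    by (subst nn_integral_cmult) auto
  show "(\<integral>\<^sup>+x. ennreal (poisson x y t) \<partial>lborel) \<le> 1"
    unfolding p using le nn_integral_lborel_translate[of "\<lambda>x. ennreal ((cmod (kern x y))\<^sup>2)" t]
    by (subst nn_integral_cmult) auto
qed

lemma integrable_poisson:
  assumes "y \<in> C"
  shows "integrable lborel (poisson x y)"
proof (rule integrableI_bounded)
  have "(\<integral>\<^sup>+t. ennreal (norm (poisson x y t)) \<partial>lborel) \<le> 1"
    using nn_integral_poisson_le_1(1)[OF assms] by (simp add: poisson_nonneg)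
  thus "(\<integral>\<^sup>+t. ennreal (norm (poisson x y t)) \<partial>lborel) < \<infinity>"
    using le_less_trans[OF _ ennreal_one_less_top] by (simp add: less_top)
qed measurable

end

text \<open>Growth and boundary limits are stated along rays, and the limits for Gaussians. The
  imaginary part \<open>q\<close> of the centre is present because the test function has to be
  translated in imaginary directions.\<close>

locale scalar_tube = tube_cone C v for C :: "(real^'n) set" and v +
  fixes u :: "real^'n \<Rightarrow> real^'n \<Rightarrow> complex" and g :: "real^'n \<Rightarrow> complex" and R :: nat
  assumes u_holo: "\<And>x y. y \<in> C \<Longrightarrow> (\<lambda>\<zeta>. u (x + Re \<zeta> *\<^sub>R y) (Im \<zeta> *\<^sub>R y)) holomorphic_on {\<zeta>. Im \<zeta> > 0}"
    and u_cont: "\<And>y. y \<in> C \<Longrightarrow> continuous_on UNIV (\<lambda>x. u x y)"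
    and u_growth: "\<And>y a. y \<in> C \<Longrightarrow> 0 < a \<Longrightarrow>
      \<exists>M. \<forall>x l. a \<le> l \<longrightarrow> cmod (u x (l *\<^sub>R y)) \<le> M * (1 + norm x) ^ R"
    and g_meas [measurable]: "g \<in> borel_measurable borel"
    and g_sq: "integrable lborel (\<lambda>t. (cmod (g t))\<^sup>2)"
    and boundary_value: "\<And>y d p q. y \<in> C \<Longrightarrow> 0 < d \<Longrightarrow>
      ((\<lambda>l. LBINT t. u t (l *\<^sub>R y) * gauss d (p - t) q) \<longlongrightarrow> (LBINT t. g t * gauss d (p - t) q)) (at_right 0)"
begin

section \<open>The mollified function and its bounds\<close>

lemma u_measurable: "y \<in> C \<Longrightarrow> (\<lambda>x. u x y) \<in> borel_measurable borel"
  by (intro borel_measurable_continuous_onI u_cont)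

text \<open>Moving the test function along with \<open>u\<close> makes the pairing independent of the height, so
  that no uniform bound on \<open>u\<close> near the real subspace is required.\<close>

lemma pairing_gauss:
  assumes y: "y \<in> C" and d: "0 < d"
  shows "(LBINT t. u t y * gauss d (p - t) (q - y)) = (LBINT t. g t * gauss d (p - t) q)"
proof -
  from gauss_translate_bound[OF d, of "norm p" R] obtain A where A: "0 \<le> A"
    "\<And>t. (1 + norm t) ^ R * rgauss d (p - t) \<le> A * pweight t" by blast
  have bd: "cmod (z * gauss d (p - t) q') \<le> M * A * exp (pi / d\<^sup>2 * c\<^sup>2) * pweight t"
    if M: "cmod z \<le> M * (1 + norm t) ^ R" and c: "norm q' \<le> c" for z M t q' c
  proof -
    have "0 \<le> M * (1 + norm t) ^ R" using M norm_ge_zero order_trans by blast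
    moreover have "0 < (1 + norm t) ^ R" by (intro zero_less_power add_pos_nonneg) auto
    ultimately have M0: "0 \<le> M" by (simp only: zero_le_mult_iff) linarith
    have "pi / d\<^sup>2 * (norm q')\<^sup>2 \<le> pi / d\<^sup>2 * c\<^sup>2" using c by (intro mult_left_mono power_mono) auto
    hence "cmod (z * gauss d (p - t) q') \<le> (M * (1 + norm t) ^ R) * (rgauss d (p - t) * exp (pi / d\<^sup>2 * c\<^sup>2))"
      unfolding norm_mult cmod_gauss[OF d] using rgauss_nonneg[OF d] M0
      by (intro mult_mono M mult_left_mono) auto
    also have "\<dots> = M * ((1 + norm t) ^ R * rgauss d (p - t)) * exp (pi / d\<^sup>2 * c\<^sup>2)" by (simp only: ac_simps)
    also have "\<dots> \<le> M * (A * pweight t) * exp (pi / d\<^sup>2 * c\<^sup>2)"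
      by (intro mult_right_mono mult_left_mono A M0) auto
    finally show ?thesis by (simp only: ac_simps)
  qed
  \<comment> \<open>Both arguments run along one complex line, that of the Gaussian with opposite
    sign, so the product is holomorphic in the shift.\<close>
  have const: "(LBINT t. u t (l *\<^sub>R y) * gauss d (p - t) (q' - l *\<^sub>R y))
      = (LBINT t. u t (1 *\<^sub>R y) * gauss d (p - t) (q' - 1 *\<^sub>R y))" if l: "0 < l" for l q'
  proof (rule integral_ray_const[where u="\<lambda>x Y. u x Y * gauss d (p - x) (q' - Y)"])
    show "(\<lambda>x. u x (l *\<^sub>R y) * gauss d (p - x) (q' - l *\<^sub>R y)) \<in> borel_measurable borel" if "0 < l" for l
      using u_measurable[OF scaleR_in_C[OF y that]] by (intro borel_measurable_times gauss_measurable) auto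
    fix x
    have "(\<lambda>\<zeta>. gauss d ((p - x) + Re \<zeta> *\<^sub>R (- y)) (q' + Im \<zeta> *\<^sub>R (- y))) holomorphic_on {\<zeta>. 0 < Im \<zeta>}"
      by (rule gauss_holomorphic)
    hence "(\<lambda>\<zeta>. gauss d (p - (x + Re \<zeta> *\<^sub>R y)) (q' - Im \<zeta> *\<^sub>R y)) holomorphic_on {\<zeta>. 0 < Im \<zeta>}"
      by (simp add: diff_diff_eq)
    thus "(\<lambda>\<zeta>. u (x + Re \<zeta> *\<^sub>R y) (Im \<zeta> *\<^sub>R y) * gauss d (p - (x + Re \<zeta> *\<^sub>R y)) (q' - Im \<zeta> *\<^sub>R y)) holomorphic_on {\<zeta>. 0 < Im \<zeta>}"
      by (intro holomorphic_on_mult u_holo y)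
  next
    fix a b :: real assume a: "0 < a"
    from u_growth[OF y a] obtain M where M: "\<And>x l. a \<le> l \<Longrightarrow> cmod (u x (l *\<^sub>R y)) \<le> M * (1 + norm x) ^ R" by blast
    show "\<exists>A. \<forall>x l. a \<le> l \<longrightarrow> l \<le> b \<longrightarrow> cmod (u x (l *\<^sub>R y) * gauss d (p - x) (q' - l *\<^sub>R y)) \<le> A * pweight x"
    proof (intro exI allI impI)
      fix x l assume l: "a \<le> l" "l \<le> b"
      have "norm (q' - l *\<^sub>R y) \<le> norm q' + norm (l *\<^sub>R y)" by (rule norm_triangle_ineq4)
      also have "\<dots> \<le> norm q' + b * norm y" using l a by (simp add: mult_right_mono)
      finally show "cmod (u x (l *\<^sub>R y) * gauss d (p - x) (q' - l *\<^sub>R y)) \<le> M * A * exp (pi / d\<^sup>2 * (norm q' + b * norm y)\<^sup>2) * pweight x"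
        by (intro bd M l)
    qed
  qed (use l in auto)
  from u_growth[OF y, of 1] obtain M where "\<And>x l. 1 \<le> l \<Longrightarrow> cmod (u x (l *\<^sub>R y)) \<le> M * (1 + norm x) ^ R" by auto
  from this[of 1] have M: "\<And>x. cmod (u x y) \<le> M * (1 + norm x) ^ R" by simp
  \<comment> \<open>By \<open>const\<close> the pairing at height \<open>l\<close> with imaginary
    centre q equals the pairing at height 1 with imaginary centre q + l y - y. As \<open>l\<close>
    tends to 0 the latter converges by domination, with \<open>u\<close> fixed, and the former to
    the boundary pairing.\<close>
  have "((\<lambda>l. LBINT t. u t y * gauss d (p - t) (q + l *\<^sub>R y - y))
     \<longlongrightarrow> (LBINT t. u t y * gauss d (p - t) (q - y))) (at 0 within {0<..<1})"
  proof (rule tendsto_parametric_integral[where B="\<lambda>t. M * A * exp (pi / d\<^sup>2 * (norm q + norm y)\<^sup>2) * pweight t"])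
    show "(\<lambda>t. u t y * gauss d (p - t) (q + l *\<^sub>R y - y)) \<in> borel_measurable lborel" for l
      using u_measurable[OF y] by (intro borel_measurable_times gauss_measurable) auto
    show "(\<lambda>t. u t y * gauss d (p - t) (q - y)) \<in> borel_measurable lborel"
      using u_measurable[OF y] by (intro borel_measurable_times gauss_measurable) auto
    show "integrable lborel (\<lambda>t::real^'n. M * A * exp (pi / d\<^sup>2 * (norm q + norm y)\<^sup>2) * pweight t)"
      by (intro integrable_mult_right integrable_pweight)
    fix t
    have "((\<lambda>l. u t y * gauss d (p - t) (q + l *\<^sub>R y - y)) \<longlongrightarrow> u t y * gauss d (p - t) (q + 0 *\<^sub>R y - y)) (at 0 within {0<..<1})"
      by (intro tendsto_mult gauss_tendsto tendsto_intros)
    thus "((\<lambda>l. u t y * gauss d (p - t) (q + l *\<^sub>R y - y)) \<longlongrightarrow> u t y * gauss d (p - t) (q - y)) (at 0 within {0<..<1})"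
      by simp
    fix l :: real assume l: "l \<in> {0<..<1}"
    have "q + l *\<^sub>R y - y = q - (1 - l) *\<^sub>R y" by (simp add: algebra_simps)
    hence "norm (q + l *\<^sub>R y - y) \<le> norm q + norm ((1 - l) *\<^sub>R y)" by (metis norm_triangle_ineq4)
    also have "\<dots> \<le> norm q + norm y" using l by (simp add: mult_left_le_one_le)
    finally show "norm (u t y * gauss d (p - t) (q + l *\<^sub>R y - y)) \<le> M * A * exp (pi / d\<^sup>2 * (norm q + norm y)\<^sup>2) * pweight t"
      by (intro bd M)
  qed
  hence "((\<lambda>l. LBINT t. u t y * gauss d (p - t) (q + l *\<^sub>R y - y))
     \<longlongrightarrow> (LBINT t. u t y * gauss d (p - t) (q - y))) (at_right 0)"
    unfolding at_within_unit_interval .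
  moreover have "((\<lambda>l. LBINT t. u t y * gauss d (p - t) (q + l *\<^sub>R y - y))
     \<longlongrightarrow> (LBINT t. g t * gauss d (p - t) q)) (at_right 0)"
  proof (rule Lim_transform_eventually[OF boundary_value[OF y d]])
    show "\<forall>\<^sub>F l in at_right 0. (LBINT t. u t (l *\<^sub>R y) * gauss d (p - t) q)
        = (LBINT t. u t y * gauss d (p - t) (q + l *\<^sub>R y - y))"
    proof -
      have "(LBINT t. u t (l *\<^sub>R y) * gauss d (p - t) q)
        = (LBINT t. u t y * gauss d (p - t) (q + l *\<^sub>R y - y))" if "0 < l" for l
        using const[OF that, of "q + l *\<^sub>R y"] by simp
      thus ?thesis by (auto simp: eventually_at intro!: exI[of _ 1])
    qed
  qed
  ultimately show ?thesis using tendsto_unique[OF trivial_limit_at_right_real] by blast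
qed

text \<open>Built from the boundary values alone, it makes sense at every height, including 0, and
  is entire along complex lines; over \<open>C\<close> it is the mollification of \<open>u\<close>
  by \<open>V_eq_mollified\<close>.\<close>

definition V :: "real \<Rightarrow> real^'n \<Rightarrow> real^'n \<Rightarrow> complex"
  where "V d x y = (LBINT t. g t * gauss d (x - t) y)"

lemma V_eq_mollified: "y \<in> C \<Longrightarrow> 0 < d \<Longrightarrow> V d x y = (LBINT t. rgauss d (x - t) *\<^sub>R u t y)"
  using pairing_gauss[of y d x y]
  by (simp add: V_def gauss_real scaleR_conv_of_real mult.commute)

text \<open>An elementary substitute for Hoelder's inequality: where |g| \<le> 1 the weight alone
  dominates, elsewhere |g|^2 does because the weight is at most 1.\<close>

lemma integrable_g_pweight: "integrable lborel (\<lambda>t. cmod (g t) * pweight t)"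
proof (rule Bochner_Integration.integrable_bound)
  show "integrable lborel (\<lambda>t. (cmod (g t))\<^sup>2 + pweight t)" using g_sq integrable_pweight by auto
  show "AE t in lborel. norm (cmod (g t) * pweight t) \<le> norm ((cmod (g t))\<^sup>2 + pweight t)"
  proof (rule AE_I2)
    fix t
    have "cmod (g t) * pweight t \<le> (cmod (g t))\<^sup>2 + pweight t"
    proof (cases "cmod (g t) \<le> 1")
      case True
      hence "cmod (g t) * pweight t \<le> pweight t" using pweight_nonneg by (intro mult_left_le_one_le) auto
      thus ?thesis by (simp add: add_increasing)
    next
      case False
      have "cmod (g t) * pweight t \<le> cmod (g t) * 1" by (intro mult_left_mono pweight_le_1) auto
      also have "\<dots> \<le> cmod (g t) * cmod (g t)" using False by (intro mult_left_mono) auto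
      finally show ?thesis using pweight_nonneg[of t] by (simp add: power2_eq_square)
    qed
    thus "norm (cmod (g t) * pweight t) \<le> norm ((cmod (g t))\<^sup>2 + pweight t)"
      using pweight_nonneg[of t] by (simp add: abs_mult)
  qed
qed measurable

lemma V_integrand_bound:
  assumes d: "0 < d"
  shows "\<exists>A. \<forall>p q t. norm p \<le> c \<longrightarrow> norm q \<le> c' \<longrightarrow> cmod (g t * gauss d (p - t) q) \<le> A * (cmod (g t) * pweight t)"
proof -
  from gauss_translate_bound[OF d, of c 0] obtain A where A: "0 \<le> A"
    "\<And>p t. norm p \<le> c \<Longrightarrow> rgauss d (p - t) \<le> A * pweight (t::real^'n)" by auto
  have "cmod (g t * gauss d (p - t) q) \<le> A * exp (pi / d\<^sup>2 * c'\<^sup>2) * (cmod (g t) * pweight t)"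
    if "norm p \<le> c" "norm q \<le> c'" for p q t
  proof -
    have "pi / d\<^sup>2 * (norm q)\<^sup>2 \<le> pi / d\<^sup>2 * c'\<^sup>2" using that by (intro mult_left_mono power_mono) auto
    hence "cmod (g t) * (rgauss d (p - t) * exp (pi / d\<^sup>2 * (norm q)\<^sup>2))
      \<le> cmod (g t) * ((A * pweight t) * exp (pi / d\<^sup>2 * c'\<^sup>2))"
      using rgauss_nonneg[OF d] A pweight_nonneg[of t] that by (intro mult_left_mono mult_mono) auto
    thus ?thesis by (simp add: norm_mult cmod_gauss[OF d] mult_ac)
  qed
  thus ?thesis by blast
qed

lemma V_holomorphic:
  assumes d: "0 < d"
  shows "(\<lambda>\<zeta>. V d (x + Re \<zeta> *\<^sub>R y) (Im \<zeta> *\<^sub>R y)) holomorphic_on UNIV"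
  unfolding V_def
proof (rule holomorphic_on_parametric_integral)
  show "(\<lambda>t. g t * gauss d (x + Re z *\<^sub>R y - t) (Im z *\<^sub>R y)) \<in> borel_measurable lborel" for z
    by (intro borel_measurable_times gauss_measurable) auto
  show "(\<lambda>\<zeta>. g t * gauss d (x + Re \<zeta> *\<^sub>R y - t) (Im \<zeta> *\<^sub>R y)) holomorphic_on UNIV" for t
    using gauss_holomorphic[of d "x - t" y 0 UNIV] by (intro holomorphic_intros) (simp add: algebra_simps)
  fix z :: complex
  from V_integrand_bound[OF d, of "norm x + (cmod z + 1) * norm y" "(cmod z + 1) * norm y"] obtain A where
    A: "\<And>p q t. norm p \<le> norm x + (cmod z + 1) * norm y \<Longrightarrow> norm q \<le> (cmod z + 1) * norm y
      \<Longrightarrow> cmod (g t * gauss d (p - t) q) \<le> A * (cmod (g t) * pweight t)" by blast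
  show "\<exists>r>0. \<exists>B. integrable lborel B \<and> (\<forall>w\<in>UNIV \<inter> ball z r. \<forall>t. cmod (g t * gauss d (x + Re w *\<^sub>R y - t) (Im w *\<^sub>R y)) \<le> B t)"
  proof (intro exI[of _ 1] exI[of _ "\<lambda>t. A * (cmod (g t) * pweight t)"] conjI ballI allI integrable_mult_right integrable_g_pweight)
    fix w t assume "w \<in> UNIV \<inter> ball z 1"
    hence "cmod w \<le> cmod z + 1" using norm_triangle_ineq2[of w z] by (simp add: dist_norm norm_minus_commute)
    hence w: "\<bar>Re w\<bar> \<le> cmod z + 1" "\<bar>Im w\<bar> \<le> cmod z + 1"
      using abs_Re_le_cmod[of w] abs_Im_le_cmod[of w] by linarith+
    have "norm (x + Re w *\<^sub>R y) \<le> norm x + \<bar>Re w\<bar> * norm y" using norm_triangle_ineq[of x "Re w *\<^sub>R y"] by simp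
    also have "\<dots> \<le> norm x + (cmod z + 1) * norm y" using w by (intro add_left_mono mult_right_mono) auto
    finally show "cmod (g t * gauss d (x + Re w *\<^sub>R y - t) (Im w *\<^sub>R y)) \<le> A * (cmod (g t) * pweight t)"
      using w by (intro A) (auto intro: mult_right_mono)
  qed simp
qed simp

lemma isCont_V:
  assumes d: "0 < d"
  shows "isCont (\<lambda>x. V d x y) x"
proof -
  from V_integrand_bound[OF d, of "norm x + 1" "norm y"] obtain A where
    A: "\<And>p t. norm p \<le> norm x + 1 \<Longrightarrow> cmod (g t * gauss d (p - t) y) \<le> A * (cmod (g t) * pweight t)" by blast
  have "((\<lambda>x. V d x y) \<longlongrightarrow> V d x y) (at x within ball x 1)"
    unfolding V_def
  proof (rule tendsto_parametric_integral[where B="\<lambda>t. A * (cmod (g t) * pweight t)"])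
    show "((\<lambda>q. g t * gauss d (q - t) y) \<longlongrightarrow> g t * gauss d (x - t) y) (at x within ball x 1)" for t
      by (intro tendsto_mult gauss_tendsto tendsto_intros)
    show "(\<lambda>t. g t * gauss d (q - t) y) \<in> borel_measurable lborel" for q
      by (intro borel_measurable_times gauss_measurable) auto
    show "(\<lambda>t. g t * gauss d (x - t) y) \<in> borel_measurable lborel"
      by (intro borel_measurable_times gauss_measurable) auto
    show "integrable lborel (\<lambda>t. A * (cmod (g t) * pweight t))"
      by (intro integrable_mult_right integrable_g_pweight)
    fix q t assume "q \<in> ball x 1"
    hence "norm q \<le> norm x + 1" using norm_triangle_ineq2[of q x] by (simp add: dist_norm norm_minus_commute)
    thus "norm (g t * gauss d (q - t) y) \<le> A * (cmod (g t) * pweight t)" by (rule A)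
  qed
  moreover have "at x within ball x 1 = at x" by (rule at_within_open) auto
  ultimately show ?thesis by (simp add: isCont_def)
qed

lemma V_measurable [measurable]: "0 < d \<Longrightarrow> (\<lambda>x. V d x y) \<in> borel_measurable borel"
  by (intro borel_measurable_continuous_onI) (simp add: continuous_on_eq_continuous_at isCont_V)

lemma rgauss_bounded:
  assumes "0 < d"
  obtains A where "0 \<le> A" "\<And>x::real^'n. rgauss d x \<le> A"
proof -
  from rgauss_bound[OF assms, of 0] obtain A where A: "0 \<le> A" "\<And>x::real^'n. rgauss d x \<le> A * pweight x" by auto
  have "rgauss d x \<le> A" for x :: "real^'n"
    using order_trans[OF A(2) mult_left_mono[OF pweight_le_1 A(1)]] by simp
  with A(1) show thesis by (rule that)
qed

text \<open>Splitting at |g| = 1, with \<open>A\<close> bounding the Gaussian. The integrals of both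
  majorants do not change with \<open>p\<close>, whence a single \<open>K\<close>.\<close>

lemma g_mollified_bound:
  assumes d: "0 < d"
  obtains K where "0 \<le> K" "\<And>p. integrable lborel (\<lambda>s. cmod (g s) * rgauss d (p - s))"
    "\<And>p. (LBINT s. cmod (g s) * rgauss d (p - s)) \<le> K"
proof -
  obtain A where A: "0 \<le> A" "\<And>x::real^'n. rgauss d x \<le> A" using rgauss_bounded[OF d] by blast
  let ?G = "LBINT s. (cmod (g s))\<^sup>2"
  have i: "integrable lborel (\<lambda>s. rgauss d (p - s) + A * (cmod (g s))\<^sup>2)" for p
    using lborel_integrable_reflect[OF integrable_rgauss[OF d, where 'n='n]] g_sq by auto
  have le: "cmod (g s) * rgauss d (p - s) \<le> rgauss d (p - s) + A * (cmod (g s))\<^sup>2" for p s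
  proof (cases "cmod (g s) \<le> 1")
    case True
    hence "cmod (g s) * rgauss d (p - s) \<le> rgauss d (p - s)"
      using rgauss_nonneg[OF d] by (intro mult_left_le_one_le) auto
    thus ?thesis using A(1) by (simp add: add_increasing2)
  next
    case False
    have "cmod (g s) * rgauss d (p - s) \<le> cmod (g s) * A" by (intro mult_left_mono A) auto
    also have "\<dots> \<le> (cmod (g s) * cmod (g s)) * A"
      using False A(1) mult_left_mono[of 1 "cmod (g s)" "cmod (g s)"] by (intro mult_right_mono) auto
    finally show ?thesis using rgauss_nonneg[OF d, of "p - s"] by (simp add: power2_eq_square mult_ac)
  qed
  show thesis
  proof
    show "0 \<le> 1 + A * ?G" using A(1) by simp
    show ii: "integrable lborel (\<lambda>s. cmod (g s) * rgauss d (p - s))" for p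
    proof (rule Bochner_Integration.integrable_bound[OF i[of p]])
      have "norm (cmod (g s) * rgauss d (p - s)) \<le> norm (rgauss d (p - s) + A * (cmod (g s))\<^sup>2)" for s
        using order_trans[OF le abs_ge_self, of s p] by (simp add: abs_mult rgauss_nonneg d)
      thus "AE s in lborel. norm (cmod (g s) * rgauss d (p - s)) \<le> norm (rgauss d (p - s) + A * (cmod (g s))\<^sup>2)"
        by (intro AE_I2)
    qed measurable
    have "(LBINT s. cmod (g s) * rgauss d (p - s)) \<le> (LBINT s. rgauss d (p - s) + A * (cmod (g s))\<^sup>2)" for p
      by (rule integral_mono[OF ii i le])
    also have "(LBINT s. rgauss d (p - s) + A * (cmod (g s))\<^sup>2) = 1 + A * ?G" for p
      using lborel_integrable_reflect[OF integrable_rgauss[OF d, where 'n='n]] g_sq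
        lborel_integral_reflect[of "rgauss d" 1 p] integral_rgauss[OF d, where 'n='n] by simp
    finally show "(LBINT s. cmod (g s) * rgauss d (p - s)) \<le> 1 + A * ?G" for p .
  qed
qed

text \<open>Two regimes meet at height 1. Below it the formula in \<open>g\<close> costs only a
  bounded exponential factor, which would explode with the height. Above it \<open>V\<close> is a
  mollification of \<open>u\<close>, whose growth bound is uniform away from height 0.\<close>

lemma V_growth:
  assumes d: "0 < d" and y: "y \<in> C"
  shows "\<exists>A\<ge>0. \<forall>x l. 0 \<le> l \<longrightarrow> cmod (V d x (l *\<^sub>R y)) \<le> A * (1 + norm x) ^ R"
proof -
  obtain K where K: "0 \<le> K" "\<And>p. integrable lborel (\<lambda>s. cmod (g s) * rgauss d (p - s))"
    "\<And>p. (LBINT s. cmod (g s) * rgauss d (p - s)) \<le> K" using g_mollified_bound[OF d] by blast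
  let ?E = "exp (pi / d\<^sup>2 * (norm y)\<^sup>2)"
  have one: "1 \<le> (1 + norm (x::real^'n)) ^ R" for x by (intro one_le_power) simp
  have small: "cmod (V d x (l *\<^sub>R y)) \<le> (K * ?E) * (1 + norm x) ^ R" if l: "0 \<le> l" "l \<le> 1" for x l
  proof -
    have "cmod (V d x (l *\<^sub>R y)) \<le> (LBINT t. cmod (g t * gauss d (x - t) (l *\<^sub>R y)))"
      unfolding V_def by (rule integral_norm_bound)
    also have "\<dots> \<le> (LBINT t. (cmod (g t) * rgauss d (x - t)) * ?E)"
    proof (rule integral_mono')
      show "integrable lborel (\<lambda>t. (cmod (g t) * rgauss d (x - t)) * ?E)" using K(2) by simp
      fix t
      have "norm (l *\<^sub>R y) \<le> norm y" using l by (simp add: mult_left_le_one_le)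
      hence "pi / d\<^sup>2 * (norm (l *\<^sub>R y))\<^sup>2 \<le> pi / d\<^sup>2 * (norm y)\<^sup>2" by (intro mult_left_mono power_mono) auto
      thus "cmod (g t * gauss d (x - t) (l *\<^sub>R y)) \<le> (cmod (g t) * rgauss d (x - t)) * ?E"
        unfolding norm_mult cmod_gauss[OF d] mult.assoc using rgauss_nonneg[OF d]
        by (intro mult_left_mono) auto
      show "0 \<le> (cmod (g t) * rgauss d (x - t)) * ?E"
        by (intro mult_nonneg_nonneg rgauss_nonneg d) auto
    qed
    also have "\<dots> \<le> K * ?E" using K(3) by (simp add: mult_right_mono)
    also have "\<dots> \<le> (K * ?E) * (1 + norm x) ^ R" using mult_left_mono[OF one[of x], of "K * ?E"] K(1) by simp
    finally show ?thesis .
  qed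
  from u_growth[OF y, of 1] obtain M where M: "\<And>x l. 1 \<le> l \<Longrightarrow> cmod (u x (l *\<^sub>R y)) \<le> M * (1 + norm x) ^ R" by auto
  have "0 \<le> M" using order_trans[OF norm_ge_zero M[of 1 0]] by simp
  from rgauss_bound[OF d, of R] obtain A where A: "0 \<le> A"
    "\<And>x::real^'n. (1 + norm x) ^ R * rgauss d x \<le> A * pweight x" by blast
  let ?P = "LBINT x. pweight (x::real^'n)"
  have P0: "0 \<le> ?P" by (intro Bochner_Integration.integral_nonneg pweight_nonneg)
  have large: "cmod (V d x (l *\<^sub>R y)) \<le> (M * A * ?P) * (1 + norm x) ^ R" if l: "1 \<le> l" for x l
  proof -
    have "l *\<^sub>R y \<in> C" using l by (intro scaleR_in_C y) simp
    hence "cmod (V d x (l *\<^sub>R y)) \<le> (LBINT t. cmod (rgauss d (x - t) *\<^sub>R u t (l *\<^sub>R y)))"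
      using d by (simp only: V_eq_mollified) (rule integral_norm_bound)
    also have "\<dots> \<le> (LBINT t. (M * (1 + norm x) ^ R * A) * pweight (x - t))"
    proof (rule integral_mono')
      show "integrable lborel (\<lambda>t. (M * (1 + norm x) ^ R * A) * pweight (x - t))"
        by (intro integrable_mult_right lborel_integrable_reflect integrable_pweight)
      fix t
      have "1 + norm t \<le> 1 + (norm x + norm (x - t))" using norm_triangle_ineq4[of x "x - t"] by simp
      also have "\<dots> \<le> (1 + norm x) * (1 + norm (x - t))" by (simp add: algebra_simps)
      finally have "(1 + norm t) ^ R \<le> (1 + norm x) ^ R * (1 + norm (x - t)) ^ R"
        unfolding power_mult_distrib[symmetric] by (intro power_mono) auto
      hence "cmod (u t (l *\<^sub>R y)) \<le> M * ((1 + norm x) ^ R * (1 + norm (x - t)) ^ R)"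
        using \<open>0 \<le> M\<close> by (intro order_trans[OF M[OF l]] mult_left_mono)
      hence "rgauss d (x - t) * cmod (u t (l *\<^sub>R y)) \<le> rgauss d (x - t) * (M * ((1 + norm x) ^ R * (1 + norm (x - t)) ^ R))"
        by (intro mult_left_mono rgauss_nonneg d)
      also have "\<dots> = M * (1 + norm x) ^ R * ((1 + norm (x - t)) ^ R * rgauss d (x - t))" by (simp only: ac_simps)
      also have "\<dots> \<le> M * (1 + norm x) ^ R * (A * pweight (x - t))"
        using \<open>0 \<le> M\<close> by (intro mult_left_mono A) simp
      finally show "cmod (rgauss d (x - t) *\<^sub>R u t (l *\<^sub>R y)) \<le> (M * (1 + norm x) ^ R * A) * pweight (x - t)"
        by (simp add: mult.assoc abs_rgauss[OF d])
      show "0 \<le> (M * (1 + norm x) ^ R * A) * pweight (x - t)"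
        using \<open>0 \<le> M\<close> A(1) pweight_nonneg by (intro mult_nonneg_nonneg) auto
    qed
    also have "\<dots> = (M * A * ?P) * (1 + norm x) ^ R"
      using lborel_integral_reflect[of pweight 1 x] by (simp add: mult_ac)
    finally show ?thesis .
  qed
  show ?thesis
  proof (intro exI[of _ "K * ?E + M * A * ?P"] conjI allI impI)
    show "0 \<le> K * ?E + M * A * ?P" using K(1) \<open>0 \<le> M\<close> A(1) P0 by simp
    fix x :: "real^'n" and l :: real assume l: "0 \<le> l"
    have "0 \<le> (K * ?E) * (1 + norm x) ^ R" "0 \<le> (M * A * ?P) * (1 + norm x) ^ R"
      using K(1) \<open>0 \<le> M\<close> A(1) P0 by simp_all
    thus "cmod (V d x (l *\<^sub>R y)) \<le> (K * ?E + M * A * ?P) * (1 + norm x) ^ R"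
      using small[of l x] large[of l x] l unfolding distrib_right by linarith
  qed
qed

lemma V_boundary_bound:
  assumes d: "0 < d"
  obtains K where "0 \<le> K" "\<And>x. cmod (V d x 0) \<le> K"
proof -
  obtain K where K: "0 \<le> K" "\<And>p. integrable lborel (\<lambda>s. cmod (g s) * rgauss d (p - s))"
    "\<And>p. (LBINT s. cmod (g s) * rgauss d (p - s)) \<le> K" using g_mollified_bound[OF d] by blast
  have "cmod (V d x 0) \<le> (LBINT s. cmod (g s * gauss d (x - s) 0))" for x
    unfolding V_def by (rule integral_norm_bound)
  also have "(LBINT s. cmod (g s * gauss d (x - s) 0)) = (LBINT s. cmod (g s) * rgauss d (x - s))" for x
    by (simp add: norm_mult gauss_real rgauss_nonneg[OF d])
  finally have "cmod (V d x 0) \<le> K" for x using K(3) order_trans by blast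
  with K(1) show thesis by (rule that)
qed

section \<open>The Poisson formula for the mollified function\<close>

lemma C_signs: "y \<in> C \<Longrightarrow> 0 \<le> l \<Longrightarrow> 0 \<le> (-1) ^ (v $ j) * (l *\<^sub>R y) $ j"
proof -
  assume y: "y \<in> C" and l: "0 \<le> l"
  from y C_subset_nrant have "0 \<le> (-1) ^ (v $ j) * y $ j" by (auto simp: nrant_def intro: less_imp_le)
  from mult_nonneg_nonneg[OF l this] show ?thesis by (simp add: mult_ac)
qed

text \<open>Cauchy's formula is applied to \<open>V\<close> times the conjugate kernel. The damping factor offsets the
  polynomial growth; it exists because \<open>C\<close> lies in an \<open>n\<close>-rant.\<close>

lemma V_poisson_damped:
  assumes d: "0 < d" and y0: "y0 \<in> C" and e: "0 < e"
  shows "V d x0 y0 * damp v (R + 2) e x0 y0 = (LBINT t. V d t 0 * damp v (R + 2) e t 0 * of_real (poisson x0 y0 t))"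
proof -
  \<comment> \<open>\<open>kern (x - x0) (Y + y0)\<close> is the multiplier K(w - conj z0) at w = x
    + iY, with z0 = x0 + i y0.\<close>
  define G where "G x Y = V d x Y * damp v (R + 2) e x Y * kern (x - x0) (Y + y0)" for x Y
  have e0: "0 \<le> e" using e by simp
  have signs: "0 \<le> (-1) ^ (v $ j) * y $ j" if "y \<in> C" for y j using C_signs[OF that, of 1] by simp
  have dampc: "isCont (\<lambda>x. damp v (R + 2) e x Y) x" if "\<And>j. 0 \<le> (-1) ^ (v $ j) * Y $ j" for x Y
    unfolding isCont_def using e0 that by (intro damp_tendsto tendsto_intros)
  have dampm: "(\<lambda>x. damp v (R + 2) e x Y) \<in> borel_measurable borel" if "\<And>j. 0 \<le> (-1) ^ (v $ j) * Y $ j" for Y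
    using dampc[of Y] that by (intro borel_measurable_continuous_onI) (auto simp: continuous_on_eq_continuous_at)
  have formula: "G x0 y0 = (LBINT t. G t 0 * kern (x0 - t) y0)"
  proof (rule cauchy_formula[OF _ _ _ _ _ y0])
    show "(\<lambda>\<zeta>. G (x + Re \<zeta> *\<^sub>R y) (Im \<zeta> *\<^sub>R y)) holomorphic_on {\<zeta>. 0 < Im \<zeta>}" if y: "y \<in> C" for x y
      unfolding G_def
    proof (intro holomorphic_on_mult)
      show "(\<lambda>\<zeta>. V d (x + Re \<zeta> *\<^sub>R y) (Im \<zeta> *\<^sub>R y)) holomorphic_on {\<zeta>. 0 < Im \<zeta>}"
        using V_holomorphic[OF d] by (rule holomorphic_on_subset) simp
      show "(\<lambda>\<zeta>. damp v (R + 2) e (x + Re \<zeta> *\<^sub>R y) (Im \<zeta> *\<^sub>R y)) holomorphic_on {\<zeta>. 0 < Im \<zeta>}"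
        by (rule damp_holomorphic[OF e0 signs[OF y]])
      show "(\<lambda>\<zeta>. kern (x + Re \<zeta> *\<^sub>R y - x0) (Im \<zeta> *\<^sub>R y + y0)) holomorphic_on {\<zeta>. 0 < Im \<zeta>}"
        using kern_holomorphic[OF y y0, of "x - x0"] by (simp add: algebra_simps)
    qed
    show "(\<lambda>x. G x y) \<in> borel_measurable borel" if "y \<in> C" for y
      unfolding G_def using d dampm[OF signs[OF that]] by measurable
    show "(\<lambda>x. G x 0) \<in> borel_measurable borel"
      unfolding G_def using d dampm[of 0] by measurable
    have "isCont (\<lambda>x. kern (x - x0) z) x0" if "z \<in> C" for z
      by (rule isCont_o2[OF _ isCont_kern[OF that]]) simp
    from this[OF add_in_C[OF y0 y0]] show "isCont (\<lambda>x. G x y0) x0"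
      unfolding G_def by (intro isCont_mult isCont_V d dampc signs y0)
  next
    fix x y assume y: "y \<in> C"
    have "isCont (\<lambda>\<zeta>. V d (x + Re \<zeta> *\<^sub>R y) (Im \<zeta> *\<^sub>R y)) (\<i> * of_real 0)"
      using holomorphic_on_imp_continuous_on[OF V_holomorphic[OF d]]
      unfolding continuous_on_eq_continuous_at[OF open_UNIV] by blast
    hence "((\<lambda>l. V d (x + Re (\<i> * of_real l) *\<^sub>R y) (Im (\<i> * of_real l) *\<^sub>R y))
        \<longlongrightarrow> V d (x + Re (\<i> * of_real 0) *\<^sub>R y) (Im (\<i> * of_real 0) *\<^sub>R y)) (at_right 0)"
      by (rule isCont_tendsto_compose) (intro tendsto_intros)
    hence "((\<lambda>l. V d x (l *\<^sub>R y)) \<longlongrightarrow> V d x 0) (at_right 0)" by simp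
    moreover have "((\<lambda>l. damp v (R + 2) e x (l *\<^sub>R y)) \<longlongrightarrow> damp v (R + 2) e x (0 *\<^sub>R y)) (at_right 0)"
      using e0 C_signs[OF y, of 0] by (intro damp_tendsto tendsto_intros) auto
    moreover have "((\<lambda>l. kern (x - x0) (y0 + l *\<^sub>R y)) \<longlongrightarrow> kern (x - x0) y0) (at_right 0)"
      by (rule kern_tendsto[OF y y0])
    ultimately show "((\<lambda>l. G x (l *\<^sub>R y)) \<longlongrightarrow> G x 0) (at_right 0)"
      unfolding G_def by (intro tendsto_mult) (simp_all add: add.commute)
  next
    fix y assume y: "y \<in> C"
    from V_growth[OF d y] obtain A1 where A1: "0 \<le> A1"
      "\<And>x l. 0 \<le> l \<Longrightarrow> cmod (V d x (l *\<^sub>R y)) \<le> A1 * (1 + norm x) ^ R" by blast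
    from damp_bound[OF e, of v R] obtain A2 where A2: "0 \<le> A2"
      "\<And>x y. (\<And>j. 0 \<le> (-1) ^ (v $ j) * y $ j) \<Longrightarrow> (1 + norm x) ^ R * cmod (damp v (R + 2) e x y) \<le> A2 * pweight x" by blast
    show "\<exists>A. \<forall>x l. 0 \<le> l \<longrightarrow> cmod (G x (l *\<^sub>R y)) \<le> A * pweight x"
    proof (intro exI allI impI)
      fix x l assume l: "0 \<le> (l::real)"
      \<comment> \<open>At \<open>l = 0\<close> the summand \<open>l *\<^sub>R y\<close> is the
        origin, which \<open>C\<close> omits; the sum is in \<open>C\<close> nevertheless.\<close>
      have c: "y0 + l *\<^sub>R y \<in> C"
        using l y0 by (cases "l = 0") (auto intro!: add_in_C scaleR_in_C y)
      have "cmod (kern (x - x0) (l *\<^sub>R y + y0)) \<le> kern0 (y0 + l *\<^sub>R y)"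
        using cmod_kern_le[OF c] by (simp add: add.commute)
      \<comment> \<open>\<open>kern0\<close> decreases in the directions of \<open>C\<close>, which
        bounds the multiplier uniformly in the height.\<close>
      also have "\<dots> \<le> kern0 y0"
        using l dual_cone_inner_nonneg y by (intro kern0_mono y0 c) auto
      finally have k: "cmod (kern (x - x0) (l *\<^sub>R y + y0)) \<le> kern0 y0" .
      have "cmod (G x (l *\<^sub>R y)) \<le> (A1 * (1 + norm x) ^ R * cmod (damp v (R + 2) e x (l *\<^sub>R y))) * kern0 y0"
        unfolding G_def norm_mult using A1(1) l by (intro mult_mono A1(2) k) auto
      also have "\<dots> = A1 * ((1 + norm x) ^ R * cmod (damp v (R + 2) e x (l *\<^sub>R y))) * kern0 y0" by (simp only: mult.assoc)
      also have "\<dots> \<le> A1 * (A2 * pweight x) * kern0 y0"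
        by (intro mult_right_mono mult_left_mono A2 A1 kern0_nonneg C_signs y l)
      finally show "cmod (G x (l *\<^sub>R y)) \<le> (A1 * A2 * kern0 y0) * pweight x" by (simp only: ac_simps)
    qed
  qed
  have k: "0 < kern0 (2 *\<^sub>R y0)" by (intro kern0_pos scaleR_in_C y0) simp
  have "kern 0 (y0 + y0) = of_real (kern0 (2 *\<^sub>R y0))" by (simp add: kern_zero scaleR_2)
  hence 1: "G x0 y0 = V d x0 y0 * damp v (R + 2) e x0 y0 * of_real (kern0 (2 *\<^sub>R y0))" by (simp add: G_def)
  have 2: "G t 0 * kern (x0 - t) y0 = of_real (kern0 (2 *\<^sub>R y0)) * (V d t 0 * damp v (R + 2) e t 0 * of_real (poisson x0 y0 t))" for t
  proof -
    have "kern (t - x0) y0 * kern (x0 - t) y0 = of_real ((cmod (kern (x0 - t) y0))\<^sup>2)"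
      using kern_minus[of "x0 - t" y0] by (simp only: complex_norm_square minus_diff_eq) (simp add: mult.commute)
    also have "\<dots> = of_real (kern0 (2 *\<^sub>R y0)) * of_real (poisson x0 y0 t)"
      unfolding poisson_def of_real_mult[symmetric] using k by simp
    finally show ?thesis by (simp add: G_def mult_ac)
  qed
  have "of_real (kern0 (2 *\<^sub>R y0)) * (V d x0 y0 * damp v (R + 2) e x0 y0)
      = of_real (kern0 (2 *\<^sub>R y0)) * (LBINT t. V d t 0 * damp v (R + 2) e t 0 * of_real (poisson x0 y0 t))"
    using formula unfolding 1 2 integral_mult_right_zero by (simp only: mult.commute)
  thus ?thesis using k by simp
qed

text \<open>On the real subspace the damping is at most 1 in modulus and \<open>V\<close> is
  bounded, so a multiple of the Poisson kernel dominates while the damping parameter tends to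
  0.\<close>

lemma V_poisson:
  assumes d: "0 < d" and y0: "y0 \<in> C"
  shows "V d x0 y0 = (LBINT t. V d t 0 * of_real (poisson x0 y0 t))"
proof -
  let ?e = "\<lambda>m. inverse (real (Suc m))"
  obtain K where K: "0 \<le> K" "\<And>x. cmod (V d x 0) \<le> K" using V_boundary_bound[OF d] by blast
  have sg0: "0 \<le> (-1) ^ (v $ j) * (0::real^'n) $ j" for j by simp
  have dampm: "(\<lambda>x. damp v (R + 2) e x 0) \<in> borel_measurable borel" if "0 \<le> e" for e
  proof -
    have "isCont (\<lambda>x. damp v (R + 2) e x 0) x" for x
      unfolding isCont_def using that by (intro damp_tendsto tendsto_intros) auto
    thus ?thesis by (intro borel_measurable_continuous_onI) (simp add: continuous_on_eq_continuous_at)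
  qed
  have "(\<lambda>m. V d x0 y0 * damp v (R + 2) (?e m) x0 y0) \<longlonglongrightarrow> V d x0 y0 * damp v (R + 2) 0 x0 y0"
    using C_signs[OF y0, of 1] by (intro tendsto_mult damp_tendsto tendsto_const LIMSEQ_inverse_real_of_nat) auto
  moreover have "(\<lambda>m. V d x0 y0 * damp v (R + 2) (?e m) x0 y0)
     \<longlonglongrightarrow> (LBINT t. V d t 0 * of_real (poisson x0 y0 t))"
  proof (subst V_poisson_damped[OF d y0])
    show "(\<lambda>m. LBINT t. V d t 0 * damp v (R + 2) (?e m) t 0 * of_real (poisson x0 y0 t))
     \<longlonglongrightarrow> (LBINT t. V d t 0 * of_real (poisson x0 y0 t))"
    proof (rule integral_dominated_convergence[where w="\<lambda>t. K * poisson x0 y0 t"])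
      show "(\<lambda>t. V d t 0 * complex_of_real (poisson x0 y0 t)) \<in> borel_measurable lborel" using d by measurable
      show "(\<lambda>t. V d t 0 * damp v (R + 2) (?e m) t 0 * complex_of_real (poisson x0 y0 t)) \<in> borel_measurable lborel" for m
        using d dampm[of "?e m"] by measurable
      show "integrable lborel (\<lambda>t. K * poisson x0 y0 t)" by (intro integrable_mult_right integrable_poisson y0)
      show "AE t in lborel. (\<lambda>m. V d t 0 * damp v (R + 2) (?e m) t 0 * of_real (poisson x0 y0 t))
          \<longlonglongrightarrow> V d t 0 * of_real (poisson x0 y0 t)"
      proof (rule AE_I2)
        fix t
        have "(\<lambda>m. V d t 0 * damp v (R + 2) (?e m) t 0 * of_real (poisson x0 y0 t))
          \<longlonglongrightarrow> V d t 0 * damp v (R + 2) 0 t 0 * of_real (poisson x0 y0 t)"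
          by (intro tendsto_mult damp_tendsto tendsto_const LIMSEQ_inverse_real_of_nat) auto
        thus "(\<lambda>m. V d t 0 * damp v (R + 2) (?e m) t 0 * of_real (poisson x0 y0 t))
          \<longlonglongrightarrow> V d t 0 * of_real (poisson x0 y0 t)" by (simp add: damp_zero)
      qed
      show "AE t in lborel. norm (V d t 0 * damp v (R + 2) (?e m) t 0 * of_real (poisson x0 y0 t)) \<le> K * poisson x0 y0 t" for m
      proof (rule AE_I2)
        fix t
        have "cmod (V d t 0) * cmod (damp v (R + 2) (?e m) t 0) \<le> K * 1"
          using K by (intro mult_mono cmod_damp_le_1) auto
        thus "norm (V d t 0 * damp v (R + 2) (?e m) t 0 * of_real (poisson x0 y0 t)) \<le> K * poisson x0 y0 t"
          by (simp add: norm_mult poisson_nonneg mult_right_mono)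
      qed
    qed
  qed simp
  ultimately show ?thesis using LIMSEQ_unique by (simp add: damp_zero) blast
qed

section \<open>Removing the mollification\<close>

definition smoothed_poisson :: "real \<Rightarrow> real^'n \<Rightarrow> real^'n \<Rightarrow> real^'n \<Rightarrow> real"
  where "smoothed_poisson d x y s = (LBINT t. rgauss d (s - t) *\<^sub>R poisson x y t)"

text \<open>Mollifying preserves sign, total mass and the upper bound of the Poisson kernel: sign
  and mass feed Scheffe's lemma, the bound feeds the passage from mean to mean square.\<close>

lemma smoothed_poisson:
  assumes d: "0 < d" and y: "y \<in> C"
  shows "integrable lborel (smoothed_poisson d x y)"
    and "(LBINT s. smoothed_poisson d x y s) = (LBINT t. poisson x y t)"
    and "0 \<le> smoothed_poisson d x y s"
    and "smoothed_poisson d x y s \<le> (kern0 y)\<^sup>2 / kern0 (2 *\<^sub>R y)"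
proof -
  let ?f = "\<lambda>(t, s). rgauss d (s - t) * poisson x y t"
  have mf: "?f \<in> borel_measurable (lborel \<Otimes>\<^sub>M lborel)" by measurable
  have rr: "(LBINT s. rgauss d (s - t)) = 1" for t :: "real^'n"
    using lborel_integral_translate[of "rgauss d" "- t"] integral_rgauss[OF d, where 'n='n] by simp
  have ir: "integrable lborel (\<lambda>s. rgauss d (s - t))" for t :: "real^'n"
    using lborel_integrable_reflect[OF integrable_rgauss[OF d, where 'n='n], of t] by (simp add: rgauss_minus)
  have int: "integrable (lborel \<Otimes>\<^sub>M lborel) ?f"
  proof (rule lborel_pair.Fubini_integrable[OF mf])
    show "AE t in lborel. integrable lborel (\<lambda>s. ?f (t, s))" using ir by (intro AE_I2) simp
    show "integrable lborel (\<lambda>t. LBINT s. norm (?f (t, s)))"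
      using integrable_poisson[OF y, of x] rr by (simp add: abs_mult poisson_nonneg abs_rgauss[OF d])
  qed
  have "integrable lborel (\<lambda>s. LBINT t. ?f (t, s))"
    using lborel_pair.integrable_fst'[OF lborel_pair.integrable_product_swap[OF int]] by simp
  thus "integrable lborel (smoothed_poisson d x y)" by (simp add: smoothed_poisson_def[abs_def])
  have "(LBINT s. smoothed_poisson d x y s) = (LBINT t. (LBINT s. ?f (t, s)))"
    unfolding smoothed_poisson_def using lborel_pair.Fubini_integral[OF int] by simp
  thus "(LBINT s. smoothed_poisson d x y s) = (LBINT t. poisson x y t)" by (simp add: rr)
  show "0 \<le> smoothed_poisson d x y s"
    unfolding smoothed_poisson_def
    by (intro Bochner_Integration.integral_nonneg) (simp add: rgauss_nonneg d poisson_nonneg)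
  define B where "B = (kern0 y)\<^sup>2 / kern0 (2 *\<^sub>R y)"
  have B: "0 \<le> B" "\<And>t. poisson x y t \<le> B" using poisson_le[OF y] by (auto simp: B_def kern0_nonneg)
  have "smoothed_poisson d x y s \<le> (LBINT t. rgauss d (s - t) * B)"
    unfolding smoothed_poisson_def real_scaleR_def
    by (rule integral_mono')
       (auto intro!: mult_left_mono B rgauss_nonneg d lborel_integrable_reflect integrable_rgauss mult_nonneg_nonneg)
  also have "\<dots> = B" using rr[of s] by (simp add: rgauss_minus)
  finally show "smoothed_poisson d x y s \<le> (kern0 y)\<^sup>2 / kern0 (2 *\<^sub>R y)" by (simp only: B_def)
qed

lemma poisson_representation:
  assumes y0: "y0 \<in> C"
  shows "u x0 y0 = (LBINT t. g t * of_real (poisson x0 y0 t))"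
proof -
  define d where "d m = inverse (real (Suc m))" for m
  have d: "0 < d m" for m by (simp add: d_def)
  let ?Q = "poisson x0 y0"
  let ?S = "\<lambda>m. smoothed_poisson (d m) x0 y0"
  define B where "B = (kern0 y0)\<^sup>2 / kern0 (2 *\<^sub>R y0)"
  have B0: "0 \<le> B" by (simp add: B_def kern0_nonneg)
  have SB: "0 \<le> ?S m s" "?S m s \<le> B" for m s
    using smoothed_poisson(3,4)[OF d y0] by (auto simp: B_def)
  have QB: "0 \<le> ?Q s" "?Q s \<le> B" for s using poisson_nonneg poisson_le[OF y0] by (auto simp: B_def)
  have iS: "integrable lborel (?S m)" for m by (rule smoothed_poisson(1)[OF d y0])
  have iQ: "integrable lborel ?Q" by (rule integrable_poisson[OF y0])
  have [measurable]: "?S m \<in> borel_measurable borel" for m using iS[of m] by auto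
  from u_growth[OF y0, of 1] obtain M where "\<And>x l. 1 \<le> l \<Longrightarrow> cmod (u x (l *\<^sub>R y0)) \<le> M * (1 + norm x) ^ R" by auto
  from this[of 1] have M: "\<And>x. cmod (u x y0) \<le> M * (1 + norm x) ^ R" by simp
  have "(\<lambda>m. V (d m) x0 y0) \<longlonglongrightarrow> u x0 y0"
    unfolding V_eq_mollified[OF y0 d] unfolding d_def
    using u_measurable[OF y0] u_cont[OF y0] M
    by (intro mollify_tendsto) (auto simp: continuous_on_eq_continuous_at)
  \<comment> \<open>The Gaussian is even, so Fubini's theorem moves the mollifier from
    \<open>g\<close> to the kernel; the bound \<open>K\<close>, uniform in the centre, makes the
    double integral absolutely convergent.\<close>
  moreover have "V (d m) x0 y0 = (LBINT s. g s * of_real (?S m s))" for m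
  proof -
    let ?f = "\<lambda>(t, s). g s * of_real (rgauss (d m) (s - t) * ?Q t)"
    have mf: "?f \<in> borel_measurable (lborel \<Otimes>\<^sub>M lborel)" by measurable
    obtain K where K: "0 \<le> K" "\<And>p. integrable lborel (\<lambda>s. cmod (g s) * rgauss (d m) (p - s))"
      "\<And>p. (LBINT s. cmod (g s) * rgauss (d m) (p - s)) \<le> K" using g_mollified_bound[OF d] by blast
    have n: "norm (?f (t, s)) = (cmod (g s) * rgauss (d m) (t - s)) * ?Q t" for t s
      using QB(1)[of t] rgauss_nonneg[OF d[of m], of "t - s"]
      by (simp add: norm_mult abs_mult rgauss_minus[of _ s t] del: of_real_mult)
    have int: "integrable (lborel \<Otimes>\<^sub>M lborel) ?f"
    proof (rule lborel_pair.Fubini_integrable[OF mf])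
      show "AE t in lborel. integrable lborel (\<lambda>s. ?f (t, s))"
      proof (rule AE_I2)
        fix t
        have "integrable lborel (\<lambda>s. (cmod (g s) * rgauss (d m) (t - s)) * ?Q t)" using K(2) by simp
        thus "integrable lborel (\<lambda>s. ?f (t, s))"
          by (rule Bochner_Integration.integrable_bound) (use n[of t] in auto)
      qed
      show "integrable lborel (\<lambda>t. LBINT s. norm (?f (t, s)))"
      proof (rule Bochner_Integration.integrable_bound)
        show "integrable lborel (\<lambda>t. K * ?Q t)" using iQ by simp
        show "(\<lambda>t. LBINT s. norm (?f (t, s))) \<in> borel_measurable lborel"
          using mf by (intro lborel.borel_measurable_lebesgue_integral) (simp add: case_prod_beta')
        have "(LBINT s. norm (?f (t, s))) \<le> K * ?Q t" for t
          unfolding n integral_mult_left_zero using K(3) QB(1) by (intro mult_right_mono)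
        moreover have "0 \<le> (LBINT s. norm (?f (t, s)))" for t
          by (rule Bochner_Integration.integral_nonneg) simp
        ultimately show "AE t in lborel. norm (LBINT s. norm (?f (t, s))) \<le> norm (K * ?Q t)"
          using K(1) QB(1) by (intro AE_I2) (simp del: norm_mult)
      qed
    qed
    have "V (d m) x0 y0 = (LBINT t. V (d m) t 0 * of_real (?Q t))" by (rule V_poisson[OF d y0])
    also have "\<dots> = (LBINT t. (LBINT s. ?f (t, s)))"
    proof (rule Bochner_Integration.integral_cong)
      fix t
      have "V (d m) t 0 * of_real (?Q t) = (LBINT s. g s * gauss (d m) (t - s) 0 * of_real (?Q t))"
        by (simp only: V_def integral_mult_left_zero)
      thus "V (d m) t 0 * of_real (?Q t) = (LBINT s. ?f (t, s))"
        by (simp add: gauss_real rgauss_minus[of _ t] mult.assoc)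
    qed simp
    also have "\<dots> = (LBINT s. (LBINT t. ?f (t, s)))"
      using lborel_pair.Fubini_integral[OF int] by simp
    also have "\<dots> = (LBINT s. g s * of_real (?S m s))"
      by (simp add: smoothed_poisson_def del: of_real_mult)
    finally show ?thesis .
  qed
  moreover have "(\<lambda>m. LBINT s. g s * of_real (?S m s)) \<longlonglongrightarrow> (LBINT s. g s * of_real (?Q s))"
  proof -
    let ?D = "\<lambda>m. LBINT s. \<bar>?S m s - ?Q s\<bar>"
    let ?G = "LBINT s. (cmod (g s))\<^sup>2"
    have D: "?D \<longlonglongrightarrow> 0"
    proof (rule scheffe[OF iQ QB(1) iS SB(1)])
      show "(\<lambda>m. ?S m s) \<longlonglongrightarrow> ?Q s" for s
        unfolding smoothed_poisson_def d_def
        using QB isCont_poisson[OF y0] by (intro mollify_tendsto[where N=0 and M=B]) auto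
      show "(LBINT s. ?S m s) = (LBINT s. ?Q s)" for m by (rule smoothed_poisson(2)[OF d y0])
    qed
    \<comment> \<open>Applied to both kernels: a nonnegative integrable function bounded by
      \<open>B\<close> pairs with \<open>g\<close>, again by splitting at |g| = 1.\<close>
    have sq: "integrable lborel (\<lambda>s. g s * of_real (q s))"
      if q: "integrable lborel q" "\<And>s. 0 \<le> q s" "\<And>s. q s \<le> B" for q
    proof (rule Bochner_Integration.integrable_bound)
      show "integrable lborel (\<lambda>s. B * (cmod (g s))\<^sup>2 + q s)" using g_sq q(1) by simp
      show "(\<lambda>s. g s * complex_of_real (q s)) \<in> borel_measurable lborel" using q(1) by measurable
      show "AE s in lborel. norm (g s * complex_of_real (q s)) \<le> norm (B * (cmod (g s))\<^sup>2 + q s)"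
      proof (rule AE_I2)
        fix s
        have "cmod (g s) * q s \<le> B * (cmod (g s))\<^sup>2 + q s"
        proof (cases "cmod (g s) \<le> 1")
          case True
          hence "cmod (g s) * q s \<le> q s" using q(2) by (intro mult_left_le_one_le) auto
          thus ?thesis using B0 by (simp add: add_increasing)
        next
          case False
          have "cmod (g s) * q s \<le> cmod (g s) * B" by (intro mult_left_mono q) auto
          also have "\<dots> \<le> (cmod (g s) * cmod (g s)) * B"
            using False B0 mult_left_mono[of 1 "cmod (g s)" "cmod (g s)"] by (intro mult_right_mono) auto
          finally show ?thesis using q(2)[of s] by (simp add: power2_eq_square mult_ac)
        qed
        thus "norm (g s * complex_of_real (q s)) \<le> norm (B * (cmod (g s))\<^sup>2 + q s)"
          using q(2)[of s] B0 by (simp add: norm_mult)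
      qed
    qed
    \<comment> \<open>The weight balances |g| x \<le> \<tau> |g|^2 + x^2 / \<tau>. Since x \<le> B,
      the second term integrates to at most B D / \<tau>, where D is the distance in mean, and
      \<tau>^2 \<ge> D makes this at most B \<tau>. Adding \<open>d m\<close> keeps \<tau>
      positive.\<close>
    define \<tau> where "\<tau> m = sqrt (?D m + d m)" for m
    have D0: "0 \<le> ?D m" for m by (rule Bochner_Integration.integral_nonneg) simp
    have \<tau>: "0 < \<tau> m" for m using D0[of m] d[of m] unfolding \<tau>_def real_sqrt_gt_0_iff by linarith
    have le: "cmod ((LBINT s. g s * of_real (?S m s)) - (LBINT s. g s * of_real (?Q s))) \<le> \<tau> m * (?G + B)" for m
    proof -
      have iD: "integrable lborel (\<lambda>s. \<bar>?S m s - ?Q s\<bar>)" using iS iQ by simp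
      have ib: "integrable lborel (\<lambda>s. \<tau> m * (cmod (g s))\<^sup>2 + B / \<tau> m * \<bar>?S m s - ?Q s\<bar>)"
        using g_sq iD by simp
      have "(LBINT s. g s * of_real (?S m s)) - (LBINT s. g s * of_real (?Q s))
          = (LBINT s. g s * of_real (?S m s) - g s * of_real (?Q s))"
        by (intro Bochner_Integration.integral_diff[symmetric] sq iS iQ SB QB)
      also have "cmod \<dots> \<le> (LBINT s. cmod (g s * of_real (?S m s) - g s * of_real (?Q s)))"
        by (rule integral_norm_bound)
      also have "\<dots> \<le> (LBINT s. \<tau> m * (cmod (g s))\<^sup>2 + B / \<tau> m * \<bar>?S m s - ?Q s\<bar>)"
      proof (rule integral_mono'[OF ib])
        fix s
        let ?x = "\<bar>?S m s - ?Q s\<bar>" and ?c = "cmod (g s)" and ?t = "\<tau> m"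
        have xB: "?x \<le> B" using SB[of m s] QB[of s] by linarith
        have "cmod (g s * of_real (?S m s) - g s * of_real (?Q s)) = ?c * ?x"
          by (simp only: right_diff_distrib[symmetric] norm_mult of_real_diff[symmetric] norm_of_real)
        also have "\<dots> \<le> ?t * ?c\<^sup>2 + ?x / ?t * ?x"
        proof (cases "?x \<le> ?t * ?c")
          case True
          have "?c * ?x \<le> ?c * (?t * ?c)" using True by (intro mult_left_mono) auto
          moreover have "0 \<le> ?x / ?t * ?x" using \<tau>[of m] by simp
          ultimately show ?thesis by (simp add: power2_eq_square mult_ac)
        next
          case False
          have "?c \<le> ?x / ?t" using False \<tau>[of m] by (simp add: field_simps)
          hence "?c * ?x \<le> ?x / ?t * ?x" by (intro mult_right_mono) auto
          moreover have "0 \<le> ?t * ?c\<^sup>2" using \<tau>[of m] by simp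
          ultimately show ?thesis by linarith
        qed
        also have "\<dots> \<le> ?t * ?c\<^sup>2 + B / ?t * ?x"
          using xB \<tau>[of m] by (intro add_left_mono mult_right_mono divide_right_mono) auto
        finally show "cmod (g s * of_real (?S m s) - g s * of_real (?Q s)) \<le> ?t * ?c\<^sup>2 + B / ?t * ?x" .
        show "0 \<le> ?t * ?c\<^sup>2 + B / ?t * ?x" using \<tau>[of m] B0 by (intro add_nonneg_nonneg mult_nonneg_nonneg) auto
      qed
      also have "\<dots> = \<tau> m * ?G + B * (?D m / \<tau> m)" using g_sq iD by simp
      also have "?D m / \<tau> m \<le> \<tau> m"
      proof -
        have "?D m \<le> \<tau> m * \<tau> m" using D0[of m] d[of m] by (simp add: \<tau>_def)
        thus ?thesis using \<tau>[of m] by (simp add: pos_divide_le_eq)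
      qed
      hence "\<tau> m * ?G + B * (?D m / \<tau> m) \<le> \<tau> m * ?G + B * \<tau> m" using B0 by (intro add_left_mono mult_left_mono)
      finally show ?thesis by (simp add: algebra_simps)
    qed
    have "(\<lambda>m. \<tau> m * (?G + B)) \<longlonglongrightarrow> sqrt (0 + 0) * (?G + B)"
      unfolding \<tau>_def using LIMSEQ_inverse_real_of_nat by (intro tendsto_intros D) (simp only: d_def)
    hence "(\<lambda>m. \<tau> m * (?G + B)) \<longlonglongrightarrow> 0" by simp
    hence "(\<lambda>m. (LBINT s. g s * of_real (?S m s)) - (LBINT s. g s * of_real (?Q s))) \<longlonglongrightarrow> 0"
      by (rule Lim_null_comparison[rotated]) (use le in simp)
    thus ?thesis using Lim_null by blast
  qed
  ultimately show ?thesis using LIMSEQ_unique by simp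
qed

end

section \<open>Gaussians are Schwartz functions\<close>

text \<open>Polynomials in the coordinates of \<open>p + iq - t\<close>: the iterated partial derivatives of
  \<open>t \<mapsto> gauss d (p - t) q\<close> are such polynomials times the Gaussian itself.\<close>

inductive gauss_poly :: "real^'n \<Rightarrow> real^'n \<Rightarrow> (real^'n \<Rightarrow> complex) \<Rightarrow> bool" for p q where
  gauss_poly_const: "gauss_poly p q (\<lambda>t. c)"
| gauss_poly_scale: "gauss_poly p q f \<Longrightarrow> gauss_poly p q (\<lambda>t. c * f t)"
| gauss_poly_coord: "gauss_poly p q f \<Longrightarrow> gauss_poly p q (\<lambda>t. Complex ((p - t) $ k) (q $ k) * f t)"
| gauss_poly_add: "gauss_poly p q f \<Longrightarrow> gauss_poly p q g \<Longrightarrow> gauss_poly p q (\<lambda>t. f t + g t)"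

lemma coord_has_derivative:
  "((\<lambda>t. Complex ((p - t) $ k) (q $ k)) has_derivative (\<lambda>h. - of_real (h $ k))) (at (t::real^'n))"
proof -
  have "(\<lambda>t. Complex ((p - t) $ k) (q $ k)) = (\<lambda>t. Complex (p $ k) (q $ k) - of_real (t $ k))"
    by (auto simp: complex_eq_iff)
  moreover have "bounded_linear (\<lambda>h::real^'n. complex_of_real (h $ k))"
    by (intro bounded_linear_of_real[THEN bounded_linear_compose] bounded_linear_vec_nth)
  from bounded_linear.has_derivative[OF this has_derivative_ident]
  have "((\<lambda>t. complex_of_real (t $ k)) has_derivative (\<lambda>h. of_real (h $ k))) (at t)" .
  ultimately show ?thesis using has_derivative_diff[OF has_derivative_const] by fastforce
qed

text \<open>Differentiability goes through the same induction because
  \<open>frechet_derivative\<close> has its meaning only at points of differentiability. The class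
  is closed since a coordinate factor has constant partial derivatives.\<close>

lemma gauss_poly_derivative:
  fixes f :: "real^'n \<Rightarrow> complex"
  assumes "gauss_poly p q f"
  shows "(\<forall>t. f differentiable at t) \<and> (\<forall>k. gauss_poly p q (partial_derivative k f))"
  using assms
proof (induction rule: gauss_poly.induct)
  case (gauss_poly_const c)
  have "partial_derivative k (\<lambda>t::real^'n. c) = (\<lambda>t. 0)" for k
    unfolding partial_derivative_def frechet_derivative_at[OF has_derivative_const, symmetric] ..
  thus ?case using gauss_poly.gauss_poly_const[of p q 0] by simp
next
  case (gauss_poly_scale f c)
  have D: "((\<lambda>t. c * f t) has_derivative (\<lambda>h. c * frechet_derivative f (at t) h)) (at t)" for t
    using gauss_poly_scale.IH frechet_derivative_works by (blast intro: has_derivative_mult_right)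
  have "partial_derivative k (\<lambda>t. c * f t) = (\<lambda>t. c * partial_derivative k f t)" for k
    unfolding partial_derivative_def frechet_derivative_at[OF D, symmetric] ..
  thus ?case using D gauss_poly_scale.IH by (auto simp: differentiable_def intro: gauss_poly.gauss_poly_scale)
next
  case (gauss_poly_coord f j)
  let ?X = "\<lambda>t. Complex ((p - t) $ j) (q $ j)"
  have D: "((\<lambda>t. ?X t * f t) has_derivative
      (\<lambda>h. ?X t * frechet_derivative f (at t) h + - of_real (h $ j) * f t)) (at t)" for t
  proof (rule has_derivative_mult[OF coord_has_derivative])
    show "(f has_derivative frechet_derivative f (at t)) (at t)"
      using gauss_poly_coord.IH frechet_derivative_works by blast
  qed
  have P: "partial_derivative k (\<lambda>t. ?X t * f t)
      = (\<lambda>t. ?X t * partial_derivative k f t + - of_real (axis k 1 $ j) * f t)" for k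
    unfolding partial_derivative_def frechet_derivative_at[OF D, symmetric] ..
  have "gauss_poly p q (partial_derivative k (\<lambda>t. ?X t * f t))" for k
    unfolding P using gauss_poly_coord
    by (intro gauss_poly.gauss_poly_add gauss_poly.gauss_poly_coord gauss_poly.gauss_poly_scale) blast+
  thus ?case using D unfolding differentiable_def by blast
next
  case (gauss_poly_add f g)
  have D: "((\<lambda>t. f t + g t) has_derivative
      (\<lambda>h. frechet_derivative f (at t) h + frechet_derivative g (at t) h)) (at t)" for t
    using gauss_poly_add.IH frechet_derivative_works by (blast intro: has_derivative_add)
  have "partial_derivative k (\<lambda>t. f t + g t)
      = (\<lambda>t. partial_derivative k f t + partial_derivative k g t)" for k
    unfolding partial_derivative_def frechet_derivative_at[OF D, symmetric] ..
  thus ?case using D gauss_poly_add.IH by (auto simp: differentiable_def intro: gauss_poly.gauss_poly_add)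
qed

lemma gauss_poly_growth:
  assumes "gauss_poly p q f"
  shows "\<exists>A N. 0 \<le> A \<and> (\<forall>t. cmod (f t) \<le> A * (1 + norm t) ^ N)"
  using assms
proof (induction rule: gauss_poly.induct)
  case (gauss_poly_const c)
  show ?case by (intro exI[of _ "cmod c"] exI[of _ 0]) simp
next
  case (gauss_poly_scale f c)
  then obtain A N where "0 \<le> A" "\<And>t. cmod (f t) \<le> A * (1 + norm t) ^ N" by blast
  thus ?case
    by (intro exI[of _ "cmod c * A"] exI[of _ N]) (auto simp: norm_mult mult.assoc intro: mult_left_mono)
next
  case (gauss_poly_coord f k)
  then obtain A N where A: "0 \<le> A" "\<And>t. cmod (f t) \<le> A * (1 + norm t) ^ N" by blast
  let ?c = "1 + norm p + norm q"
  show ?case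
  proof (intro exI[of _ "?c * A"] exI[of _ "Suc N"] conjI allI)
    show "0 \<le> ?c * A" using A(1) by simp
    fix t
    have "cmod (Complex ((p - t) $ k) (q $ k)) \<le> \<bar>(p - t) $ k\<bar> + \<bar>q $ k\<bar>"
      using cmod_le[of "Complex ((p - t) $ k) (q $ k)"] by simp
    also have "\<dots> \<le> norm (p - t) + norm q" by (intro add_mono component_le_norm_cart)
    also have "\<dots> \<le> norm p + norm t + norm q" using norm_triangle_ineq4[of p t] by simp
    also have "\<dots> \<le> ?c * (1 + norm t)" by (simp add: algebra_simps)
    finally have "cmod (Complex ((p - t) $ k) (q $ k)) * cmod (f t) \<le> ?c * (1 + norm t) * (A * (1 + norm t) ^ N)"
      by (intro mult_mono A) auto
    thus "cmod (Complex ((p - t) $ k) (q $ k) * f t) \<le> ?c * A * (1 + norm t) ^ Suc N"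
      by (simp only: norm_mult power_Suc ac_simps)
  qed
next
  case (gauss_poly_add f g)
  then obtain A N A' N' where A: "0 \<le> A" "\<And>t. cmod (f t) \<le> A * (1 + norm t) ^ N"
    "0 \<le> A'" "\<And>t. cmod (g t) \<le> A' * (1 + norm t) ^ N'" by blast
  show ?case
  proof (intro exI[of _ "A + A'"] exI[of _ "N + N'"] conjI allI)
    show "0 \<le> A + A'" using A by simp
    fix t
    have "cmod (f t + g t) \<le> A * (1 + norm t) ^ N + A' * (1 + norm t) ^ N'"
      using norm_triangle_ineq[of "f t" "g t"] A(2,4)[of t] by linarith
    also have "\<dots> \<le> A * (1 + norm t) ^ (N + N') + A' * (1 + norm t) ^ (N + N')"
      using A by (intro add_mono mult_left_mono power_increasing) auto
    finally show "cmod (f t + g t) \<le> (A + A') * (1 + norm t) ^ (N + N')" by (simp only: distrib_right)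
  qed
qed

text \<open>The sum is the logarithmic derivative of the Gaussian; its sign is positive because the
  variable enters as \<open>p - t\<close>.\<close>

lemma gauss_has_derivative:
  "((\<lambda>t. gauss d (p - t) q) has_derivative
     (\<lambda>h. (\<Sum>j\<in>UNIV. of_real (2 * pi / d\<^sup>2) * Complex ((p - t) $ j) (q $ j) * of_real (h $ j)) * gauss d (p - t) q)) (at (t::real^'n))"
proof -
  let ?X = "\<lambda>j t. Complex ((p - t) $ j) (q $ j)"
  let ?k = "complex_of_real (pi / d\<^sup>2)"
  have g: "gauss d (p - t) q = of_real (1 / d) ^ CARD('n) * exp (\<Sum>j\<in>UNIV. - (?k * (?X j t * ?X j t)))" for t
    unfolding gauss_def prod.distrib prod_constant exp_sum[OF finite] power2_eq_square ..
  have S: "((\<lambda>t. \<Sum>j\<in>UNIV. - (?k * (?X j t * ?X j t))) has_derivative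
      (\<lambda>h. \<Sum>j\<in>UNIV. - (?k * (?X j t * - of_real (h $ j) + - of_real (h $ j) * ?X j t)))) (at t)"
    by (intro has_derivative_sum has_derivative_minus has_derivative_mult_right has_derivative_mult coord_has_derivative)
  have "((\<lambda>t. exp (\<Sum>j\<in>UNIV. - (?k * (?X j t * ?X j t)))) has_derivative
      (\<lambda>h. (\<Sum>j\<in>UNIV. - (?k * (?X j t * - of_real (h $ j) + - of_real (h $ j) * ?X j t)))
         * exp (\<Sum>j\<in>UNIV. - (?k * (?X j t * ?X j t))))) (at t)"
    using has_derivative_compose[OF S DERIV_exp[unfolded has_field_derivative_def]]
    by (simp only: mult.commute)
  from has_derivative_mult_right[OF this, of "of_real (1 / d) ^ CARD('n)"]
  have "((\<lambda>t. gauss d (p - t) q) has_derivative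
      (\<lambda>h. (\<Sum>j\<in>UNIV. - (?k * (?X j t * - of_real (h $ j) + - of_real (h $ j) * ?X j t))) * gauss d (p - t) q)) (at t)"
    unfolding g by (simp only: ac_simps)
  moreover have e: "- (?k * (x * - h + - h * x)) = of_real (2 * pi / d\<^sup>2) * x * h" for x h :: complex
    by (simp add: algebra_simps)
  ultimately show ?thesis by (simp only: e)
qed

lemma iterated_partial_gauss:
  "\<exists>f. gauss_poly p q f \<and> iterated_partial js (\<lambda>t. gauss d (p - t) q) = (\<lambda>t. f t * gauss d (p - (t::real^'n)) q)"
proof (induction js)
  case Nil
  show ?case by (intro exI[of _ "\<lambda>t. 1"]) (auto intro: gauss_poly_const)
next
  case (Cons k js)
  then obtain f where f: "gauss_poly p q f"
    "iterated_partial js (\<lambda>t. gauss d (p - t) q) = (\<lambda>t. f t * gauss d (p - t) q)" by blast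
  let ?S = "\<lambda>t h. \<Sum>j\<in>UNIV. of_real (2 * pi / d\<^sup>2) * Complex ((p - t) $ j) (q $ j) * of_real (h $ j)"
  have D: "((\<lambda>t. f t * gauss d (p - t) q) has_derivative
     (\<lambda>h. f t * (?S t h * gauss d (p - t) q) + frechet_derivative f (at t) h * gauss d (p - t) q)) (at t)" for t
  proof (rule has_derivative_mult[OF _ gauss_has_derivative])
    show "(f has_derivative frechet_derivative f (at t)) (at t)"
      using gauss_poly_derivative[OF f(1)] frechet_derivative_works by blast
  qed
  have S: "?S t (axis k 1) = of_real (2 * pi / d\<^sup>2) * Complex ((p - t) $ k) (q $ k)" for t
    by (subst sum.remove[of _ k]) (auto simp: axis_def intro!: sum.neutral)
  \<comment> \<open>The recursion of Hermite polynomials: the previous factor times the logarithmic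
    derivative, plus its own derivative.\<close>
  let ?f' = "\<lambda>t. of_real (2 * pi / d\<^sup>2) * (Complex ((p - t) $ k) (q $ k) * f t) + partial_derivative k f t"
  have "iterated_partial (k # js) (\<lambda>t. gauss d (p - t) q) = (\<lambda>t. ?f' t * gauss d (p - t) q)"
  proof
    fix t
    have "iterated_partial (k # js) (\<lambda>t. gauss d (p - t) q) t
      = f t * (?S t (axis k 1) * gauss d (p - t) q) + frechet_derivative f (at t) (axis k 1) * gauss d (p - t) q"
      by (simp only: iterated_partial.simps f(2) partial_derivative_def frechet_derivative_at[OF D, symmetric])
    thus "iterated_partial (k # js) (\<lambda>t. gauss d (p - t) q) t = ?f' t * gauss d (p - t) q"
      unfolding S partial_derivative_def by (simp only: distrib_right distrib_left ac_simps)
  qed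
  moreover have "gauss_poly p q ?f'"
    using gauss_poly_derivative[OF f(1)] by (intro gauss_poly_add gauss_poly_scale gauss_poly_coord f(1)) blast
  ultimately show ?case by blast
qed

lemma gauss_schwartz:
  assumes d: "0 < d"
  shows "(\<lambda>t. gauss d (p - t) q) \<in> schwartz_space"
  unfolding schwartz_space_def
proof (intro CollectI conjI allI)
  fix js x
  obtain f where f: "gauss_poly p q f"
    "iterated_partial js (\<lambda>t. gauss d (p - t) q) = (\<lambda>t. f t * gauss d (p - t) q)"
    using iterated_partial_gauss by blast
  show "iterated_partial js (\<lambda>t. gauss d (p - t) q) differentiable at x"
    unfolding f(2) using gauss_poly_derivative[OF f(1)]
    by (intro differentiable_mult differentiableI[OF gauss_has_derivative]) blast
next
  fix \<alpha> :: "'a \<Rightarrow> nat" and js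
  obtain f where f: "gauss_poly p q f"
    "iterated_partial js (\<lambda>t. gauss d (p - t) q) = (\<lambda>t. f t * gauss d (p - t) q)"
    using iterated_partial_gauss by blast
  obtain A N where A: "0 \<le> A" "\<And>t. cmod (f t) \<le> A * (1 + norm t) ^ N" using gauss_poly_growth[OF f(1)] by blast
  let ?K = "sum \<alpha> UNIV"
  let ?E = "exp (pi / d\<^sup>2 * (norm q)\<^sup>2)"
  \<comment> \<open>The real Gaussian absorbs the degree of the monomial together with the growth
    exponent of the polynomial factor; the imaginary centre contributes only the constant
    \<open>?E\<close>.\<close>
  from gauss_translate_bound[OF d, of "norm p" "?K + N"] obtain B where B: "0 \<le> B"
    "\<And>t. (1 + norm t) ^ (?K + N) * rgauss d (p - t) \<le> B * pweight t" by blast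
  show "\<exists>B. \<forall>x. \<bar>\<Prod>j\<in>UNIV. (x $ j) ^ \<alpha> j\<bar> * cmod (iterated_partial js (\<lambda>t. gauss d (p - t) q) x) \<le> B"
  proof (intro exI[of _ "A * ?E * B"] allI)
    fix x :: "real^'a"
    have "\<bar>\<Prod>j\<in>UNIV. (x $ j) ^ \<alpha> j\<bar> = (\<Prod>j\<in>UNIV. \<bar>x $ j\<bar> ^ \<alpha> j)" by (simp add: abs_prod power_abs)
    also have "\<dots> \<le> (\<Prod>j\<in>UNIV. (1 + norm x) ^ \<alpha> j)"
    proof (intro prod_mono conjI power_mono)
      show "\<bar>x $ j\<bar> \<le> 1 + norm x" for j using component_le_norm_cart[of x j] by linarith
    qed auto
    also have "\<dots> = (1 + norm x) ^ ?K" by (simp add: power_sum)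
    finally have "\<bar>\<Prod>j\<in>UNIV. (x $ j) ^ \<alpha> j\<bar> * cmod (f x * gauss d (p - x) q)
      \<le> (1 + norm x) ^ ?K * ((A * (1 + norm x) ^ N) * (rgauss d (p - x) * ?E))"
      unfolding norm_mult cmod_gauss[OF d] using A rgauss_nonneg[OF d, of "p - x"]
      by (intro mult_mono) auto
    also have "\<dots> = A * ?E * ((1 + norm x) ^ (?K + N) * rgauss d (p - x))" by (simp only: power_add ac_simps)
    also have "\<dots> \<le> A * ?E * (B * 1)"
      using A(1) order_trans[OF B(2) mult_left_mono[OF pweight_le_1 B(1)]] by (intro mult_left_mono) auto
    finally show "\<bar>\<Prod>j\<in>UNIV. (x $ j) ^ \<alpha> j\<bar> * cmod (iterated_partial js (\<lambda>t. gauss d (p - t) q) x) \<le> A * ?E * B"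
      unfolding f(2) by simp
  qed
qed

section \<open>Hilbert-space valued functions\<close>

lemma (in tube_cone) cauchy_kernel_eq: "cauchy_kernel C (vcomplex x y) = kern x y"
proof -
  have e: "exp (2 * of_real pi * \<i> * (\<Sum>j\<in>UNIV. vcomplex x y $ j * of_real (\<eta> $ j))) = tube_char x y \<eta>" for \<eta>
  proof -
    have "(\<Sum>j\<in>UNIV. vcomplex x y $ j * of_real (\<eta> $ j)) = of_real (x \<bullet> \<eta>) + \<i> * of_real (y \<bullet> \<eta>)"
      by (simp add: complex_eq_iff vcomplex_def inner_vec_def)
    thus ?thesis unfolding tube_char_def by (intro arg_cong[where f=exp]) (simp add: algebra_simps)
  qed
  have "cauchy_kernel C (vcomplex x y) = (\<integral>\<eta>. indicator (dual_cone C) \<eta> *\<^sub>R tube_char x y \<eta> \<partial>lebesgue)"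
    by (simp only: cauchy_kernel_def set_lebesgue_integral_def e)
  also have "\<dots> = (LBINT \<eta>. indicator (dual_cone C) \<eta> *\<^sub>R tube_char x y \<eta>)"
    by (rule integral_completion) measurable
  finally show ?thesis by (simp add: kern_def of_real_laplace scaleR_conv_of_real)
qed

lemma (in tube_cone) poisson_kernel_eq: "poisson_kernel C (vcomplex x y) t = of_real (poisson x y t)"
proof -
  have "vcomplex x y - vcomplex t 0 = vcomplex (x - t) y"
    by (simp add: vcomplex_def vec_eq_iff complex_eq_iff)
  moreover have "(\<chi> j. Im (vcomplex x y $ j)) = y" by (simp add: vcomplex_def vec_eq_iff)
  ultimately show ?thesis
    by (simp add: poisson_kernel_def cauchy_kernel_eq kern_zero poisson_def)
qed

lemma borel_measurable_lebesgueI: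
  "f \<in> borel_measurable borel \<Longrightarrow> f \<in> borel_measurable lebesgue"
  by (rule measurable_completion) simp

text \<open>The scalar argument works with Borel functions on \<open>lborel\<close>, whereas inner
  products with \<open>h\<close> are Lebesgue measurable; a change on a null set connects the
  two.\<close>

lemma borel_version_complex:
  fixes f :: "'a \<Rightarrow> complex"
  assumes "f \<in> borel_measurable (completion M)"
  obtains g where "g \<in> borel_measurable M" "AE x in M. f x = g x"
proof -
  have "(\<lambda>x. Re (f x)) \<in> borel_measurable (completion M)" "(\<lambda>x. Im (f x)) \<in> borel_measurable (completion M)"
    using assms by measurable
  from this[THEN completion_ex_borel_measurable_real] obtain a b where
    ab: "a \<in> borel_measurable M" "AE x in M. Re (f x) = a x" "b \<in> borel_measurable M" "AE x in M. Im (f x) = b x"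
    by blast
  show thesis
  proof
    show "(\<lambda>x. of_real (a x) + \<i> * of_real (b x)) \<in> borel_measurable M" using ab by measurable
    show "AE x in M. f x = of_real (a x) + \<i> * of_real (b x)"
      using ab(2,4) by eventually_elim (simp add: complex_eq_iff)
  qed
qed

text \<open>The closure of an open ray adds only the origin, which the unit sphere avoids.\<close>

lemma compact_subcone_ray:
  assumes "vertex_cone C" "y \<in> C" "y \<noteq> 0"
  shows "compact_subcone {l *\<^sub>R y | l. 0 < l} C"
  unfolding compact_subcone_def
proof (intro conjI)
  let ?C' = "{l *\<^sub>R y | l. 0 < l}"
  show "vertex_cone ?C'" unfolding vertex_cone_def
  proof (intro ballI allI impI)
    fix z and c :: real assume "z \<in> ?C'" "0 < c"
    then obtain l where "z = l *\<^sub>R y" "0 < l" by blast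
    thus "c *\<^sub>R z \<in> ?C'" using \<open>0 < c\<close> by (auto intro!: exI[of _ "c * l"])
  qed
  show sub: "?C' \<subseteq> C" using assms by (auto simp: vertex_cone_def)
  \<comment> \<open>The closed ray through \<open>y\<close> as a closed condition: vectors equal to
    their own projection on \<open>y\<close>, with nonnegative coefficient.\<close>
  let ?S = "{z. z = ((z \<bullet> y) / (y \<bullet> y)) *\<^sub>R y \<and> 0 \<le> z \<bullet> y}"
  have yy: "0 < y \<bullet> y" using assms(3) by simp
  have "closed ?S"
    using yy by (intro closed_Collect_conj closed_Collect_eq closed_Collect_le continuous_intros) auto
  moreover have "?C' \<subseteq> ?S" using yy by auto
  ultimately have cl: "closure ?C' \<subseteq> ?S" by (rule closure_minimal[rotated])
  show "cone_pr (closure ?C') \<subseteq> cone_pr C"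
    unfolding cone_pr_def
  proof
    fix z assume z: "z \<in> closure ?C' \<inter> sphere 0 1"
    hence zS: "z = ((z \<bullet> y) / (y \<bullet> y)) *\<^sub>R y" "0 \<le> z \<bullet> y" using cl by auto
    have "z \<bullet> y \<noteq> 0" using z zS(1) by auto
    hence "0 < (z \<bullet> y) / (y \<bullet> y)" using zS(2) yy by simp
    hence "z \<in> ?C'" using zS(1) by blast
    thus "z \<in> C \<inter> sphere 0 1" using sub z by blast
  qed
qed

section \<open>Passage to scalar functions by inner products\<close>

locale tempered_tube = tube_cone C v for C :: "(real^'n) set" and v +
  fixes f :: "complex^'n \<Rightarrow> 'h::complex_hilbert_space" and h :: "real^'n \<Rightarrow> 'h" and R :: nat and k :: int
  assumes analytic: "vanalytic_on f (tube C)" and k: "k > 1"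
    and growth: "\<forall>C' r. compact_subcone C' C \<and> r > 0 \<longrightarrow>
      (\<exists>M. \<forall>x. \<forall>y \<in> C' - C' \<inter> cball 0 r.
         norm (f (vcomplex x y)) \<le> M * (1 + norm x) ^ R * norm y powi (- k))"
    and h_L2: "h \<in> Lp_space 2"
    and boundary: "\<forall>\<phi>\<in>schwartz_space. \<forall>C'. compact_subcone C' C \<longrightarrow>
      ((\<lambda>y. norm (strong_integral lebesgue (\<lambda>x. \<phi> x *\<^sub>C f (vcomplex x y))
                 - strong_integral lebesgue (\<lambda>x. \<phi> x *\<^sub>C h x))) \<longlongrightarrow> 0) (at 0 within C')"
begin

lemma nonzero_in_C: "y \<in> C \<Longrightarrow> y \<noteq> 0"
  using C_subset_nrant by (auto simp: nrant_def)

lemma f_differentiable: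
  assumes "y \<in> C"
  obtains D where "(f has_derivative D) (at (vcomplex x y))" "\<And>c w. D (c *s w) = c *\<^sub>C D w"
proof -
  have "vcomplex x y \<in> tube C" using assms by (auto simp: tube_def)
  with analytic obtain e where "0 < e" "\<forall>w\<in>ball (vcomplex x y) e. \<exists>D. (f has_derivative D) (at w) \<and>
       (\<forall>c v. D (c *s v) = c *\<^sub>C D v)" unfolding vanalytic_on_def by blast
  hence "\<exists>D. (f has_derivative D) (at (vcomplex x y)) \<and> (\<forall>c v. D (c *s v) = c *\<^sub>C D v)"
    using centre_in_ball by blast
  thus thesis using that by blast
qed

lemma f_continuous:
  assumes "y \<in> C"
  shows "continuous_on UNIV (\<lambda>x. f (vcomplex x y))"
  unfolding continuous_on_eq_continuous_at[OF open_UNIV]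
proof
  fix x
  obtain D where "(f has_derivative D) (at (vcomplex x y))" using f_differentiable[OF assms] by blast
  hence "isCont f (vcomplex x y)" by (rule has_derivative_continuous)
  moreover have "isCont (\<lambda>x. vcomplex x y) x"
  proof -
    have "(\<lambda>x. vcomplex x y) = (\<lambda>x. \<chi> j. of_real (x $ j) + \<i> * of_real (y $ j))"
      by (simp add: vcomplex_def fun_eq_iff vec_eq_iff complex_eq_iff)
    moreover have "isCont (\<lambda>x. \<chi> j. complex_of_real (x $ j) + \<i> * of_real (y $ j)) x"
      unfolding isCont_def by (intro tendsto_vec_lambda tendsto_intros)
    ultimately show ?thesis by simp
  qed
  ultimately show "isCont (\<lambda>x. f (vcomplex x y)) x" by (rule isCont_o2[rotated])
qed

lemma f_growth:
  assumes y: "y \<in> C" and a: "0 < a"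
  shows "\<exists>M\<ge>0. \<forall>x l. a \<le> l \<longrightarrow> norm (f (vcomplex x (l *\<^sub>R y))) \<le> M * (1 + norm x) ^ R"
proof -
  let ?C' = "{l *\<^sub>R y | l. 0 < l}"
  \<comment> \<open>Half of the least norm on the part of the ray considered, since its points must
    lie outside the closed ball.\<close>
  define r where "r = a * norm y / 2"
  have ny: "0 < norm y" using nonzero_in_C[OF y] by simp
  have r: "0 < r" using a ny by (simp add: r_def)
  from growth compact_subcone_ray[OF cone_C y nonzero_in_C[OF y]] r obtain M where
    M: "\<And>x y'. y' \<in> ?C' - ?C' \<inter> cball 0 r \<Longrightarrow> norm (f (vcomplex x y')) \<le> M * (1 + norm x) ^ R * norm y' powi (- k)"
    by blast
  show ?thesis
  \<comment> \<open>The sign of \<open>M\<close> is not known, hence the absolute value.\<close>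
  proof (intro exI[of _ "\<bar>M\<bar> * inverse (r ^ nat k)"] conjI allI impI)
    show "0 \<le> \<bar>M\<bar> * inverse (r ^ nat k)" using r by simp
    fix x l assume l: "a \<le> l"
    have "0 < l * norm y" using l a ny by simp
    have "a * norm y \<le> l * norm y" using l by (intro mult_right_mono) auto
    hence ln: "r < norm (l *\<^sub>R y)" using l a ny r by (simp add: r_def)
    have pk: "a powi (- k) = inverse (a ^ nat k)" for a :: real
      using k by (simp add: power_int_def power_inverse)
    have inv: "inverse (norm (l *\<^sub>R y) ^ nat k) \<le> inverse (r ^ nat k)"
      using ln r by (intro le_imp_inverse_le power_mono) auto
    have "norm (f (vcomplex x (l *\<^sub>R y))) \<le> M * (1 + norm x) ^ R * inverse (norm (l *\<^sub>R y) ^ nat k)"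
      unfolding pk[symmetric] using ln l a by (intro M) auto
    also have "\<dots> \<le> \<bar>M\<bar> * (1 + norm x) ^ R * inverse (norm (l *\<^sub>R y) ^ nat k)"
      by (intro mult_right_mono) auto
    also have "\<dots> \<le> \<bar>M\<bar> * (1 + norm x) ^ R * inverse (r ^ nat k)"
      by (intro mult_left_mono inv) auto
    finally show "norm (f (vcomplex x (l *\<^sub>R y))) \<le> \<bar>M\<bar> * inverse (r ^ nat k) * (1 + norm x) ^ R"
      by (simp add: mult_ac)
  qed
qed

text \<open>Complex linearity of \<open>D\<close> turns the real chain rule along \<zeta> \<mapsto>
  x + \<zeta> y into a complex derivative, here \<open>cinner (D ?y) e\<close>.\<close>

lemma f_slice_holomorphic:
  assumes y: "y \<in> C"
  shows "(\<lambda>\<zeta>. cinner (f (vcomplex (x + Re \<zeta> *\<^sub>R y) (Im \<zeta> *\<^sub>R y))) e) holomorphic_on {\<zeta>. 0 < Im \<zeta>}"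
  unfolding holomorphic_on_open[OF open_halfspace_Im_gt]
proof
  fix \<zeta> :: complex assume "\<zeta> \<in> {\<zeta>. 0 < Im \<zeta>}"
  hence "Im \<zeta> *\<^sub>R y \<in> C" using scaleR_in_C[OF y] by simp
  then obtain D where D: "(f has_derivative D) (at (vcomplex (x + Re \<zeta> *\<^sub>R y) (Im \<zeta> *\<^sub>R y)))"
    "\<And>c w. D (c *s w) = c *\<^sub>C D w" using f_differentiable by blast
  let ?y = "vcomplex y 0"
  have line: "vcomplex (x + Re \<zeta> *\<^sub>R y) (Im \<zeta> *\<^sub>R y) = vcomplex x 0 + \<zeta> *s ?y" for \<zeta>
    by (simp add: vcomplex_def vec_eq_iff complex_eq_iff)
  have bl: "bounded_linear (\<lambda>c. c *s ?y)"
    by (rule linear_conv_bounded_linear[THEN iffD1]) (auto intro!: linearI simp: vec_eq_iff distrib_right)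
  have "((\<lambda>\<zeta>. vcomplex x 0 + \<zeta> *s ?y) has_derivative (\<lambda>c. c *s ?y)) (at \<zeta>)"
    using has_derivative_add[OF has_derivative_const bounded_linear.has_derivative[OF bl has_derivative_ident]] by simp
  from has_derivative_compose[OF this D(1)[unfolded line]]
  have "((\<lambda>\<zeta>. f (vcomplex x 0 + \<zeta> *s ?y)) has_derivative (\<lambda>c. c *\<^sub>C D ?y)) (at \<zeta>)" by (simp add: D(2))
  from bounded_linear.has_derivative[OF bounded_linear_cinner_left[of e] this]
  have "((\<lambda>\<zeta>. cinner (f (vcomplex x 0 + \<zeta> *s ?y)) e) has_field_derivative cinner (D ?y) e) (at \<zeta>)"
    by (simp add: has_field_derivative_def cinner_scaleC_left mult.commute[of _ "cinner (D ?y) e"])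
  thus "\<exists>f'. ((\<lambda>\<zeta>. cinner (f (vcomplex (x + Re \<zeta> *\<^sub>R y) (Im \<zeta> *\<^sub>R y))) e) has_field_derivative f') (at \<zeta>)"
    unfolding line by blast
qed

lemma h_strongly_measurable: "strongly_measurable lebesgue h"
  using h_L2 by (simp add: Lp_space_def)

lemma norm_h_measurable [measurable]: "(\<lambda>t. norm (h t)) \<in> borel_measurable lebesgue"
  by (rule strongly_measurable_compose_measurable[OF h_strongly_measurable]) (intro continuous_intros)

lemma h_square_finite: "(\<integral>\<^sup>+t. ennreal ((norm (h t))\<^sup>2) \<partial>lebesgue) < \<infinity>"
  using h_L2 by (simp add: Lp_space_def powr_numeral)

text \<open>Splitting at |h| = 1 replaces the Cauchy-Schwarz inequality: a bounded integrable weight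
  is dominated by itself on one part and by a multiple of |h|^2 on the other.\<close>

lemma weighted_h_finite:
  assumes [measurable]: "q \<in> borel_measurable borel" and q: "integrable lborel q" "\<And>t. 0 \<le> q t" "\<And>t. q t \<le> B"
  shows "(\<integral>\<^sup>+t. ennreal (q t * norm (h t)) \<partial>lebesgue) < \<infinity>"
proof -
  have B: "0 \<le> B" using q(2,3) order_trans by blast
  have [measurable]: "q \<in> borel_measurable lebesgue" by (rule borel_measurable_lebesgueI) measurable
  have "(\<integral>\<^sup>+t. ennreal (q t * norm (h t)) \<partial>lebesgue)
      \<le> (\<integral>\<^sup>+t. ennreal B * ennreal ((norm (h t))\<^sup>2) + ennreal (q t) \<partial>lebesgue)"
  proof (rule nn_integral_mono)
    fix t
    have "q t * norm (h t) \<le> B * (norm (h t))\<^sup>2 + q t"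
    proof (cases "norm (h t) \<le> 1")
      case True
      hence "q t * norm (h t) \<le> q t" using q(2) by (intro mult_left_le) auto
      thus ?thesis using B by (simp add: add_increasing)
    next
      case False
      have "q t * norm (h t) \<le> B * norm (h t)" by (intro mult_right_mono q) auto
      also have "\<dots> \<le> B * (norm (h t) * norm (h t))"
        using False B mult_left_mono[of 1 "norm (h t)" "norm (h t)"] by (intro mult_left_mono) auto
      finally show ?thesis using q(2)[of t] by (simp add: power2_eq_square)
    qed
    from ennreal_leI[OF this] show "ennreal (q t * norm (h t)) \<le> ennreal B * ennreal ((norm (h t))\<^sup>2) + ennreal (q t)"
      using B q(2) by (simp add: ennreal_mult)
  qed
  also have "\<dots> = ennreal B * (\<integral>\<^sup>+t. ennreal ((norm (h t))\<^sup>2) \<partial>lebesgue) + (\<integral>\<^sup>+t. ennreal (q t) \<partial>lebesgue)"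
    by (subst nn_integral_add) (auto simp: nn_integral_cmult)
  also have "\<dots> < \<infinity>"
    using h_square_finite q(1,2) by (auto simp: nn_integral_completion ennreal_mult_less_top nn_integral_eq_integral less_top)
  finally show ?thesis .
qed

text \<open>\<open>g\<close> is a Borel version of the inner product with \<open>e\<close>; it is
  chosen for each \<open>e\<close> separately, with a null set that may depend on
  \<open>e\<close>.\<close>

lemma scalar_tube_cinner:
  assumes g [measurable]: "g \<in> borel_measurable borel" and ae: "AE t in lborel. cinner (h t) e = g t"
  shows "scalar_tube C v (\<lambda>x y. cinner (f (vcomplex x y)) e) g R"
proof
  show "(\<lambda>\<zeta>. cinner (f (vcomplex (x + Re \<zeta> *\<^sub>R y) (Im \<zeta> *\<^sub>R y))) e) holomorphic_on {\<zeta>. 0 < Im \<zeta>}"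
    if "y \<in> C" for x y using that by (rule f_slice_holomorphic)
  show "continuous_on UNIV (\<lambda>x. cinner (f (vcomplex x y)) e)" if "y \<in> C" for y
    by (rule bounded_linear.continuous_on[OF bounded_linear_cinner_left f_continuous[OF that]])
  show "\<exists>M. \<forall>x l. a \<le> l \<longrightarrow> cmod (cinner (f (vcomplex x (l *\<^sub>R y))) e) \<le> M * (1 + norm x) ^ R"
    if y: "y \<in> C" and a: "0 < a" for y a
  proof -
    from f_growth[OF y a] obtain M where M: "\<And>x l. a \<le> l \<Longrightarrow> norm (f (vcomplex x (l *\<^sub>R y))) \<le> M * (1 + norm x) ^ R" by blast
    show ?thesis
    proof (intro exI[of _ "M * norm e"] allI impI)
      fix x l assume l: "a \<le> l"
      have "cmod (cinner (f (vcomplex x (l *\<^sub>R y))) e) \<le> norm (f (vcomplex x (l *\<^sub>R y))) * norm e"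
        by (rule cinner_Cauchy_Schwarz)
      also have "\<dots> \<le> (M * (1 + norm x) ^ R) * norm e" using l by (intro mult_right_mono M) auto
      finally show "cmod (cinner (f (vcomplex x (l *\<^sub>R y))) e) \<le> M * norm e * (1 + norm x) ^ R" by (simp add: mult_ac)
    qed
  qed
  show "g \<in> borel_measurable borel" by fact
  show "integrable lborel (\<lambda>t. (cmod (g t))\<^sup>2)"
  proof (rule integrableI_bounded)
    have "(\<integral>\<^sup>+t. ennreal (norm ((cmod (g t))\<^sup>2)) \<partial>lborel) = (\<integral>\<^sup>+t. ennreal ((cmod (cinner (h t) e))\<^sup>2) \<partial>lborel)"
      using ae by (intro nn_integral_cong_AE) (auto elim: eventually_mono)
    also have "\<dots> = (\<integral>\<^sup>+t. ennreal ((cmod (cinner (h t) e))\<^sup>2) \<partial>lebesgue)" by (simp only: nn_integral_completion)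
    also have "\<dots> \<le> (\<integral>\<^sup>+t. ennreal ((norm e)\<^sup>2) * ennreal ((norm (h t))\<^sup>2) \<partial>lebesgue)"
    proof (rule nn_integral_mono)
      fix t
      have "(cmod (cinner (h t) e))\<^sup>2 \<le> (norm (h t) * norm e)\<^sup>2"
        by (intro power_mono cinner_Cauchy_Schwarz) simp
      hence "(cmod (cinner (h t) e))\<^sup>2 \<le> (norm e)\<^sup>2 * (norm (h t))\<^sup>2"
        by (simp only: power_mult_distrib mult.commute)
      from ennreal_leI[OF this] show "ennreal ((cmod (cinner (h t) e))\<^sup>2) \<le> ennreal ((norm e)\<^sup>2) * ennreal ((norm (h t))\<^sup>2)"
        by (simp add: ennreal_mult)
    qed
    also have "\<dots> = ennreal ((norm e)\<^sup>2) * (\<integral>\<^sup>+t. ennreal ((norm (h t))\<^sup>2) \<partial>lebesgue)"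
      by (intro nn_integral_cmult) measurable
    also have "\<dots> < \<infinity>" using h_square_finite by (simp add: ennreal_mult_less_top)
    finally show "(\<integral>\<^sup>+t. ennreal (norm ((cmod (g t))\<^sup>2)) \<partial>lborel) < \<infinity>" .
  qed measurable
next
  fix y p q :: "real^'n" and d :: real assume y: "y \<in> C" and d: "0 < d"
  let ?\<phi> = "\<lambda>t. gauss d (p - t) q"
  let ?C' = "{l *\<^sub>R y | l. 0 < l}"
  let ?E = "exp (pi / d\<^sup>2 * (norm q)\<^sup>2)"
  have mb: "?\<phi> \<in> borel_measurable borel" by (intro gauss_measurable) auto
  have m\<phi>: "?\<phi> \<in> borel_measurable lebesgue" by (rule borel_measurable_lebesgueI[OF mb])
  \<comment> \<open>At a fixed height the Gaussian outweighs the polynomial growth of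
    \<open>f\<close>, so the strong integral exists and the inner product may be taken inside;
    without existence \<open>strong_integral\<close> would be the default value 0.\<close>
  have eqf: "cinner (strong_integral lebesgue (\<lambda>t. ?\<phi> t *\<^sub>C f (vcomplex t (l *\<^sub>R y)))) e
      = (LBINT t. cinner (f (vcomplex t (l *\<^sub>R y))) e * ?\<phi> t)" if l: "0 < l" for l
  proof -
    have ly: "l *\<^sub>R y \<in> C" by (rule scaleR_in_C[OF y l])
    have sm: "strongly_measurable lebesgue (\<lambda>t. ?\<phi> t *\<^sub>C f (vcomplex t (l *\<^sub>R y)))"
      by (intro strongly_measurable_scaleC m\<phi> strongly_measurable_continuous f_continuous ly)
         (auto intro: borel_measurable_lebesgueI)
    from f_growth[OF y l] obtain M where M: "0 \<le> M" "\<And>x. norm (f (vcomplex x (l *\<^sub>R y))) \<le> M * (1 + norm x) ^ R" by blast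
    from gauss_translate_bound[OF d, of "norm p" R] obtain A where A: "0 \<le> A"
      "\<And>t. (1 + norm t) ^ R * rgauss d (p - t) \<le> A * pweight t" by blast
    have "(\<integral>\<^sup>+t. ennreal (norm (?\<phi> t *\<^sub>C f (vcomplex t (l *\<^sub>R y)))) \<partial>lebesgue)
        \<le> (\<integral>\<^sup>+t. ennreal (M * ?E * A * pweight (t::real^'n)) \<partial>lebesgue)"
    proof (intro nn_integral_mono ennreal_leI)
      fix t
      have "norm (?\<phi> t *\<^sub>C f (vcomplex t (l *\<^sub>R y))) \<le> (rgauss d (p - t) * ?E) * (M * (1 + norm t) ^ R)"
        unfolding norm_scaleC cmod_gauss[OF d]
        by (intro mult_left_mono M mult_nonneg_nonneg rgauss_nonneg d) auto
      also have "\<dots> = M * ?E * ((1 + norm t) ^ R * rgauss d (p - t))" by (simp only: ac_simps)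
      also have "\<dots> \<le> M * ?E * (A * pweight t)" using M(1) by (intro mult_left_mono A) auto
      finally show "norm (?\<phi> t *\<^sub>C f (vcomplex t (l *\<^sub>R y))) \<le> M * ?E * A * pweight t" by (simp only: mult.assoc)
    qed
    also have "\<dots> < \<infinity>"
    proof -
      have i: "integrable lborel (\<lambda>t::real^'n. M * ?E * A * pweight t)" by (intro integrable_mult_right integrable_pweight)
      have "0 \<le> M * ?E * A * pweight t" for t :: "real^'n"
        using M(1) A(1) pweight_nonneg[of t] by (intro mult_nonneg_nonneg) auto
      thus ?thesis using i by (subst nn_integral_completion, subst nn_integral_eq_integral) auto
    qed
    finally have "cinner (strong_integral lebesgue (\<lambda>t. ?\<phi> t *\<^sub>C f (vcomplex t (l *\<^sub>R y)))) e
      = (\<integral>t. cinner (?\<phi> t *\<^sub>C f (vcomplex t (l *\<^sub>R y))) e \<partial>lebesgue)"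
      by (rule cinner_strong_integral[OF sm])
    also have "\<dots> = (\<integral>t. cinner (f (vcomplex t (l *\<^sub>R y))) e * ?\<phi> t \<partial>lebesgue)"
      by (simp only: cinner_scaleC_left mult.commute)
    also have "\<dots> = (LBINT t. cinner (f (vcomplex t (l *\<^sub>R y))) e * ?\<phi> t)"
    proof (rule integral_completion)
      have "(\<lambda>t. cinner (f (vcomplex t (l *\<^sub>R y))) e) \<in> borel_measurable borel"
        by (intro borel_measurable_continuous_onI bounded_linear.continuous_on[OF bounded_linear_cinner_left f_continuous[OF ly]])
      thus "(\<lambda>t. cinner (f (vcomplex t (l *\<^sub>R y))) e * ?\<phi> t) \<in> borel_measurable lborel"
        using mb by simp
    qed
    finally show ?thesis .
  qed
  have eqh: "cinner (strong_integral lebesgue (\<lambda>t. ?\<phi> t *\<^sub>C h t)) e = (LBINT t. g t * ?\<phi> t)"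
  proof -
    have sm: "strongly_measurable lebesgue (\<lambda>t. ?\<phi> t *\<^sub>C h t)"
      by (intro strongly_measurable_scaleC m\<phi> h_strongly_measurable)
    from gauss_translate_bound[OF d, of "norm p" 0] obtain A where A: "0 \<le> A"
      "\<And>t. rgauss d (p - t) \<le> A * pweight t" by auto
    have b: "cmod (?\<phi> t) \<le> A * ?E * pweight t" for t
      unfolding cmod_gauss[OF d] using mult_right_mono[OF A(2)[of t], of ?E] by (simp add: mult_ac)
    have "(\<integral>\<^sup>+t. ennreal (cmod (?\<phi> t) * norm (h t)) \<partial>lebesgue) < \<infinity>"
    proof (rule weighted_h_finite)
      show "(\<lambda>t. cmod (?\<phi> t)) \<in> borel_measurable borel" using mb by measurable
      thus "integrable lborel (\<lambda>t. cmod (?\<phi> t))"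
        by (rule integrable_pweight_bound[where A="A * ?E"]) (use b in simp)
      show "cmod (?\<phi> t) \<le> A * ?E" for t
        using order_trans[OF b mult_left_mono[OF pweight_le_1]] A(1) by simp
    qed simp
    hence "cinner (strong_integral lebesgue (\<lambda>t. ?\<phi> t *\<^sub>C h t)) e = (\<integral>t. cinner (?\<phi> t *\<^sub>C h t) e \<partial>lebesgue)"
      by (intro cinner_strong_integral sm) (simp add: norm_scaleC)
    also have "\<dots> = (\<integral>t. g t * ?\<phi> t \<partial>lebesgue)"
    proof (rule integral_cong_AE)
      have "(\<lambda>t. cinner (h t) e) \<in> borel_measurable lebesgue"
        by (rule strongly_measurable_compose_measurable[OF h_strongly_measurable])
           (intro bounded_linear.continuous_on[OF bounded_linear_cinner_left] continuous_on_id)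
      thus "(\<lambda>t. cinner (?\<phi> t *\<^sub>C h t) e) \<in> borel_measurable lebesgue"
        using m\<phi> by (simp add: cinner_scaleC_left)
      show "(\<lambda>t. g t * ?\<phi> t) \<in> borel_measurable lebesgue"
        using mb by (intro borel_measurable_lebesgueI) measurable
      show "AE t in lebesgue. cinner (?\<phi> t *\<^sub>C h t) e = g t * ?\<phi> t"
        using AE_completion[OF ae] by eventually_elim (simp add: cinner_scaleC_left)
    qed
    also have "\<dots> = (LBINT t. g t * ?\<phi> t)" by (rule integral_completion) (use mb in simp)
    finally show ?thesis .
  qed
  have "((\<lambda>y'. norm (strong_integral lebesgue (\<lambda>x. ?\<phi> x *\<^sub>C f (vcomplex x y'))
      - strong_integral lebesgue (\<lambda>x. ?\<phi> x *\<^sub>C h x))) \<longlongrightarrow> 0) (at 0 within ?C')"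
    by (rule boundary[rule_format, OF gauss_schwartz[OF d] compact_subcone_ray[OF cone_C y nonzero_in_C[OF y]]])
  \<comment> \<open>Composition with l \<mapsto> l y turns the limit within the ray, taken as a
    compact subcone, into a one-sided limit in \<open>l\<close>.\<close>
  moreover have "filterlim (\<lambda>l. l *\<^sub>R y) (at 0 within ?C') (at_right 0)"
    unfolding filterlim_at
  proof
    have "((\<lambda>l. l *\<^sub>R y) \<longlongrightarrow> 0 *\<^sub>R y) (at_right 0)" by (intro tendsto_intros)
    thus "((\<lambda>l. l *\<^sub>R y) \<longlongrightarrow> 0) (at_right 0)" by simp
    show "\<forall>\<^sub>F l in at_right 0. l *\<^sub>R y \<in> ?C' \<and> l *\<^sub>R y \<noteq> 0"
      using nonzero_in_C[OF y] by (auto simp: eventually_at intro!: exI[of _ 1])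
  qed
  ultimately have lim: "((\<lambda>l. norm (strong_integral lebesgue (\<lambda>x. ?\<phi> x *\<^sub>C f (vcomplex x (l *\<^sub>R y)))
      - strong_integral lebesgue (\<lambda>x. ?\<phi> x *\<^sub>C h x))) \<longlongrightarrow> 0) (at_right 0)"
    by (rule filterlim_compose)
  have "((\<lambda>l. (LBINT t. cinner (f (vcomplex t (l *\<^sub>R y))) e * ?\<phi> t) - (LBINT t. g t * ?\<phi> t)) \<longlongrightarrow> 0) (at_right 0)"
  proof (rule Lim_null_comparison)
    show "((\<lambda>l. norm (strong_integral lebesgue (\<lambda>x. ?\<phi> x *\<^sub>C f (vcomplex x (l *\<^sub>R y)))
      - strong_integral lebesgue (\<lambda>x. ?\<phi> x *\<^sub>C h x)) * norm e) \<longlongrightarrow> 0) (at_right 0)"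
      using tendsto_mult_left_zero[OF lim] .
    have "cmod ((LBINT t. cinner (f (vcomplex t (l *\<^sub>R y))) e * ?\<phi> t) - (LBINT t. g t * ?\<phi> t))
      \<le> norm (strong_integral lebesgue (\<lambda>x. ?\<phi> x *\<^sub>C f (vcomplex x (l *\<^sub>R y)))
      - strong_integral lebesgue (\<lambda>x. ?\<phi> x *\<^sub>C h x)) * norm e" if "0 < l" for l
      unfolding eqf[OF that, symmetric] eqh[symmetric] cinner_diff_left[symmetric] by (rule cinner_Cauchy_Schwarz)
    thus "\<forall>\<^sub>F l in at_right 0. norm ((LBINT t. cinner (f (vcomplex t (l *\<^sub>R y))) e * ?\<phi> t) - (LBINT t. g t * ?\<phi> t))
      \<le> norm (strong_integral lebesgue (\<lambda>x. ?\<phi> x *\<^sub>C f (vcomplex x (l *\<^sub>R y)))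
      - strong_integral lebesgue (\<lambda>x. ?\<phi> x *\<^sub>C h x)) * norm e"
      by (auto simp: eventually_at intro!: exI[of _ 1])
  qed
  thus "((\<lambda>l. LBINT t. cinner (f (vcomplex t (l *\<^sub>R y))) e * ?\<phi> t) \<longlongrightarrow> (LBINT t. g t * ?\<phi> t)) (at_right 0)"
    using Lim_null by blast
qed

text \<open>Existence comes first, from integrability of the norm; the value is then identified by
  testing with every \<open>e\<close>. The null set of the Borel version may vary with
  \<open>e\<close>, since each test concerns one \<open>e\<close> only.\<close>

lemma poisson_integral:
  assumes y: "y \<in> C"
  shows "has_strong_integral lebesgue (\<lambda>t. of_real (poisson x y t) *\<^sub>C h t) (f (vcomplex x y))"
proof -
  have mp: "(\<lambda>t. complex_of_real (poisson x y t)) \<in> borel_measurable borel" by measurable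
  have mp': "(\<lambda>t. complex_of_real (poisson x y t)) \<in> borel_measurable lebesgue"
    by (rule borel_measurable_lebesgueI[OF mp])
  have sm: "strongly_measurable lebesgue (\<lambda>t. complex_of_real (poisson x y t) *\<^sub>C h t)"
    by (intro strongly_measurable_scaleC mp' h_strongly_measurable)
  have "(\<integral>\<^sup>+t. ennreal (poisson x y t * norm (h t)) \<partial>lebesgue) < \<infinity>"
    by (rule weighted_h_finite[OF _ integrable_poisson[OF y] poisson_nonneg poisson_le[OF y]]) measurable
  hence "(\<integral>\<^sup>+t. ennreal (norm (complex_of_real (poisson x y t) *\<^sub>C h t)) \<partial>lebesgue) < \<infinity>"
    by (simp add: norm_scaleC poisson_nonneg)
  from has_strong_integralI_bounded[OF sm this] obtain I where
    I: "has_strong_integral lebesgue (\<lambda>t. complex_of_real (poisson x y t) *\<^sub>C h t) I" by blast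
  have "I = f (vcomplex x y)"
  proof (rule cinner_eqI)
    fix e
    have mh: "(\<lambda>t. cinner (h t) e) \<in> borel_measurable lebesgue"
      by (rule strongly_measurable_compose_measurable[OF h_strongly_measurable])
         (intro bounded_linear.continuous_on[OF bounded_linear_cinner_left] continuous_on_id)
    then obtain g where g: "g \<in> borel_measurable lborel" "AE t in lborel. cinner (h t) e = g t"
      by (rule borel_version_complex)
    hence [measurable]: "g \<in> borel_measurable borel" by simp
    interpret scalar_tube C v "\<lambda>x y. cinner (f (vcomplex x y)) e" g R
      by (rule scalar_tube_cinner) (use g in auto)
    have "cinner I e = (\<integral>t. cinner (complex_of_real (poisson x y t) *\<^sub>C h t) e \<partial>lebesgue)"
      using has_bochner_integral_integral_eq[OF has_strong_integral_cinner[OF I]] by simp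
    also have "\<dots> = (\<integral>t. g t * of_real (poisson x y t) \<partial>lebesgue)"
    proof (rule integral_cong_AE)
      show "(\<lambda>t. cinner (complex_of_real (poisson x y t) *\<^sub>C h t) e) \<in> borel_measurable lebesgue"
        unfolding cinner_scaleC_left using mh mp' by (intro borel_measurable_times)
      show "(\<lambda>t. g t * of_real (poisson x y t)) \<in> borel_measurable lebesgue"
        by (rule borel_measurable_lebesgueI) measurable
      show "AE t in lebesgue. cinner (complex_of_real (poisson x y t) *\<^sub>C h t) e = g t * of_real (poisson x y t)"
        using AE_completion[OF g(2)] by eventually_elim (simp add: cinner_scaleC_left)
    qed
    also have "\<dots> = (LBINT t. g t * of_real (poisson x y t))"
      by (rule integral_completion) (use mp in simp)
    also have "\<dots> = cinner (f (vcomplex x y)) e" by (rule poisson_representation[OF y, symmetric])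
    finally show "cinner I e = cinner (f (vcomplex x y)) e" .
  qed
  with I show ?thesis by simp
qed

lemma hardy_bound:
  assumes y: "y \<in> C"
  shows "(\<integral>\<^sup>+x. ennreal ((norm (f (vcomplex x y)))\<^sup>2) \<partial>lebesgue) \<le> (\<integral>\<^sup>+t. ennreal ((norm (h t))\<^sup>2) \<partial>lebesgue)"
proof -
  \<comment> \<open>A Borel version of the norm makes Tonelli's theorem on \<open>lborel\<close>
    applicable; it may be negative on a null set, hence the absolute values.\<close>
  obtain H where H [measurable]: "H \<in> borel_measurable lborel" and ae: "AE t in lborel. norm (h t) = H t"
    using completion_ex_borel_measurable_real[OF norm_h_measurable] by blast
  have pw: "ennreal ((norm (f (vcomplex x y)))\<^sup>2) \<le> (\<integral>\<^sup>+t. ennreal (poisson x y t) * (ennreal \<bar>H t\<bar>)\<^sup>2 \<partial>lborel)" for x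
  proof -
    \<comment> \<open>Square roots split the kernel evenly: Cauchy-Schwarz with the square root of Q
      as one factor is Jensen's inequality for a measure of mass at most 1.\<close>
    let ?s = "\<lambda>t. ennreal (sqrt (poisson x y t))"
    have ss: "?s t * ?s t = ennreal (poisson x y t)" for t
      using poisson_nonneg by (simp flip: ennreal_mult)
    have "ennreal (norm (f (vcomplex x y))) \<le> (\<integral>\<^sup>+t. ennreal (norm (complex_of_real (poisson x y t) *\<^sub>C h t)) \<partial>lebesgue)"
      by (rule norm_has_strong_integral_le[OF poisson_integral[OF y]])
    also have "\<dots> = (\<integral>\<^sup>+t. ennreal (norm (complex_of_real (poisson x y t) *\<^sub>C h t)) \<partial>lborel)"
      by (rule nn_integral_completion)
    also have "\<dots> = (\<integral>\<^sup>+t. (?s t * ennreal \<bar>H t\<bar>) * ?s t \<partial>lborel)"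
    proof (rule nn_integral_cong_AE)
      show "AE t in lborel. ennreal (norm (complex_of_real (poisson x y t) *\<^sub>C h t)) = (?s t * ennreal \<bar>H t\<bar>) * ?s t"
        using ae
      proof eventually_elim
        case (elim t)
        have "(?s t * ennreal \<bar>H t\<bar>) * ?s t = ennreal (poisson x y t) * ennreal \<bar>H t\<bar>"
          unfolding ss[symmetric] by (simp only: ac_simps)
        also have "\<dots> = ennreal (norm (complex_of_real (poisson x y t) *\<^sub>C h t))"
          using poisson_nonneg[of x y t] norm_ge_zero[of "h t"] unfolding elim
          by (simp add: norm_scaleC elim flip: ennreal_mult)
        finally show ?case ..
      qed
    qed
    finally have "(ennreal (norm (f (vcomplex x y))))\<^sup>2 \<le> (\<integral>\<^sup>+t. (?s t * ennreal \<bar>H t\<bar>) * ?s t \<partial>lborel)\<^sup>2"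
      by (rule power_mono) simp
    also have "\<dots> \<le> (\<integral>\<^sup>+t. (?s t * ennreal \<bar>H t\<bar>)\<^sup>2 \<partial>lborel) * (\<integral>\<^sup>+t. (?s t)\<^sup>2 \<partial>lborel)"
      by (rule Cauchy_Schwarz_nn_integral) measurable
    also have "\<dots> \<le> (\<integral>\<^sup>+t. (?s t * ennreal \<bar>H t\<bar>)\<^sup>2 \<partial>lborel) * 1"
      using nn_integral_poisson_le_1(1)[OF y, of x] by (intro mult_left_mono) (simp_all add: power2_eq_square ss)
    also have "\<dots> = (\<integral>\<^sup>+t. ennreal (poisson x y t) * (ennreal \<bar>H t\<bar>)\<^sup>2 \<partial>lborel)"
      by (simp only: power_mult_distrib mult_1_right) (simp only: power2_eq_square ss)
    finally show ?thesis by (simp add: ennreal_power)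
  qed
  have "(\<integral>\<^sup>+x. ennreal ((norm (f (vcomplex x y)))\<^sup>2) \<partial>lebesgue) = (\<integral>\<^sup>+x. ennreal ((norm (f (vcomplex x y)))\<^sup>2) \<partial>lborel)"
    by (rule nn_integral_completion)
  also have "\<dots> \<le> (\<integral>\<^sup>+x. \<integral>\<^sup>+t. ennreal (poisson x y t) * (ennreal \<bar>H t\<bar>)\<^sup>2 \<partial>lborel \<partial>lborel)"
    by (rule nn_integral_mono) (rule pw)
  also have "\<dots> = (\<integral>\<^sup>+t. \<integral>\<^sup>+x. ennreal (poisson x y t) * (ennreal \<bar>H t\<bar>)\<^sup>2 \<partial>lborel \<partial>lborel)"
    by (rule lborel_pair.Fubini') measurable
  also have "\<dots> = (\<integral>\<^sup>+t. (\<integral>\<^sup>+x. ennreal (poisson x y t) \<partial>lborel) * (ennreal \<bar>H t\<bar>)\<^sup>2 \<partial>lborel)"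
    by (intro nn_integral_cong nn_integral_multc) measurable
  also have "\<dots> \<le> (\<integral>\<^sup>+t. 1 * (ennreal \<bar>H t\<bar>)\<^sup>2 \<partial>lborel)"
    by (intro nn_integral_mono mult_right_mono nn_integral_poisson_le_1(2)[OF y]) simp
  also have "\<dots> = (\<integral>\<^sup>+t. ennreal ((norm (h t))\<^sup>2) \<partial>lborel)"
    using ae by (intro nn_integral_cong_AE) (auto elim!: eventually_mono simp: ennreal_power)
  also have "\<dots> = (\<integral>\<^sup>+t. ennreal ((norm (h t))\<^sup>2) \<partial>lebesgue)" by (rule nn_integral_completion[symmetric])
  finally show ?thesis .
qed

lemma in_hardy_space: "f \<in> hardy_space 2 C"
proof -
  let ?A = "\<integral>\<^sup>+t. ennreal ((norm (h t))\<^sup>2) \<partial>lebesgue"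
  have "ennreal (enn2real ?A) = ?A" using h_square_finite by simp
  hence "\<forall>y\<in>C. (\<integral>\<^sup>+x. ennreal (norm (f (vcomplex x y)) powr 2) \<partial>lebesgue) \<le> ennreal (enn2real ?A)"
    using hardy_bound by (simp add: powr_numeral)
  thus ?thesis using analytic unfolding hardy_space_def by blast
qed

end

theorem theorem4p2:
  fixes C :: "(real^'n) set"
    and f :: "complex^'n \<Rightarrow> 'h::complex_hilbert_space"
    and h :: "real^'n \<Rightarrow> 'h"
    and v :: "nat^'n"
    and R :: nat and k :: int
  assumes "open C" "convex C" "vertex_cone C"
    and "\<forall>j. v $ j \<in> {0, 1}" and "C \<subseteq> nrant v"
    and "vanalytic_on f (tube C)"
    and "k > 1"
    and "\<forall>C' r. compact_subcone C' C \<and> r > 0 \<longrightarrow>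
      (\<exists>M. \<forall>x. \<forall>y \<in> C' - C' \<inter> cball 0 r.
         norm (f (vcomplex x y)) \<le> M * (1 + norm x) ^ R * norm y powi (- k))"
    and "h \<in> Lp_space 2"
    and "\<forall>\<phi>\<in>schwartz_space. \<forall>C'. compact_subcone C' C \<longrightarrow>
      ((\<lambda>y. norm (strong_integral lebesgue (\<lambda>x. \<phi> x *\<^sub>C f (vcomplex x y))
                 - strong_integral lebesgue (\<lambda>x. \<phi> x *\<^sub>C h x))) \<longlongrightarrow> 0) (at 0 within C')"
  shows "f \<in> hardy_space 2 C \<and>
    (\<forall>z\<in>tube C. has_strong_integral lebesgue (\<lambda>t. poisson_kernel C z t *\<^sub>C h t) (f z))"
proof -
  interpret tempered_tube C v f h R k
    by unfold_locales fact+
  have "has_strong_integral lebesgue (\<lambda>t. poisson_kernel C z t *\<^sub>C h t) (f z)" if "z \<in> tube C" for z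
  proof -
    from that obtain x y where "z = vcomplex x y" "y \<in> C" by (auto simp: tube_def)
    thus ?thesis using poisson_integral[of y x] by (simp add: poisson_kernel_eq)
  qed
  thus ?thesis using in_hardy_space by blast
qed

end
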